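(* For every simple closed geodesic $\gamma$ on the modular torus $\mathfrak X$, $\tau_{\mathfrak X}(\gamma)\neq0$.
   Context: The modular torus is $\mathfrak X=\mathbb{H}^2/\Gamma$, where $\Gamma$ is the commutator subgroup of $\mathrm{PSL}(2,\mathbb{Z})$; it is a complete finite-area hyperbolic once-punctured torus. Relative twist: let $\gamma$ be a simple closed geodesic on $\mathfrak X$ of length $\ell_{\mathfrak X}(\gamma)$, with a chosen orientation (the result does not depend on this choice). The completion of $\mathfrak X\setminus\gamma$ is a pair of pants with two geodesic boundary components and one cusp. From each geodesic boundary component there is exactly one simple orthogeodesic to the cusp; let $A_l$ and $A_r$ be the feet on $\gamma$ of the orthogeodesics on the left and right sides of $\gamma$, respectively. The absolute twist $\mathrm{tw}_{\mathfrak X}(\gamma)\in[0,\ell_{\mathfrak X}(\gamma))$ is the distance travelled from $A_l$ to the first arrival at $A_r$ along $\gamma$ in its positive direction (and is $0$ if $A_l=A_r$). The relative twist is $\tau_{\mathfrak X}(\gamma)=\mathrm{tw}_{\mathfrak X}(\gamma)/\ell_{\mathfrak X}(\gamma)$. *)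

theory Defs
  imports "HOL-Analysis.Complex_Transcendental" "HOL-Algebra.Bij"
    "HOL-Algebra.Generated_Groups" "HOL-Algebra.Group_Action"
begin

section \<open>The hyperbolic plane\<close>

definition uhp :: "complex set" where
  "uhp = {z. 0 < Im z}"

definition hdist :: "complex \<Rightarrow> complex \<Rightarrow> real" where
  "hdist z w = arcosh (1 + (cmod (z - w))\<^sup>2 / (2 * Im z * Im w))"

text \<open>In the hyperbolic plane every geodesic is globally minimising, so the unit-speed
  geodesics parametrised by an interval are its isometric embeddings.\<close>

definition hgeodesic_on :: "real set \<Rightarrow> (real \<Rightarrow> complex) \<Rightarrow> bool" where
  "hgeodesic_on I c \<longleftrightarrow> c ` I \<subseteq> uhp \<and> (\<forall>s\<in>I. \<forall>t\<in>I. hdist (c s) (c t) = \<bar>s - t\<bar>)"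

section \<open>The modular torus\<close>

text \<open>\<open>PSL(2,\<int>)\<close> is represented by its faithful action on the upper half-plane: two integer
  matrices of determinant 1 give the same transformation iff they agree up to sign.\<close>

definition PSL2Z :: "(complex \<Rightarrow> complex) monoid" where
  "PSL2Z = BijGroup uhp
     \<lparr>carrier := {restrict (moebius (of_int a) (of_int b) (of_int c) (of_int d)) uhp
                   | a b c d :: int. a * d - b * c = 1}\<rparr>"

definition \<Gamma> :: "(complex \<Rightarrow> complex) monoid" where
  "\<Gamma> = PSL2Z\<lparr>carrier := derived PSL2Z (carrier PSL2Z)\<rparr>"

definition torus_proj :: "complex \<Rightarrow> complex set" where
  "torus_proj z = orbit \<Gamma> (\<lambda>g. g) z"

definition modular_torus :: "complex set set" where
  "modular_torus = torus_proj ` uhp"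

text \<open>\<open>\<Gamma>\<close> has a single conjugacy class of maximal parabolic subgroups, represented by the
  stabiliser of \<open>\<infinity>\<close>. So these are the standard neighbourhoods of the cusp.\<close>

definition cusp_nbhd :: "real \<Rightarrow> complex set set" where
  "cusp_nbhd h = torus_proj ` {z \<in> uhp. h < Im z}"

section \<open>Simple closed geodesics\<close>

text \<open>\<open>\<Gamma>\<close> acts freely, so \<open>torus_proj\<close> is a local isometry on the upper half-plane, and
  the complete unit-speed geodesics of the torus are the images of those of the plane.\<close>

definition lifts_to :: "(real \<Rightarrow> complex set) \<Rightarrow> (real \<Rightarrow> complex) \<Rightarrow> bool" where
  "lifts_to \<gamma> c \<longleftrightarrow> hgeodesic_on UNIV c \<and> (\<forall>t. \<gamma> t = torus_proj (c t))"

lemma lifts_to_imp_range_subset: "lifts_to \<gamma> c \<Longrightarrow> range \<gamma> \<subseteq> modular_torus"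
  by (auto simp: lifts_to_def modular_torus_def hgeodesic_on_def)

text \<open>A closed geodesic is given by a unit-speed parametrisation on the whole real line; this
  includes the choice of an orientation.\<close>

definition simple_closed_geodesic :: "(real \<Rightarrow> complex set) \<Rightarrow> bool" where
  "simple_closed_geodesic \<gamma> \<longleftrightarrow>
     (\<exists>c. lifts_to \<gamma> c) \<and>
     (\<exists>l>0. (\<forall>t. \<gamma> (t + l) = \<gamma> t) \<and> inj_on \<gamma> {0..<l})"

text \<open>By unit speed, the length is the least period.\<close>

definition geodesic_length :: "(real \<Rightarrow> complex set) \<Rightarrow> real" where
  "geodesic_length \<gamma> = (LEAST l. 0 < l \<and> (\<forall>t. \<gamma> (t + l) = \<gamma> t))"

section \<open>Orthogeodesics to the cusp and the twist\<close>

text \<open>The geodesic ray \<open>torus_proj \<circ> r\<close> leaves \<open>\<gamma>\<close> at \<open>\<gamma> s\<close> and runs into the cusp. The parameter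
  \<open>u\<close> is \<open>\<i>\<close> for the left and \<open>-\<i>\<close> for the right side of \<open>\<gamma>\<close>: the hyperbolic metric is conformal
  and both curves have unit speed, so the initial velocity of \<open>r\<close> is the velocity \<open>v\<close> of the
  lift of \<open>\<gamma>\<close> turned by \<open>\<plusminus>\<pi>/2\<close>. The ray is an orthogeodesic of the completion of the complement
  of \<open>\<gamma>\<close>, so it may meet \<open>\<gamma>\<close> only in its foot.\<close>

definition simple_cusp_orthogeodesic ::
    "(real \<Rightarrow> complex set) \<Rightarrow> complex \<Rightarrow> real \<Rightarrow> (real \<Rightarrow> complex) \<Rightarrow> bool" where
  "simple_cusp_orthogeodesic \<gamma> u s r \<longleftrightarrow>
     hgeodesic_on {0..} r \<and>
     (\<exists>c v. lifts_to \<gamma> c \<and> r 0 = c s \<and>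
        (c has_vector_derivative v) (at s) \<and>
        (r has_vector_derivative u * v) (at 0 within {0..})) \<and>
     (\<forall>h. eventually (\<lambda>t. torus_proj (r t) \<in> cusp_nbhd h) at_top) \<and>
     inj_on (\<lambda>t. torus_proj (r t)) {0..} \<and>
     (\<forall>t>0. torus_proj (r t) \<notin> range \<gamma>)"

definition left_foot :: "(real \<Rightarrow> complex set) \<Rightarrow> complex set" where
  "left_foot \<gamma> = (THE A. \<exists>s r. simple_cusp_orthogeodesic \<gamma> \<i> s r \<and> A = \<gamma> s)"

definition right_foot :: "(real \<Rightarrow> complex set) \<Rightarrow> complex set" where
  "right_foot \<gamma> = (THE A. \<exists>s r. simple_cusp_orthogeodesic \<gamma> (- \<i>) s r \<and> A = \<gamma> s)"

definition absolute_twist :: "(real \<Rightarrow> complex set) \<Rightarrow> real" where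
  "absolute_twist \<gamma> =
     (LEAST t. 0 \<le> t \<and> (\<exists>s. \<gamma> s = left_foot \<gamma> \<and> \<gamma> (s + t) = right_foot \<gamma>))"

definition relative_twist :: "(real \<Rightarrow> complex set) \<Rightarrow> real" where
  "relative_twist \<gamma> = absolute_twist \<gamma> / geodesic_length \<gamma>"

end

theory Submission
  imports Defs
begin

text \<open>The lifts of a simple closed geodesic to the upper half-plane are semicircles that do not cross, so
their pairs of end points form a \<open>\<Gamma>\<close>-invariant family of unlinked pairs of reals. The end points are
conjugate quadratic irrationals, because they are the fixed points of an integer matrix.

The once-punctured torus has a hyperelliptic involution. Among its lifts are the half-turns about
points over rationals \<open>p / q\<close> with \<open>q dvd p\<^sup>2 + 1\<close> and the translations by odd multiples of
\<open>3\<close>. A simple closed geodesic is mapped to itself by this involution, with its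
orientation reversed, and this symmetry is what makes the twist nonzero.

To obtain the symmetry without the classification of simple closed curves, consider triples of
half-turns that bound an ideal triangulation with vertical edges, the frames below; their
denominators form a Markoff triple (\<open>frame_markoff\<close>). The number of lifts that cross the edges
of a frame is finite (\<open>finite_crossing\<close>). In a frame that minimises the number of crossings among the
frames that are crossed at all, a product of two half-turns permutes finitely many
lifts in a strictly monotone manner, hence fixes them (\<open>terminal_frame\<close>). So some lift of the
geodesic is the axis of such a product, the semicircle with centre \<open>x\<close> and radius \<open>\<rho>\<close> where
\<open>\<rho>\<^sup>2 = 9/4 - 1/q\<^sup>2 > 1\<close>, and one of the two half-turns exchanges its ends (\<open>core_data\<close>).
Consequently the family of lifts is invariant under the translation by \<open>3\<close> (\<open>shift_L\<close>), and this
translation reverses orientations. Since semicircles that do not cross their translate by \<open>3\<close> have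
diameter at most \<open>3\<close>, the integrality of the quadratic forms shows that no lift has a radius above \<open>\<rho>\<close> (\<open>length_le\<close>).

A simple orthogeodesic to the cusp lifts to a vertical ray that starts at the top of a lift of
the geodesic (\<open>ray_to_cusp\<close>). The tops of the translates of the axis do give orthogeodesics, since no lift is
higher (\<open>orthogeodesic_exists\<close>). There are no others: a ray over another centre either
hits a lift or is wound around the axis by the product of half-turns until its image crosses the
ray itself (\<open>self_crossing\<close>, \<open>simple_ray_unique\<close>). So the feet are the projections of the tops
\<open>x + 3 j + \<i> \<rho>\<close>, and on the left and on the right side the integers \<open>j\<close> have different parities.
As \<open>\<rho> > 1\<close>, an element of \<open>\<Gamma>\<close> that moves one such top to another is a translation, and the
translations in \<open>\<Gamma>\<close> are by multiples of \<open>6\<close>. Hence the two feet are different points (\<open>opposite_tops\<close>).\<close>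

section \<open>The modular torus group as a group of integer matrices\<close>

lemma denom_uhp:
  assumes "0 < Im z" "c \<noteq> 0 \<or> d \<noteq> 0"
  shows "complex_of_real c * z + complex_of_real d \<noteq> 0"
  using assms by (auto simp: complex_eq_iff)

lemma denom_uhp_int:
  assumes "0 < Im z" "a * d - b * c = (1::int)"
  shows "of_int c * z + of_int d \<noteq> 0"
proof -
  have "c \<noteq> 0 \<or> d \<noteq> 0" using assms by auto
  then show ?thesis using denom_uhp[of z "of_int c" "of_int d"] assms(1) by simp
qed

lemma Im_moebius:
  "Im (moebius (complex_of_real a) (of_real b) (of_real c) (of_real d) z)
     = (a * d - b * c) * Im z / (cmod (of_real c * z + of_real d))\<^sup>2"
proof (cases "of_real c * z + of_real d = 0")
  case True
  then show ?thesis by (simp add: moebius_def)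
next
  case False
  have "moebius (complex_of_real a) (of_real b) (of_real c) (of_real d) z
     = (of_real a * z + of_real b) * cnj (of_real c * z + of_real d) / of_real ((cmod (of_real c * z + of_real d))\<^sup>2)"
    unfolding moebius_def by (subst complex_div_cnj) simp
  also have "Im \<dots> = Im ((of_real a * z + of_real b) * cnj (of_real c * z + of_real d)) / (cmod (of_real c * z + of_real d))\<^sup>2"
    by (subst Im_divide_of_real) simp
  finally show ?thesis by (simp add: algebra_simps)
qed

lemma Im_moebius_int:
  assumes "a * d - b * c = (1::int)"
  shows "Im (moebius (of_int a) (of_int b) (of_int c) (of_int d) z)
     = Im z / (cmod (of_int c * z + of_int d))\<^sup>2"
proof -
  have "real_of_int a * of_int d - of_int b * of_int c = 1"
    using arg_cong[OF assms, of real_of_int] by simp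
  then show ?thesis
    using Im_moebius[of "of_int a" "of_int b" "of_int c" "of_int d" z] by simp
qed

lemma moebius_uhp:
  assumes "a * d - b * c = (1::int)" "z \<in> uhp"
  shows "moebius (of_int a) (of_int b) (of_int c) (of_int d) z \<in> uhp"
  using assms denom_uhp_int[of z a d b c] by (simp add: uhp_def Im_moebius_int)

lemma moebius_comp:
  fixes z :: "'a::field"
  assumes "g * z + h \<noteq> 0"
  shows "moebius a b c d (moebius e f g h z) = moebius (a*e+b*g) (a*f+b*h) (c*e+d*g) (c*f+d*h) z"
proof -
  have *: "p * ((e*z+f) / (g*z+h)) + q = (p*(e*z+f)+q*(g*z+h)) / (g*z+h)" for p q
    using assms by (simp add: divide_simps)
  have "moebius a b c d (moebius e f g h z) = (a*(e*z+f)+b*(g*z+h)) / (c*(e*z+f)+d*(g*z+h))"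
    unfolding moebius_def * using assms by simp
  then show ?thesis by (simp add: moebius_def algebra_simps)
qed

definition pslz :: "int \<Rightarrow> int \<Rightarrow> int \<Rightarrow> int \<Rightarrow> complex \<Rightarrow> complex" where
  "pslz a b c d = restrict (moebius (of_int a) (of_int b) (of_int c) (of_int d)) uhp"

lemma pslz_in_uhp: "a * d - b * c = 1 \<Longrightarrow> z \<in> uhp \<Longrightarrow> pslz a b c d z \<in> uhp"
  by (simp add: pslz_def moebius_uhp)

lemma pslz_uminus: "pslz (-a) (-b) (-c) (-d) = pslz a b c d"
proof -
  have "moebius (- of_int a) (- of_int b) (- of_int c) (- of_int d) z
      = moebius (of_int a) (of_int b) (of_int c) (of_int d) z" for z :: complex
    unfolding moebius_def
    using minus_divide_divide[of "of_int a * z + of_int b" "of_int c * z + of_int d"]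
    by (simp add: algebra_simps)
  then show ?thesis by (auto simp: pslz_def)
qed

lemma pslz_comp:
  assumes "e * h - f * g = 1" "z \<in> uhp"
  shows "pslz a b c d (pslz e f g h z) = pslz (a*e+b*g) (a*f+b*h) (c*e+d*g) (c*f+d*h) z"
  using assms moebius_uhp[OF assms] denom_uhp_int[of z e h f g] moebius_comp[of "of_int g" z "of_int h"]
  by (simp add: pslz_def) (simp add: uhp_def)

lemma pslz_compose:
  assumes "e * h - f * g = 1"
  shows "compose uhp (pslz a b c d) (pslz e f g h) = pslz (a*e+b*g) (a*f+b*h) (c*e+d*g) (c*f+d*h)"
proof
  fix z
  show "compose uhp (pslz a b c d) (pslz e f g h) z = pslz (a*e+b*g) (a*f+b*h) (c*e+d*g) (c*f+d*h) z"
    using pslz_comp[OF assms, of z] by (cases "z \<in> uhp") (auto simp: compose_def pslz_def)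
qed

lemma pslz_id: "pslz 1 0 0 1 = (\<lambda>z\<in>uhp. z)"
  by (auto simp: pslz_def moebius_def)

lemma pslz_Bij:
  assumes "a * d - b * c = 1" shows "pslz a b c d \<in> Bij uhp"
proof -
  have inv: "pslz a b c d (pslz d (-b) (-c) a z) = z" if "z \<in> uhp" for z
    using pslz_comp[of d a "-b" "-c" z a b c d] assms that pslz_id
    by (simp add: algebra_simps)
  have inv': "pslz d (-b) (-c) a (pslz a b c d z) = z" if "z \<in> uhp" for z
    using pslz_comp[of a d b c z d "-b" "-c" a] assms that pslz_id
    by (simp add: algebra_simps)
  have "bij_betw (pslz a b c d) uhp uhp"
    by (rule bij_betw_byWitness[where f' = "pslz d (-b) (-c) a"])
       (use inv inv' assms in \<open>auto simp: pslz_in_uhp algebra_simps intro!: pslz_in_uhp\<close>)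
  then show ?thesis by (simp add: Bij_def pslz_def)
qed

lemma carrier_PSL2Z: "carrier PSL2Z = {pslz a b c d | a b c d. a * d - b * c = 1}"
  by (simp add: PSL2Z_def pslz_def)

lemma mult_PSL2Z:
  assumes "a * d - b * c = 1" "e * h - f * g = 1"
  shows "pslz a b c d \<otimes>\<^bsub>PSL2Z\<^esub> pslz e f g h = pslz (a*e+b*g) (a*f+b*h) (c*e+d*g) (c*f+d*h)"
  using assms by (simp add: PSL2Z_def BijGroup_def pslz_Bij pslz_compose)

lemma one_PSL2Z: "\<one>\<^bsub>PSL2Z\<^esub> = pslz 1 0 0 1"
  by (simp add: PSL2Z_def BijGroup_def pslz_id)

lemma det_mult:
  assumes "a * d - b * c = (1::int)" "e * h - f * g = 1"
  shows "(a*e+b*g)*(c*f+d*h) - (a*f+b*h)*(c*e+d*g) = 1"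
proof -
  have "(a*e+b*g)*(c*f+d*h) - (a*f+b*h)*(c*e+d*g) = (a*d-b*c)*(e*h-f*g)" by algebra
  then show ?thesis using assms by simp
qed

lemma group_PSL2Z: "group PSL2Z"
proof (rule groupI)
  fix x y assume "x \<in> carrier PSL2Z" "y \<in> carrier PSL2Z"
  then show "x \<otimes>\<^bsub>PSL2Z\<^esub> y \<in> carrier PSL2Z"
    unfolding carrier_PSL2Z by clarsimp (metis det_mult mult_PSL2Z)
next
  show "\<one>\<^bsub>PSL2Z\<^esub> \<in> carrier PSL2Z"
    unfolding carrier_PSL2Z one_PSL2Z by force
next
  interpret B: group "BijGroup uhp" by (rule group_BijGroup)
  fix x y z assume "x \<in> carrier PSL2Z" "y \<in> carrier PSL2Z" "z \<in> carrier PSL2Z"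
  then have "x \<in> carrier (BijGroup uhp)" "y \<in> carrier (BijGroup uhp)" "z \<in> carrier (BijGroup uhp)"
    unfolding carrier_PSL2Z by (auto simp: BijGroup_def pslz_Bij)
  then show "x \<otimes>\<^bsub>PSL2Z\<^esub> y \<otimes>\<^bsub>PSL2Z\<^esub> z = x \<otimes>\<^bsub>PSL2Z\<^esub> (y \<otimes>\<^bsub>PSL2Z\<^esub> z)"
    by (simp add: PSL2Z_def B.m_assoc)
next
  fix x assume "x \<in> carrier PSL2Z"
  then obtain a b c d where x: "x = pslz a b c d" and det: "a * d - b * c = 1"
    unfolding carrier_PSL2Z by blast
  then show "\<one>\<^bsub>PSL2Z\<^esub> \<otimes>\<^bsub>PSL2Z\<^esub> x = x"
    by (simp add: one_PSL2Z mult_PSL2Z)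
  have det': "d * a - (-b) * (-c) = 1" using det by (simp add: algebra_simps)
  have "pslz d (-b) (-c) a \<in> carrier PSL2Z"
    unfolding carrier_PSL2Z using det' by blast
  moreover have "pslz d (-b) (-c) a \<otimes>\<^bsub>PSL2Z\<^esub> x = \<one>\<^bsub>PSL2Z\<^esub>"
    unfolding x one_PSL2Z using mult_PSL2Z[OF det' det] det by (simp add: algebra_simps)
  ultimately show "\<exists>y\<in>carrier PSL2Z. y \<otimes>\<^bsub>PSL2Z\<^esub> x = \<one>\<^bsub>PSL2Z\<^esub>" by blast
qed

lemma inv_PSL2Z:
  assumes "a * d - b * c = 1"
  shows "inv\<^bsub>PSL2Z\<^esub> (pslz a b c d) = pslz d (-b) (-c) a"
proof -
  interpret group PSL2Z by (rule group_PSL2Z)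
  have det': "d * a - (-b) * (-c) = 1" using assms by (simp add: algebra_simps)
  have "pslz d (-b) (-c) a \<otimes>\<^bsub>PSL2Z\<^esub> pslz a b c d = \<one>\<^bsub>PSL2Z\<^esub>"
    unfolding one_PSL2Z using mult_PSL2Z[OF det' assms] assms by (simp add: algebra_simps)
  moreover have "pslz a b c d \<in> carrier PSL2Z" "pslz d (-b) (-c) a \<in> carrier PSL2Z"
    unfolding carrier_PSL2Z using assms det' by blast+
  ultimately show ?thesis by (rule inv_equality)
qed

text \<open>The matrices \<open>T\<close>, \<open>T\<close> inverse and \<open>S\<close> generate: right multiplication by them performs the
  Euclidean algorithm on the lower row.\<close>

lemma sl2_row_induct:
  fixes P :: "int \<Rightarrow> int \<Rightarrow> int \<Rightarrow> int \<Rightarrow> bool"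
  assumes det: "a*d-b*c = 1"
    and one: "P 1 0 0 1"
    and T: "\<And>a b c d. a*d-b*c = 1 \<Longrightarrow> P a b c d \<Longrightarrow> P a (a+b) c (c+d)"
    and T': "\<And>a b c d. a*d-b*c = 1 \<Longrightarrow> P a b c d \<Longrightarrow> P a (b-a) c (d-c)"
    and S: "\<And>a b c d. a*d-b*c = 1 \<Longrightarrow> P a b c d \<Longrightarrow> P b (-a) d (-c)"
  shows "P a b c d"
proof -
  have Tn: "P a (int n * a + b) c (int n * c + d)" if "P a b c d" "a*d-b*c=1" for a b c d n
    using that
  proof (induction n)
    case (Suc n)
    have "a * (int n * c + d) - (int n * a + b) * c = 1"
      using Suc(3) by (simp add: algebra_simps)
    from T[OF this] Suc show ?case by (simp add: algebra_simps)
  qed auto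
  have Tm: "P a (b - int n * a) c (d - int n * c)" if "P a b c d" "a*d-b*c=1" for a b c d n
    using that
  proof (induction n)
    case (Suc n)
    have "a * (d - int n * c) - (b - int n * a) * c = 1"
      using Suc(3) by (simp add: algebra_simps)
    from T'[OF this] Suc show ?case by (simp add: algebra_simps)
  qed auto
  have Tz: "P a (k * a + b) c (k * c + d)" if "P a b c d" "a*d-b*c=1" for a b c d k
  proof (cases "k \<ge> 0")
    case True then show ?thesis using Tn[OF that, of "nat k"] by simp
  next
    case False then show ?thesis using Tm[OF that, of "nat (-k)"] by (simp add: algebra_simps)
  qed
  show ?thesis using det
  proof (induction "nat \<bar>c\<bar>" arbitrary: a b c d rule: less_induct)
    case less
    show ?case
    proof (cases "c = 0")
      case True
      then have ad: "a * d = 1" using less.prems by simp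
      have m1: "P (-1) 0 0 (-1)"
      proof -
        have "P 0 (-1) 1 0" using S[OF _ one] by simp
        from S[OF _ this] show ?thesis by simp
      qed
      from ad consider "a = 1" "d = 1" | "a = -1" "d = -1"
        using pos_zmult_eq_1_iff_lemma[of a d] by (auto simp: zmult_eq_1_iff)
      then show ?thesis
      proof cases
        case 1 then show ?thesis using Tz[OF one, of b] True by simp
      next
        case 2 then show ?thesis using Tz[OF m1, of "-b"] True by simp
      qed
    next
      case False
      define k where "k = d div c"
      define d' where "d' = d - k * c"
      define b' where "b' = b - k * a"
      have d': "d' = d mod c" by (simp add: d'_def k_def minus_div_mult_eq_mod)
      have lt: "nat \<bar>d'\<bar> < nat \<bar>c\<bar>"
        unfolding d' using False abs_mod_less by simp
      have det': "(-b') * c - a * (-d') = 1"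
        using less.prems by (simp add: b'_def d'_def algebra_simps)
      from less.hyps[of "-d'" "-b'" c a] lt det' have "P (-b') a (-d') c" by simp
      from S[OF det' this] have "P a b' c d'" by simp
      moreover have "a * d' - b' * c = 1" using det' by (simp add: algebra_simps)
      ultimately show ?thesis using Tz[of a b' c d' k] by (simp add: b'_def d'_def)
    qed
  qed
qed

text \<open>The matrices of \<open>\<Gamma>\<close>, by congruences modulo \<open>2\<close> and \<open>3\<close>. The abelianization of \<open>PSL(2,\<int>)\<close> is cyclic
  of order \<open>6\<close>, so its kernel \<open>\<Gamma>\<close> is the intersection of a subgroup of index \<open>2\<close> and one of index \<open>3\<close>.\<close>

definition gam :: "int \<Rightarrow> int \<Rightarrow> int \<Rightarrow> int \<Rightarrow> bool" where
  "gam a b c d \<longleftrightarrow> a * d - b * c = 1 \<and>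
     (if even c then even b else odd (a + d)) \<and>
     (if 3 dvd c then 3 dvd b else 3 dvd (a + d))"

text \<open>The functions \<open>chi2\<close> and \<open>chi3\<close> are polynomial formulas for the two components of the
  abelianization, modulo \<open>2\<close> and \<open>3\<close>. The generator \<open>z \<mapsto> z + 1\<close> has the value \<open>1\<close> in both, the generator
  \<open>z \<mapsto> - 1 / z\<close> has the values \<open>1\<close> and \<open>0\<close>.\<close>

definition chi2 :: "int \<Rightarrow> int \<Rightarrow> int \<Rightarrow> int \<Rightarrow> int" where
  "chi2 a b c d = (1 + c) * b + c * (a + d + 1)"

definition chi3 :: "int \<Rightarrow> int \<Rightarrow> int \<Rightarrow> int \<Rightarrow> int" where
  "chi3 a b c d = (1 - c^2) * (b * d) + c * (a + d)"

lemma gam_iff_chi: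
  assumes "a * d - b * c = 1"
  shows "gam a b c d \<longleftrightarrow> even (chi2 a b c d) \<and> 3 dvd chi3 a b c d"
proof -
  have "(if even c then even b else odd (a + d)) \<longleftrightarrow> even (chi2 a b c d)"
    by (auto simp: chi2_def)
  moreover have "(if 3 dvd c then 3 dvd b else 3 dvd (a + d)) \<longleftrightarrow> 3 dvd chi3 a b c d"
  proof (cases "3 dvd c")
    case True
    then obtain k where k: "c = 3 * k" by blast
    have "\<not> 3 dvd d"
    proof
      assume "3 dvd d"
      then have "3 dvd a * d - b * c" using True by simp
      then show False using assms by simp
    qed
    then have "3 dvd b * d \<longleftrightarrow> 3 dvd b"
      using prime_dvd_mult_iff[of "3::int" b d] by simp
    moreover have "3 dvd chi3 a b c d \<longleftrightarrow> 3 dvd b * d"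
    proof -
      have "chi3 a b c d = b * d + 3 * (k * (a + d) - 3 * k^2 * (b * d))"
        by (simp add: chi3_def k power2_eq_square algebra_simps)
      then show ?thesis by (metis dvd_add_left_iff dvd_triv_left)
    qed
    ultimately show ?thesis using True by simp
  next
    case False
    have "3 dvd 1 - c^2"
    proof -
      have "3 dvd 1 - c \<or> 3 dvd 1 + c" using False by presburger
      moreover have "1 - c^2 = (1 - c) * (1 + c)" by (simp add: algebra_simps power2_eq_square)
      ultimately show ?thesis by (metis dvd_mult dvd_mult2)
    qed
    then have "3 dvd (1 - c^2) * (b * d)" by simp
    then have "3 dvd chi3 a b c d \<longleftrightarrow> 3 dvd c * (a + d)"
      unfolding chi3_def using dvd_add_right_iff by blast
    also have "\<dots> \<longleftrightarrow> 3 dvd (a + d)"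
      using False prime_dvd_mult_iff[of "3::int" c "a + d"] by simp
    finally show ?thesis using False by simp
  qed
  ultimately show ?thesis using assms by (simp add: gam_def)
qed

lemma chi2_T:
  assumes "a * d - b * c = 1"
  shows "even (chi2 a (a + b) c (c + d) - chi2 a b c d - 1)"
proof -
  have "odd (a * d - b * c)" using assms by simp
  then show ?thesis by (auto simp: chi2_def)
qed

lemma chi2_T':
  assumes "a * d - b * c = 1"
  shows "even (chi2 a (b - a) c (d - c) - chi2 a b c d - 1)"
proof -
  have "odd (a * d - b * c)" using assms by simp
  then show ?thesis by (auto simp: chi2_def)
qed

lemma chi2_S:
  assumes "a * d - b * c = 1"
  shows "even (chi2 b (-a) d (-c) - chi2 a b c d - 1)"
proof -
  have "odd (a * d - b * c)" using assms by simp
  then show ?thesis by (auto simp: chi2_def)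
qed

lemma cube3: "3 dvd (1 - c^2) * (c::int)"
proof -
  have "(1 - c^2) * c = - ((c - 1) * c * (c + 1))" by (simp add: algebra_simps power2_eq_square)
  moreover have "3 dvd (c - 1) * c * (c + 1)"
  proof -
    have "3 dvd c - 1 \<or> 3 dvd c \<or> 3 dvd c + 1" by presburger
    then show ?thesis by (metis dvd_mult dvd_mult2)
  qed
  ultimately show ?thesis by simp
qed

lemma chi3_T:
  assumes "a * d - b * c = 1"
  shows "3 dvd (chi3 a (a + b) c (c + d) - chi3 a b c d - 1)"
proof -
  have "chi3 a (a + b) c (c + d) - chi3 a b c d - 1
     = (1 - c^2) * (a * d + (a + b) * c) + c^2 - 1"
    by (simp add: chi3_def algebra_simps power2_eq_square)
  also have "\<dots> = (1 - c^2) * ((a * d - b * c - 1) + (a + 2 * b) * c)"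
    by (simp add: algebra_simps power2_eq_square)
  also have "\<dots> = ((1 - c^2) * c) * (a + 2 * b)" using assms by simp
  finally show ?thesis
    by (metis dvd_mult2 cube3)
qed

lemma chi3_T':
  assumes "a * d - b * c = 1"
  shows "3 dvd (chi3 a (b - a) c (d - c) - chi3 a b c d + 1)"
proof -
  have "a * (d - c) - (b - a) * c = 1" using assms by (simp add: algebra_simps)
  from chi3_T[OF this] have "3 dvd - (chi3 a b c d - chi3 a (b - a) c (d - c) - 1)"
    by (simp only: dvd_minus_iff) simp
  then show ?thesis by (simp add: algebra_simps)
qed

lemma chi3_S:
  assumes "a * d - b * c = 1"
  shows "3 dvd (chi3 b (-a) d (-c) - chi3 a b c d)"
proof -
  have "chi3 b (-a) d (-c) - chi3 a b c d = - c * d * (a * d - b * c) - 2 * c * d"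
    by (simp add: chi3_def algebra_simps power2_eq_square)
  also have "\<dots> = 3 * (- c * d)" using assms by simp
  finally show ?thesis by simp
qed

text \<open>Additivity only has to be checked when the second factor is multiplied by a generator.\<close>

lemma chi_mult:
  assumes A: "a * d - b * c = 1" and B: "e * h - f * g = 1"
  shows "even (chi2 (a*e+b*g) (a*f+b*h) (c*e+d*g) (c*f+d*h) - chi2 a b c d - chi2 e f g h) \<and>
    3 dvd (chi3 (a*e+b*g) (a*f+b*h) (c*e+d*g) (c*f+d*h) - chi3 a b c d - chi3 e f g h)"
  using B
proof (induction e f g h rule: sl2_row_induct[consumes 1, case_names one T T' S])
  case one
  show ?case by (simp add: chi2_def chi3_def)
next
  case (T e f g h)
  let ?a = "a*e+b*g" and ?b = "a*f+b*h" and ?c = "c*e+d*g" and ?d = "c*f+d*h"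
  have AB: "?a * ?d - ?b * ?c = 1" by (rule det_mult[OF A T(1)])
  have eq: "a * (e + f) + b * (g + h) = ?a + ?b" "c * (e + f) + d * (g + h) = ?c + ?d"
    by (simp_all add: algebra_simps)
  show ?case unfolding eq
    using T(2) chi2_T[OF AB] chi3_T[OF AB] chi2_T[OF T(1)] chi3_T[OF T(1)] by presburger
next
  case (T' e f g h)
  let ?a = "a*e+b*g" and ?b = "a*f+b*h" and ?c = "c*e+d*g" and ?d = "c*f+d*h"
  have AB: "?a * ?d - ?b * ?c = 1" by (rule det_mult[OF A T'(1)])
  have eq: "a * (f - e) + b * (h - g) = ?b - ?a" "c * (f - e) + d * (h - g) = ?d - ?c"
    by (simp_all add: algebra_simps)
  show ?case unfolding eq
    using T'(2) chi2_T'[OF AB] chi3_T'[OF AB] chi2_T'[OF T'(1)] chi3_T'[OF T'(1)] by presburger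
next
  case (S e f g h)
  let ?a = "a*e+b*g" and ?b = "a*f+b*h" and ?c = "c*e+d*g" and ?d = "c*f+d*h"
  have AB: "?a * ?d - ?b * ?c = 1" by (rule det_mult[OF A S(1)])
  have eq: "a * - e + b * - g = - ?a" "c * - e + d * - g = - ?c"
    by (simp_all add: algebra_simps)
  show ?case unfolding eq
    using S(2) chi2_S[OF AB] chi3_S[OF AB] chi2_S[OF S(1)] chi3_S[OF S(1)] by presburger
qed

lemma chi_inv:
  assumes A: "a * d - b * c = 1"
  shows "even (chi2 a b c d + chi2 d (-b) (-c) a) \<and> 3 dvd (chi3 a b c d + chi3 d (-b) (-c) a)"
proof -
  have B: "d * a - (-b) * (-c) = 1" using A by (simp add: algebra_simps)
  have "a * d + b * - c = 1" "a * - b + b * a = 0" "c * d + d * - c = 0" "c * - b + d * a = 1"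
    using A by (simp_all add: algebra_simps)
  moreover have "chi2 1 0 0 1 = 0" "chi3 1 0 0 1 = 0" by (simp_all add: chi2_def chi3_def)
  ultimately have "even (0 - chi2 a b c d - chi2 d (-b) (-c) a) \<and> 3 dvd (0 - chi3 a b c d - chi3 d (-b) (-c) a)"
    using chi_mult[OF A B] by metis
  then show ?thesis by presburger
qed

lemma gam_det: "gam a b c d \<Longrightarrow> a * d - b * c = 1" by (simp add: gam_def)

lemma gam_mult:
  assumes "gam a b c d" "gam e f g h"
  shows "gam (a*e+b*g) (a*f+b*h) (c*e+d*g) (c*f+d*h)"
proof -
  note A = gam_det[OF assms(1)] and B = gam_det[OF assms(2)]
  show ?thesis
    using chi_mult[OF A B] assms
    unfolding gam_iff_chi[OF A] gam_iff_chi[OF B] gam_iff_chi[OF det_mult[OF A B]] by presburger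
qed

lemma gam_inv: "gam a b c d \<Longrightarrow> gam d (-b) (-c) a"
  by (auto simp: gam_def algebra_simps)

lemma gam_one: "gam 1 0 0 1" by (simp add: gam_def)

definition Gset :: "(complex \<Rightarrow> complex) set" where
  "Gset = {pslz a b c d | a b c d. gam a b c d}"

text \<open>The characters are additive, so they vanish on commutators.\<close>

lemma derived_subset: "derived PSL2Z (carrier PSL2Z) \<subseteq> Gset"
proof -
  interpret group PSL2Z by (rule group_PSL2Z)
  have sub: "subgroup Gset PSL2Z"
  proof (rule subgroupI)
    show "Gset \<subseteq> carrier PSL2Z"
      unfolding Gset_def carrier_PSL2Z using gam_det by blast
    show "Gset \<noteq> {}" unfolding Gset_def using gam_one by blast
  next
    fix x assume "x \<in> Gset"
    then show "inv\<^bsub>PSL2Z\<^esub> x \<in> Gset"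
      unfolding Gset_def using gam_det gam_inv inv_PSL2Z by fastforce
  next
    fix x y assume "x \<in> Gset" "y \<in> Gset"
    then show "x \<otimes>\<^bsub>PSL2Z\<^esub> y \<in> Gset"
      unfolding Gset_def using gam_det gam_mult mult_PSL2Z by fastforce
  qed
  have comm: "x \<otimes>\<^bsub>PSL2Z\<^esub> y \<otimes>\<^bsub>PSL2Z\<^esub> inv\<^bsub>PSL2Z\<^esub> x \<otimes>\<^bsub>PSL2Z\<^esub> inv\<^bsub>PSL2Z\<^esub> y \<in> Gset"
    if xy: "x \<in> carrier PSL2Z" "y \<in> carrier PSL2Z" for x y
  proof -
    obtain a b c d where x: "x = pslz a b c d" and A: "a * d - b * c = 1"
      using xy(1) unfolding carrier_PSL2Z by blast
    obtain e f g h where y: "y = pslz e f g h" and B: "e * h - f * g = 1"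
      using xy(2) unfolding carrier_PSL2Z by blast
    have A': "d * a - (-b) * (-c) = 1" using A by (simp add: algebra_simps)
    have B': "h * e - (-f) * (-g) = 1" using B by (simp add: algebra_simps)
    note AB = det_mult[OF A B]
    note ABA = det_mult[OF AB A']
    note ABAB = det_mult[OF ABA B']
    have "even (z::int) \<and> 3 dvd z'"
      if "even (x - p - q) \<and> 3 dvd (x' - p1 - q1)" "even (y - x - p') \<and> 3 dvd (y' - x' - p1')"
        "even (z - y - q') \<and> 3 dvd (z' - y' - q1')" "even (p + p') \<and> 3 dvd (p1 + p1')"
        "even (q + q') \<and> 3 dvd (q1 + q1')" for x y z p q p' q' x' y' z' p1 q1 p1' q1' :: int
      using that by presburger
    note gam_iff_chi[OF ABAB, THEN iffD2,
      OF this[OF chi_mult[OF A B] chi_mult[OF AB A'] chi_mult[OF ABA B'] chi_inv[OF A] chi_inv[OF B]]]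
    note gm = this
    show ?thesis
      unfolding x y inv_PSL2Z[OF A] inv_PSL2Z[OF B] mult_PSL2Z[OF A B] mult_PSL2Z[OF AB A'] mult_PSL2Z[OF ABA B']
        Gset_def mem_Collect_eq
      by (rule exI)+ (rule conjI[OF refl gm])
  qed
  show ?thesis
    unfolding derived_def by (rule generate_subgroup_incl[OF _ sub]) (use comm in auto)
qed

text \<open>Modulo commutators \<open>S\<close> is congruent to \<open>T\<^sup>3\<close>, so every element is a product of an element of the
  derived group with a power \<open>T\<^sup>n\<close>, where \<open>n\<close> is determined modulo \<open>6\<close> by the characters. If
  these vanish, \<open>6 dvd n\<close>, and \<open>T\<^sup>6\<close> is itself in the derived group.\<close>

lemma subset_derived: "Gset \<subseteq> derived PSL2Z (carrier PSL2Z)"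
proof -
  interpret group PSL2Z by (rule group_PSL2Z)
  let ?D = "derived PSL2Z (carrier PSL2Z)"
  have D: "subgroup ?D PSL2Z" by (rule derived_is_subgroup) simp
  have N: "?D \<lhd> PSL2Z" by (rule derived_self_is_normal)
  have pc: "pslz a b c d \<in> carrier PSL2Z" if "a * d - b * c = 1" for a b c d
    unfolding carrier_PSL2Z using that by blast
  have comm: "x \<otimes>\<^bsub>PSL2Z\<^esub> y \<otimes>\<^bsub>PSL2Z\<^esub> inv\<^bsub>PSL2Z\<^esub> x \<otimes>\<^bsub>PSL2Z\<^esub> inv\<^bsub>PSL2Z\<^esub> y \<in> ?D"
    if "x \<in> carrier PSL2Z" "y \<in> carrier PSL2Z" for x y
    unfolding derived_def by (rule generate.incl) (use that in blast)
  have 1: "pslz 1 1 1 2 \<in> ?D"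
    using comm[of "pslz 0 (-1) 1 0" "pslz 1 1 (-1) 0"] by (simp add: pc inv_PSL2Z mult_PSL2Z)
  have 2: "pslz 1 (-1) (-1) 2 \<in> ?D"
    using comm[of "pslz 0 (-1) 1 1" "pslz 0 (-1) 1 0"] by (simp add: pc inv_PSL2Z mult_PSL2Z)
  have "pslz 0 1 (-1) 3 \<in> ?D"
    using subgroup.m_closed[OF D 1 2] by (simp add: mult_PSL2Z)
  \<comment> \<open>This is \<open>S T^(-3)\<close>.\<close>
  then have S3: "pslz 0 (-1) 1 (-3) \<in> ?D"
    using pslz_uminus[of 0 1 "-1" 3] by simp
  have conj: "x \<otimes>\<^bsub>PSL2Z\<^esub> h \<otimes>\<^bsub>PSL2Z\<^esub> inv\<^bsub>PSL2Z\<^esub> x \<in> ?D" if "x \<in> carrier PSL2Z" "h \<in> ?D" for x h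
    using normal.inv_op_closed2[OF N] that by blast
  have decomp: "\<exists>n. \<exists>h\<in>?D. pslz a b c d = h \<otimes>\<^bsub>PSL2Z\<^esub> pslz 1 n 0 1 \<and>
      even (n - chi2 a b c d) \<and> 3 dvd (n - chi3 a b c d)" if "a * d - b * c = 1" for a b c d
    using that
  proof (induction a b c d rule: sl2_row_induct[consumes 1, case_names one T T' S])
    case one
    have "pslz 1 0 0 1 \<in> ?D" using subgroup.one_closed[OF D] by (simp add: one_PSL2Z)
    then show ?case
      by (intro exI[of _ 0] bexI[of _ "pslz 1 0 0 1"]) (auto simp: mult_PSL2Z chi2_def chi3_def)
  next
    case (T a b c d)
    then obtain n h where h: "h \<in> ?D" "pslz a b c d = h \<otimes>\<^bsub>PSL2Z\<^esub> pslz 1 n 0 1"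
      and n: "even (n - chi2 a b c d)" "3 dvd (n - chi3 a b c d)" by blast
    have hc: "h \<in> carrier PSL2Z" using h(1) subgroup.subset[OF D] by blast
    have "pslz a (a + b) c (c + d) = pslz a b c d \<otimes>\<^bsub>PSL2Z\<^esub> pslz 1 1 0 1"
      using T(1) by (simp add: mult_PSL2Z)
    also have "\<dots> = h \<otimes>\<^bsub>PSL2Z\<^esub> pslz 1 (n + 1) 0 1"
      unfolding h(2) using m_assoc[OF hc pc[of 1 1 n 0] pc[of 1 1 1 0]] by (simp add: mult_PSL2Z add.commute)
    finally show ?case
      using h(1) n chi2_T[OF T(1)] chi3_T[OF T(1)]
      by (intro exI[of _ "n + 1"] bexI[of _ h] conjI) (assumption | presburger)+
  next
    case (T' a b c d)
    then obtain n h where h: "h \<in> ?D" "pslz a b c d = h \<otimes>\<^bsub>PSL2Z\<^esub> pslz 1 n 0 1"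
      and n: "even (n - chi2 a b c d)" "3 dvd (n - chi3 a b c d)" by blast
    have hc: "h \<in> carrier PSL2Z" using h(1) subgroup.subset[OF D] by blast
    have "pslz a (b - a) c (d - c) = pslz a b c d \<otimes>\<^bsub>PSL2Z\<^esub> pslz 1 (-1) 0 1"
      using T'(1) by (simp add: mult_PSL2Z)
    also have "\<dots> = h \<otimes>\<^bsub>PSL2Z\<^esub> pslz 1 (n - 1) 0 1"
      unfolding h(2) using m_assoc[OF hc pc[of 1 1 n 0] pc[of 1 1 "-1" 0]] by (simp add: mult_PSL2Z add.commute)
    finally show ?case
      using h(1) n chi2_T'[OF T'(1)] chi3_T'[OF T'(1)]
      by (intro exI[of _ "n - 1"] bexI[of _ h] conjI) (assumption | presburger)+
  next
    case (S a b c d)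
    then obtain n h where h: "h \<in> ?D" "pslz a b c d = h \<otimes>\<^bsub>PSL2Z\<^esub> pslz 1 n 0 1"
      and n: "even (n - chi2 a b c d)" "3 dvd (n - chi3 a b c d)" by blast
    have hc: "h \<in> carrier PSL2Z" using h(1) subgroup.subset[OF D] by blast
    let ?k = "pslz 1 n 0 1 \<otimes>\<^bsub>PSL2Z\<^esub> pslz 0 (-1) 1 (-3) \<otimes>\<^bsub>PSL2Z\<^esub> inv\<^bsub>PSL2Z\<^esub> pslz 1 n 0 1"
    have k: "?k \<in> ?D" by (rule conj[OF pc S3]) simp
    have kc: "?k \<in> carrier PSL2Z" using k subgroup.subset[OF D] by blast
    have k1: "?k \<otimes>\<^bsub>PSL2Z\<^esub> pslz 1 (n + 3) 0 1 = pslz 1 n 0 1 \<otimes>\<^bsub>PSL2Z\<^esub> pslz 0 (-1) 1 0"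
      by (simp add: mult_PSL2Z inv_PSL2Z algebra_simps)
    have "pslz b (-a) d (-c) = pslz a b c d \<otimes>\<^bsub>PSL2Z\<^esub> pslz 0 (-1) 1 0"
      using S(1) by (simp add: mult_PSL2Z)
    also have "\<dots> = h \<otimes>\<^bsub>PSL2Z\<^esub> (?k \<otimes>\<^bsub>PSL2Z\<^esub> pslz 1 (n + 3) 0 1)"
      unfolding h(2) k1 by (rule m_assoc[OF hc pc pc]) simp_all
    also have "\<dots> = h \<otimes>\<^bsub>PSL2Z\<^esub> ?k \<otimes>\<^bsub>PSL2Z\<^esub> pslz 1 (n + 3) 0 1"
      by (rule m_assoc[OF hc kc pc, symmetric]) simp
    finally show ?case
      using subgroup.m_closed[OF D h(1) k] n chi2_S[OF S(1)] chi3_S[OF S(1)]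
      by (intro exI[of _ "n + 3"] bexI[of _ "h \<otimes>\<^bsub>PSL2Z\<^esub> ?k"] conjI) (assumption | presburger)+
  qed
  have T3S: "pslz 3 (-1) 1 0 \<in> ?D"
    using subgroup.m_inv_closed[OF D S3] pslz_uminus[of 3 "-1" 1 0] by (simp add: inv_PSL2Z)
  have ST3: "pslz 0 (-1) 1 3 \<in> ?D"
    using conj[OF pc T3S, of 0 0 "-1" 1] pslz_uminus[of 0 "-1" 1 3] by (simp add: inv_PSL2Z mult_PSL2Z)
  have T6: "pslz 1 6 0 1 \<in> ?D"
    using subgroup.m_closed[OF D T3S ST3] pslz_uminus[of 1 6 0 1] by (simp add: mult_PSL2Z)
  have T6n: "pslz 1 (6 * int k) 0 1 \<in> ?D" for k
  proof (induction k)
    case 0 then show ?case using subgroup.one_closed[OF D] by (simp add: one_PSL2Z)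
  next
    case (Suc k)
    then show ?case using subgroup.m_closed[OF D Suc T6] by (simp add: mult_PSL2Z add.commute)
  qed
  have T6z: "pslz 1 (6 * k) 0 1 \<in> ?D" for k
  proof (cases "k \<ge> 0")
    case True then show ?thesis using T6n[of "nat k"] by simp
  next
    case False
    then show ?thesis using subgroup.m_inv_closed[OF D T6n[of "nat (-k)"]] by (simp add: inv_PSL2Z)
  qed
  show ?thesis
  proof
    fix x assume "x \<in> Gset"
    then obtain a b c d where x: "x = pslz a b c d" and g: "gam a b c d" unfolding Gset_def by blast
    note det = gam_det[OF g]
    from decomp[OF det] obtain n h where h: "h \<in> ?D" "x = h \<otimes>\<^bsub>PSL2Z\<^esub> pslz 1 n 0 1"
      and n: "even (n - chi2 a b c d)" "3 dvd (n - chi3 a b c d)" unfolding x by blast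
    have "6 dvd n" using n g unfolding gam_iff_chi[OF det] by presburger
    then obtain k where "n = 6 * k" by blast
    then show "x \<in> ?D" using subgroup.m_closed[OF D h(1) T6z[of k]] h(2) by simp
  qed
qed

lemma carrier_Gamma: "carrier \<Gamma> = Gset"
  using derived_subset subset_derived by (auto simp: \<Gamma>_def)

lemma mem_torus_proj_iff:
  "w \<in> torus_proj z \<longleftrightarrow> (\<exists>a b c d. gam a b c d \<and> w = pslz a b c d z)"
  unfolding torus_proj_def orbit_def carrier_Gamma Gset_def by blast

lemma torus_proj_eq_iff:
  assumes "z \<in> uhp" "w \<in> uhp"
  shows "torus_proj z = torus_proj w \<longleftrightarrow> (\<exists>a b c d. gam a b c d \<and> w = pslz a b c d z)"
proof
  assume eq: "torus_proj z = torus_proj w"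
  have "w = pslz 1 0 0 1 w" using assms by (simp add: pslz_id)
  then have "w \<in> torus_proj w" using gam_one by (auto simp: mem_torus_proj_iff)
  then show "\<exists>a b c d. gam a b c d \<and> w = pslz a b c d z" using eq by (simp add: mem_torus_proj_iff[symmetric])
next
  have sub: "torus_proj w \<subseteq> torus_proj z" if "gam a b c d" "w = pslz a b c d z" "z \<in> uhp" for a b c d z w
  proof
    fix x assume "x \<in> torus_proj w"
    then obtain e f g h where x: "gam e f g h" "x = pslz e f g h w" by (auto simp: mem_torus_proj_iff)
    show "x \<in> torus_proj z"
      unfolding mem_torus_proj_iff x(2) that(2) using pslz_comp[OF gam_det[OF that(1)] that(3)] gam_mult[OF x(1) that(1)] by blast
  qed
  assume "\<exists>a b c d. gam a b c d \<and> w = pslz a b c d z"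
  then obtain a b c d where g: "gam a b c d" and w: "w = pslz a b c d z" by blast
  have "pslz d (-b) (-c) a w = pslz 1 0 0 1 z"
    unfolding w using pslz_comp[OF gam_det[OF g] assms(1), of d "-b" "-c" a] gam_det[OF g] by (simp add: algebra_simps)
  then have "z = pslz d (-b) (-c) a w" using assms by (simp add: pslz_id)
  then show "torus_proj z = torus_proj w"
    using sub[OF g w assms(1)] sub[OF gam_inv[OF g] _ assms(2)] by blast
qed

lemma torus_proj_pslz: "gam a b c d \<Longrightarrow> z \<in> uhp \<Longrightarrow> torus_proj (pslz a b c d z) = torus_proj z"
  using torus_proj_eq_iff[of z "pslz a b c d z"] pslz_in_uhp gam_det by metis

text \<open>\<open>\<Gamma>\<close> acts freely: a fixed point forces a trace in \<open>{-1, 0, 1}\<close>. Trace \<open>0\<close> would make \<open>-1\<close> a square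
  modulo \<open>4\<close>, and trace \<open>\<plusminus>1\<close> would contradict the congruences modulo \<open>9\<close>.\<close>

lemma gam_fixed_point:
  assumes g: "gam a b c d" and z: "z \<in> uhp" and fx: "pslz a b c d z = z"
  shows "b = 0 \<and> c = 0 \<and> a = d"
proof -
  note det = gam_det[OF g]
  have Imz: "Im z > 0" using z by (simp add: uhp_def)
  have "of_int a * z + of_int b = z * (of_int c * z + of_int d)"
    using fx z denom_uhp_int[OF Imz det] by (simp add: pslz_def moebius_def field_simps)
  then have re: "of_int a * Re z + of_int b = of_int c * ((Re z)\<^sup>2 - (Im z)\<^sup>2) + of_int d * Re z"
    and im: "of_int a * Im z = 2 * of_int c * Re z * Im z + of_int d * Im z"
    by (auto simp: complex_eq_iff algebra_simps power2_eq_square)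
  from im have im': "real_of_int a - of_int d = 2 * of_int c * Re z" using Imz
    by (metis (no_types, opaque_lifting) add_diff_cancel_right' distrib_right less_irrefl mult_right_cancel)
  show ?thesis
  proof (cases "c = 0")
    case True
    then have "a = d" using im' by simp
    moreover have "b = 0" using re True \<open>a = d\<close> by simp
    ultimately show ?thesis using True by simp
  next
    case False
    have "real_of_int b = of_int c * ((Re z)\<^sup>2 - (Im z)\<^sup>2) - 2 * of_int c * Re z * Re z"
      using re im' by (simp add: algebra_simps)
    then have "real_of_int b * of_int c = (of_int c * ((Re z)\<^sup>2 - (Im z)\<^sup>2) - 2 * of_int c * Re z * Re z) * of_int c"
      by simp
    then have "real_of_int (b * c) = - (of_int c)\<^sup>2 * ((Re z)\<^sup>2 + (Im z)\<^sup>2)"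
      by (simp add: algebra_simps power2_eq_square)
    moreover have "real_of_int ((a + d)^2 - 4) = (real_of_int a - of_int d)^2 + 4 * real_of_int (b * c)"
    proof -
      have "(a + d)^2 - 4 = (a - d)^2 + 4 * (b * c)" using det by (simp add: power2_eq_square algebra_simps)
      from arg_cong[OF this, of real_of_int] show ?thesis by simp
    qed
    ultimately have "real_of_int ((a + d)^2 - 4) = - 4 * (of_int c)\<^sup>2 * (Im z)\<^sup>2"
      unfolding im' by (simp add: algebra_simps power2_eq_square)
    also have "\<dots> < 0" using False Imz by simp
    finally have "(a + d)^2 - 4 < 0" by (simp only: of_int_less_0_iff)
    then have lt: "(a + d)^2 < 2^2" by simp
    then have "\<bar>a + d\<bar> < 2" by (metis abs_numeral power2_less_imp_less abs_ge_zero power2_abs zero_le_numeral)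
    then consider "a + d = 0" | "a + d = 1" | "a + d = -1" by linarith
    then have False
    proof cases
      case 1
      then have "even c" using g unfolding gam_def by (metis even_zero)
      then have "even b" using g by (auto simp: gam_def)
      obtain b' c' where bc: "b = 2 * b'" "c = 2 * c'" using \<open>even b\<close> \<open>even c\<close> by (auto elim!: evenE)
      have d: "d = - a" using 1 by simp
      have "a * a + 1 = - 4 * (b' * c')" using det bc by (simp add: d algebra_simps)
      then have "4 dvd a * a + 1" by simp
      moreover have "\<not> 4 dvd a * a + 1"
      proof (cases "even a")
        case True then obtain k where "a = 2 * k" by blast
        then have "a * a + 1 = 4 * (k * k) + 1" by simp
        then show ?thesis by presburger
      next
        case False then obtain k where "a = 2 * k + 1" by (elim oddE)
        then have "a * a + 1 = 4 * (k * k + k) + 2" by (simp add: algebra_simps)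
        then show ?thesis by presburger
      qed
      ultimately show False by simp
    next
      case 2
      then have c3: "3 dvd c" using g by (auto simp: gam_def split: if_splits)
      then have "3 dvd b" using g by (auto simp: gam_def)
      then obtain b' c' where bc: "b = 3 * b'" "c = 3 * c'" using c3 by blast
      have d: "d = 1 - a" using 2 by simp
      have eq: "a * a - a + 1 = - 9 * (b' * c')" using det bc by (simp add: d algebra_simps)
      have "(2 * a - 1)^2 + 3 = 4 * (a * a - a + 1)" by (simp add: power2_eq_square algebra_simps)
      then have e: "(2 * a - 1)^2 + 3 = - 36 * (b' * c')" using eq by simp
      then have "3 dvd (2 * a - 1)^2" by presburger
      then have "3 dvd 2 * a - 1" using prime_dvd_power[of "3::int"] by simp
      then obtain m where "2 * a - 1 = 3 * m" by blast
      then have "9 * m^2 + 3 = - 36 * (b' * c')" using e by (simp add: power2_eq_square)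
      then show False by presburger
    next
      case 3
      then have c3: "3 dvd c" using g by (auto simp: gam_def split: if_splits)
      then have "3 dvd b" using g by (auto simp: gam_def)
      then obtain b' c' where bc: "b = 3 * b'" "c = 3 * c'" using c3 by blast
      have d: "d = - 1 - a" using 3 by simp
      have eq: "a * a + a + 1 = - 9 * (b' * c')" using det bc by (simp add: d algebra_simps)
      have "(2 * a + 1)^2 + 3 = 4 * (a * a + a + 1)" by (simp add: power2_eq_square algebra_simps)
      then have e: "(2 * a + 1)^2 + 3 = - 36 * (b' * c')" using eq by simp
      then have "3 dvd (2 * a + 1)^2" by presburger
      then have "3 dvd 2 * a + 1" using prime_dvd_power[of "3::int"] by simp
      then obtain m where "2 * a + 1 = 3 * m" by blast
      then have "9 * m^2 + 3 = - 36 * (b' * c')" using e by (simp add: power2_eq_square)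
      then show False by presburger
    qed
    then show ?thesis by simp
  qed
qed

section \<open>Half-turns and integral quadratic forms\<close>

abbreviation rmob :: "int \<Rightarrow> int \<Rightarrow> int \<Rightarrow> int \<Rightarrow> real \<Rightarrow> real" where
  "rmob a b c d \<equiv> moebius (of_int a) (of_int b) (of_int c) (of_int d)"

text \<open>The boundary action of the hyperbolic rotation by \<open>\<pi>\<close> about the point \<open>p / q + \<i> / q\<close>, which
  exchanges \<open>p / q\<close> and \<open>\<infinity>\<close>.\<close>

definition half_turn :: "int \<Rightarrow> int \<Rightarrow> real \<Rightarrow> real" where
  "half_turn p q x = of_int p / of_int q - 1 / ((of_int q)\<^sup>2 * (x - of_int p / of_int q))"

text \<open>In the abelianization, of order \<open>6\<close>, a half-turn has the class of order \<open>2\<close>, and so has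
  the translation by an odd multiple of \<open>3\<close>; their product is in \<open>\<Gamma>\<close>.\<close>

lemma gam_half_turn:
  assumes "q dvd p^2 + 1" "odd n" "r = (p^2 + 1) div q"
  shows "gam (p + 3 * n * q) (- r - 3 * n * p) q (-p)"
proof -
  have qr: "q * r = p^2 + 1" using assms by simp
  have det: "(p + 3 * n * q) * (-p) - (- r - 3 * n * p) * q = 1"
    using qr by (simp add: algebra_simps power2_eq_square)
  have 3: "\<not> 3 dvd q"
  proof
    assume "3 dvd q"
    then have "3 dvd p^2 + 1" using assms(1) dvd_trans by blast
    moreover have "p = 3 * (p div 3) \<or> p = 3 * (p div 3) + 1 \<or> p = 3 * (p div 3) + 2" by presburger
    then obtain k where "p = 3 * k \<or> p = 3 * k + 1 \<or> p = 3 * k + 2" by blast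
    then have "p^2 + 1 = 3 * (3 * k^2) + 1 \<or> p^2 + 1 = 3 * (3 * k^2 + 2 * k) + 2 \<or> p^2 + 1 = 3 * (3 * k^2 + 4 * k + 1) + 2"
      by (auto simp: power2_eq_square algebra_simps)
    ultimately show False by presburger
  qed
  have 2: "even (- r - 3 * n * p)" if "even q"
  proof -
    have "even (p^2 + 1)" using qr that by (metis dvd_mult2)
    then have op: "odd p" by simp
    have "odd r"
    proof
      assume "even r"
      then obtain r' q' where "r = 2 * r'" "q = 2 * q'" using \<open>even q\<close> by blast
      then have "p^2 + 1 = 4 * (q' * r')" using qr by simp
      moreover obtain k where "p = 2 * k + 1" using op by (elim oddE)
      then have "p^2 + 1 = 4 * (k^2 + k) + 2" by (simp add: power2_eq_square algebra_simps)
      ultimately show False by presburger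
    qed
    then show ?thesis using op assms(2) by simp
  qed
  show ?thesis unfolding gam_def using det 2 3 assms(2) by auto
qed

lemma rmob_half_turn:
  assumes "q > 0" "q dvd p^2 + 1" "r = (p^2 + 1) div q" "x \<notin> \<rat>"
  shows "rmob (p + m * q) (- r - m * p) q (-p) x = of_int m + half_turn p q x"
proof -
  have "q * r = p^2 + 1" using assms by simp
  from arg_cong[OF this, of real_of_int] have r: "real_of_int r = ((of_int p)\<^sup>2 + 1) / of_int q"
    using assms(1) by (simp add: field_simps)
  have "x \<noteq> of_int p / of_int q" using assms(4) by auto
  then have "of_int q * x - of_int p \<noteq> 0" "x - of_int p / of_int q \<noteq> 0"
    using assms(1) by (auto simp: field_simps)
  then show ?thesis
    using assms(1) unfolding moebius_def half_turn_def
    by (simp add: r divide_simps) (simp add: algebra_simps power2_eq_square)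
qed

lemma half_turn_diff:
  assumes "x \<noteq> of_int p / of_int q" "y \<noteq> of_int p / of_int q" "q > 0"
  shows "half_turn p q x - half_turn p q y
    = (x - y) / ((of_int q)\<^sup>2 * (x - of_int p / of_int q) * (y - of_int p / of_int q))"
proof -
  have "x - of_int p / of_int q \<noteq> 0" "y - of_int p / of_int q \<noteq> 0" using assms by auto
  then show ?thesis using assms(3) unfolding half_turn_def
    by (simp add: divide_simps) (simp add: algebra_simps)
qed

text \<open>The numbers \<open>u\<close> and \<open>v\<close> are the roots of an integral quadratic form \<open>C X\<^sup>2 + B X + A\<close> with
  discriminant \<open>D\<close>.\<close>

definition has_form :: "int \<Rightarrow> int \<Rightarrow> real \<Rightarrow> real \<Rightarrow> bool" where
  "has_form D C u v \<longleftrightarrow> C \<noteq> 0 \<and> (\<exists>B A. of_int C * (u + v) = - of_int B \<and> of_int C * (u * v) = of_int A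
      \<and> B^2 - 4 * C * A = D)"

lemma has_form_sym: "has_form D C u v \<Longrightarrow> has_form D C v u"
  unfolding has_form_def by (simp add: algebra_simps)

lemma has_form_disc: assumes "has_form D C u v" shows "(of_int C * (u - v))\<^sup>2 = of_int D"
proof -
  obtain B A where *: "of_int C * (u + v) = - of_int B" "of_int C * (u * v) = of_int A" "B^2 - 4 * C * A = D"
    using assms by (auto simp: has_form_def)
  have "(of_int C * (u - v))\<^sup>2 = (of_int C * (u + v))\<^sup>2 - 4 * of_int C * (of_int C * (u * v))"
    by (simp add: power2_eq_square algebra_simps)
  also have "\<dots> = of_int (B^2 - 4 * C * A)" unfolding *(1,2) by simp
  finally show ?thesis by (simp only: *)
qed

lemma rmob_denom:
  fixes u :: real
  assumes "a * d - b * c = (1::int)" "u \<notin> \<rat>"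
  shows "of_int c * u + of_int d \<noteq> 0"
proof
  assume *: "of_int c * u + of_int d = 0"
  show False
  proof (cases "c = 0")
    case True then show False using * assms(1) by auto
  next
    case False
    have "of_int c * u = - of_int d" using * by linarith
    then have "u = - of_int d / of_int c"
      using False by (metis mult.commute nonzero_eq_divide_eq of_int_eq_0_iff)
    then show False using assms(2) by auto
  qed
qed

lemma has_form_rmob:
  assumes F: "has_form D C u v" and g: "a * d - b * c = (1::int)" and irr: "u \<notin> \<rat>" "v \<notin> \<rat>"
  shows "\<exists>C'. has_form D C' (rmob a b c d u) (rmob a b c d v)"
proof -
  obtain B A where *: "of_int C * (u + v) = - of_int B" "of_int C * (u * v) = of_int A" "B^2 - 4 * C * A = D"
    and C: "C \<noteq> 0"
    using F by (auto simp: has_form_def)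
  define C' where "C' = C * d^2 - B * (c * d) + A * c^2"
  define B' where "B' = - (2 * a * c * A - (a * d + b * c) * B + 2 * b * d * C)"
  define A' where "A' = a^2 * A - a * b * B + b^2 * C"
  have nz: "of_int c * u + of_int d \<noteq> 0" "of_int c * v + of_int d \<noteq> 0" using rmob_denom[OF g] irr by auto
  have C': "of_int C' = of_int C * ((of_int c * u + of_int d) * (of_int c * v + of_int d))"
  proof -
    have "of_int C * ((of_int c * u + of_int d) * (of_int c * v + of_int d)) =
      (of_int c)\<^sup>2 * (of_int C * (u * v)) + of_int c * of_int d * (of_int C * (u + v)) + of_int C * (of_int d)\<^sup>2"
      by (simp add: algebra_simps power2_eq_square)
    then show ?thesis unfolding * by (simp add: C'_def)
  qed
  have 1: "of_int C' * (rmob a b c d u + rmob a b c d v) = - of_int B'"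
  proof -
    have "of_int C' * (rmob a b c d u + rmob a b c d v)
      = of_int C * ((of_int a * u + of_int b) * (of_int c * v + of_int d) + (of_int a * v + of_int b) * (of_int c * u + of_int d))"
      unfolding C' moebius_def using nz by (simp add: divide_simps)
    also have "\<dots> = 2 * of_int a * of_int c * (of_int C * (u * v)) + (of_int a * of_int d + of_int b * of_int c) * (of_int C * (u + v))
      + 2 * of_int b * of_int d * of_int C" by (simp add: algebra_simps)
    finally show ?thesis unfolding * by (simp add: B'_def)
  qed
  have 2: "of_int C' * (rmob a b c d u * rmob a b c d v) = of_int A'"
  proof -
    have "of_int C' * (rmob a b c d u * rmob a b c d v)
      = of_int C * ((of_int a * u + of_int b) * (of_int a * v + of_int b))"
      unfolding C' moebius_def using nz by simp
    also have "\<dots> = (of_int a)\<^sup>2 * (of_int C * (u * v)) + of_int a * of_int b * (of_int C * (u + v))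
      + (of_int b)\<^sup>2 * of_int C" by (simp add: algebra_simps power2_eq_square)
    finally show ?thesis unfolding * by (simp add: A'_def)
  qed
  have "C' \<noteq> 0" using C' C nz by (metis mult_eq_0_iff of_int_eq_0_iff)
  moreover have "B'^2 - 4 * C' * A' = (B^2 - 4 * C * A) * (a * d - b * c)^2"
    by (simp add: A'_def B'_def C'_def power2_eq_square algebra_simps)
  ultimately show ?thesis unfolding has_form_def using 1 2 g *(3) by auto
qed

lemma self_le_power2_int: "(0::int) \<le> x \<Longrightarrow> x \<le> x^2"
  by (cases "x = 0") (auto simp: power2_eq_square mult_le_cancel_left1)

text \<open>Shift the variable to \<open>p / q\<close> and clear denominators: a form whose roots lie on different sides has
  an outer coefficient product that is negative. With the discriminant fixed, this bounds all coefficients.\<close>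

lemma finite_forms_crossing:
  fixes p q :: int
  assumes "q > 0"
  shows "finite {(u, v). (u - of_int p / of_int q) * (v - of_int p / of_int q) < 0 \<and> (\<exists>C. has_form D C u v)}"
proof -
  define K where "K = D * q^2"
  define f where "f = (\<lambda>(C::int, B::int, s::real). ((- of_int B + s * sqrt (of_int D)) / (2 * of_int C), (- of_int B - s * sqrt (of_int D)) / (2 * of_int C)))"
  let ?M = "{-K..K} \<times> {-(K + 2 * K * \<bar>p\<bar>)..K + 2 * K * \<bar>p\<bar>} \<times> {1, -1}"
  have "(u, v) \<in> f ` ?M"
    if uv: "(u - of_int p / of_int q) * (v - of_int p / of_int q) < 0" and F: "has_form D C u v" for u v C
  proof -
    obtain B A where *: "of_int C * (u + v) = - of_int B" "of_int C * (u * v) = of_int A" "B^2 - 4 * C * A = D"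
      and C: "C \<noteq> 0"
      using F by (auto simp: has_form_def)
    define N where "N = C * p^2 + B * p * q + A * q^2"
    have "real_of_int N = of_int C * (of_int q)\<^sup>2 * ((u - of_int p / of_int q) * (v - of_int p / of_int q))"
    proof -
      have "of_int C * (of_int q)\<^sup>2 * ((u - of_int p / of_int q) * (v - of_int p / of_int q))
        = (of_int C * (u * v)) * (of_int q)\<^sup>2 - (of_int C * (u + v)) * of_int p * of_int q + of_int C * (of_int p)\<^sup>2"
        using assms by (simp add: field_simps power2_eq_square)
      then show ?thesis unfolding * N_def by simp
    qed
    then have "real_of_int (C * N) = (of_int C)\<^sup>2 * (of_int q)\<^sup>2 * ((u - of_int p / of_int q) * (v - of_int p / of_int q))"
      by (simp add: power2_eq_square)
    also have "\<dots> < 0" using uv C assms by (simp add: mult_pos_neg)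
    finally have CN: "C * N < 0" by linarith
    then have "N \<noteq> 0" by auto
    have "\<bar>C\<bar> * 1 \<le> \<bar>C\<bar> * \<bar>N\<bar>" using \<open>N \<noteq> 0\<close> by (intro mult_left_mono) auto
    also have "\<dots> = - (C * N)" using CN by (simp add: abs_mult[symmetric])
    finally have CN': "\<bar>C\<bar> \<le> - (C * N)" by simp
    have id: "(2 * C * p + B * q)^2 - 4 * (C * N) = K"
      unfolding N_def K_def *(3)[symmetric] by (simp add: power2_eq_square algebra_simps)
    have Cb: "\<bar>C\<bar> \<le> K" using id CN' zero_le_power2[of "2 * C * p + B * q"] by linarith
    have "\<bar>2 * C * p + B * q\<bar> \<le> (2 * C * p + B * q)^2" by (metis abs_ge_zero power2_abs self_le_power2_int)
    then have "\<bar>2 * C * p + B * q\<bar> \<le> K" using id CN by linarith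
    moreover have "\<bar>2 * C * p\<bar> \<le> 2 * K * \<bar>p\<bar>" using Cb by (simp add: abs_mult mult_right_mono)
    moreover have "\<bar>B\<bar> \<le> \<bar>B * q\<bar>" using assms by (simp add: abs_mult mult_le_cancel_left1)
    ultimately have Bb: "\<bar>B\<bar> \<le> K + 2 * K * \<bar>p\<bar>" by linarith
    have "D > 0" using id CN assms zero_le_power2[of "2 * C * p + B * q"] unfolding K_def
      by (smt (verit) mult_nonpos_nonneg zero_le_power2)
    have "\<bar>of_int C * (u - v)\<bar> = sqrt (of_int D)"
      using has_form_disc[OF F] by (metis real_sqrt_abs)
    then have "of_int C * (u - v) = sqrt (of_int D) \<or> of_int C * (u - v) = - sqrt (of_int D)" by linarith
    then have "\<exists>s::real\<in>{1,-1}. of_int C * (u - v) = s * sqrt (of_int D)" by auto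
    then obtain s :: real where s: "s \<in> {1,-1}" "of_int C * (u - v) = s * sqrt (of_int D)" by blast
    have "u = (- of_int B + s * sqrt (of_int D)) / (2 * of_int C)" "v = (- of_int B - s * sqrt (of_int D)) / (2 * of_int C)"
      unfolding s(2)[symmetric] *(1)[symmetric] using C by (simp_all add: field_simps)
    then have "(u, v) = f (C, B, s)" by (simp add: f_def)
    moreover have "(C, B, s) \<in> ?M" using Cb Bb s(1) by auto
    ultimately show ?thesis by blast
  qed
  then have "{(u, v). (u - of_int p / of_int q) * (v - of_int p / of_int q) < 0 \<and> (\<exists>C. has_form D C u v)} \<subseteq> f ` ?M"
    by blast
  then show ?thesis by (rule finite_subset) simp
qed

section \<open>Invariant families of unlinked pairs of boundary points\<close>

text \<open>The combinatorial part of the proof uses only these properties of the end point pairs of the lifts.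
  Orientations are forgotten: each pair occurs in both orders.\<close>

locale geodesic_family =
  fixes L :: "(real \<times> real) set"
  assumes nonempty: "L \<noteq> {}"
    and sym: "(u, v) \<in> L \<Longrightarrow> (v, u) \<in> L"
    and inv: "(u, v) \<in> L \<Longrightarrow> gam a b c d \<Longrightarrow> (rmob a b c d u, rmob a b c d v) \<in> L"
    and orbit: "(u, v) \<in> L \<Longrightarrow> (u', v') \<in> L \<Longrightarrow>
      \<exists>a b c d. gam a b c d \<and> ((u', v') = (rmob a b c d u, rmob a b c d v) \<or> (u', v') = (rmob a b c d v, rmob a b c d u))"
    and unlinked: "(u, v) \<in> L \<Longrightarrow> (u', v') \<in> L \<Longrightarrow> \<not> (u < u' \<and> u' < v \<and> v < v')"
    and distinct: "(u, v) \<in> L \<Longrightarrow> u \<noteq> v"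
    and irrational: "(u, v) \<in> L \<Longrightarrow> u \<notin> \<rat>"
    and some_form: "\<exists>u v C D. (u, v) \<in> L \<and> has_form D C u v"
begin

lemma irrational2: "(u, v) \<in> L \<Longrightarrow> v \<notin> \<rat>" using irrational sym by blast

lemma forms:
  assumes "(u, v) \<in> L" "has_form D C u v" "(u', v') \<in> L"
  shows "\<exists>C. has_form D C u' v'"
proof -
  obtain a b c d where g: "gam a b c d"
    and e: "(u', v') = (rmob a b c d u, rmob a b c d v) \<or> (u', v') = (rmob a b c d v, rmob a b c d u)"
    using orbit[OF assms(1,3)] by blast
  show ?thesis
    using has_form_rmob[OF assms(2) gam_det[OF g] irrational[OF assms(1)] irrational2[OF assms(1)]] e has_form_sym
    by blast
qed

definition disc :: int where "disc = (SOME D. \<forall>(u, v)\<in>L. \<exists>C. has_form D C u v)"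

lemma disc: "(u, v) \<in> L \<Longrightarrow> \<exists>C. has_form disc C u v"
proof -
  have "\<exists>D. \<forall>(u, v)\<in>L. \<exists>C. has_form D C u v" using some_form forms by blast
  then have "\<forall>(u, v)\<in>L. \<exists>C. has_form disc C u v" unfolding disc_def by (rule someI_ex)
  then show "(u, v) \<in> L \<Longrightarrow> \<exists>C. has_form disc C u v" by blast
qed

text \<open>All members have forms of the same discriminant \<open>disc\<close>, as \<open>\<Gamma>\<close> acts transitively. So their lengths
  are of the form \<open>sqrt disc / C\<close> with natural numbers \<open>C\<close>, and a least \<open>C\<close> exists.\<close>

lemma longest:
  assumes "X \<subseteq> L" "X \<noteq> {}"
  obtains u v where "(u, v) \<in> X" "\<And>u' v'. (u', v') \<in> X \<Longrightarrow> \<bar>u' - v'\<bar> \<le> \<bar>u - v\<bar>"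
proof -
  define c where "c = (\<lambda>(u, v). nat \<bar>SOME C. has_form disc C u v\<bar>)"
  have c: "real (c (u, v)) * \<bar>u - v\<bar> = sqrt (of_int disc)" "c (u, v) > 0" if "(u, v) \<in> L" for u v
  proof -
    define C where "C = (SOME C. has_form disc C u v)"
    have C: "has_form disc C u v" unfolding C_def by (rule someI_ex[OF disc[OF that]])
    have "c (u, v) = nat \<bar>C\<bar>" by (simp add: c_def C_def)
    moreover have "\<bar>of_int C * (u - v)\<bar> = sqrt (of_int disc)" using has_form_disc[OF C] by (metis real_sqrt_abs)
    ultimately show "real (c (u, v)) * \<bar>u - v\<bar> = sqrt (of_int disc)" "c (u, v) > 0"
      using C by (auto simp: abs_mult has_form_def)
  qed
  obtain w where w: "w \<in> X" "\<And>w'. w' \<in> X \<Longrightarrow> c w \<le> c w'"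
    using ex_has_least_nat[of "\<lambda>w. w \<in> X" _ c] assms(2) by blast
  obtain u v where uv: "w = (u, v)" by (cases w)
  have "\<bar>u' - v'\<bar> \<le> \<bar>u - v\<bar>" if "(u', v') \<in> X" for u' v'
  proof (rule ccontr)
    assume "\<not> ?thesis"
    then have "\<bar>u - v\<bar> < \<bar>u' - v'\<bar>" by simp
    then have "real (c (u, v)) * \<bar>u - v\<bar> < real (c (u, v)) * \<bar>u' - v'\<bar>"
      using c(2) w(1) uv assms(1) by (intro mult_strict_left_mono) auto
    also have "\<dots> \<le> real (c (u', v')) * \<bar>u' - v'\<bar>"
      using w(2)[OF that] uv by (intro mult_right_mono) auto
    finally have "real (c (u, v)) * \<bar>u - v\<bar> < real (c (u', v')) * \<bar>u' - v'\<bar>" .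
    moreover have "(u, v) \<in> L" "(u', v') \<in> L" using w(1) uv that assms(1) by auto
    ultimately show False using c(1) by simp
  qed
  then show ?thesis using that w(1) uv by blast
qed

text \<open>For a rational \<open>y = p / q\<close> the vertical line over \<open>y\<close> projects to an arc from cusp to cusp.
  The cardinality of this set plays the part of the intersection number of the closed geodesic with
  that arc; every lift is counted in both orders.\<close>

definition crossing :: "real \<Rightarrow> (real \<times> real) set" where
  "crossing y = {(u, v) \<in> L. (u - y) * (v - y) < 0}"

lemma finite_crossing: "q > 0 \<Longrightarrow> finite (crossing (of_int p / of_int q))"
  by (rule finite_subset[OF _ finite_forms_crossing[of q p disc]]) (auto simp: crossing_def dest: disc)

lemma inv_half_turn:
  assumes "(u, v) \<in> L" "q > 0" "q dvd p^2 + 1" "odd n"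
  shows "(of_int (3 * n) + half_turn p q u, of_int (3 * n) + half_turn p q v) \<in> L"
  using inv[OF assms(1) gam_half_turn[OF assms(3,4) refl]]
  unfolding rmob_half_turn[OF assms(2,3) refl irrational[OF assms(1)], of "3 * n"]
    rmob_half_turn[OF assms(2,3) refl irrational2[OF assms(1)], of "3 * n"] .

lemma neq_rational: "(u, v) \<in> L \<Longrightarrow> u \<noteq> of_int p / of_int q"
  using irrational by fastforce

lemma neq_rational2: "(u, v) \<in> L \<Longrightarrow> v \<noteq> of_int p / of_int q"
  using irrational2 by fastforce

lemma half_turn_involution:
  assumes "q > 0" "x \<noteq> of_int p / of_int q"
  shows "half_turn p q (half_turn p q x) = x"
proof -
  have "x - of_int p / of_int q \<noteq> 0" using assms(2) by simp
  then show ?thesis using assms(1) by (simp add: half_turn_def divide_simps)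
qed

lemma half_turn_shift:
  assumes "q > 0"
  shows "half_turn (p + k * q) q x = of_int k + half_turn p q (x - of_int k)"
  using assms by (simp add: half_turn_def add_divide_distrib algebra_simps)

text \<open>Half-turns alone are not in \<open>\<Gamma>\<close>, so they are always combined with the translation by \<open>3\<close>.\<close>

lemma bij_half_turn:
  assumes "q > 0" "q dvd p^2 + 1"
  shows "bij_betw (\<lambda>(u, v). (3 + half_turn p q u, 3 + half_turn p q v)) L L"
proof -
  have d3: "q dvd (p + 3 * q)^2 + 1"
  proof -
    have "(p + 3 * q)^2 + 1 = (p^2 + 1) + q * (6 * p + 9 * q)" by (simp add: power2_eq_square algebra_simps)
    then show ?thesis using assms(2) by (metis dvd_add dvd_triv_left)
  qed
  define f where "f = (\<lambda>(u, v). (3 + half_turn p q u, 3 + half_turn p q v))"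
  define g where "g = (\<lambda>(u, v). (- 3 + half_turn (p + 3 * q) q u, - 3 + half_turn (p + 3 * q) q v))"
  have f: "f w \<in> L" if "w \<in> L" for w
    using inv_half_turn[of "fst w" "snd w" q p 1] that assms by (auto simp: f_def split: prod.splits)
  have g: "g w \<in> L" if "w \<in> L" for w
    using inv_half_turn[of "fst w" "snd w" q "p + 3 * q" "-1"] that assms d3 by (auto simp: g_def split: prod.splits)
  have gf: "g (f w) = w" if "w \<in> L" for w
  proof -
    obtain u v where w: "w = (u, v)" by (cases w)
    have "(u, v) \<in> L" using that w by simp
    from neq_rational[OF this] neq_rational2[OF this]
    have "half_turn p q (half_turn p q u) = u" "half_turn p q (half_turn p q v) = v"
      by (simp_all only: half_turn_involution[OF assms(1)] not_False_eq_True)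
    then show ?thesis
      by (simp add: f_def g_def half_turn_shift[OF assms(1), where k = 3, simplified] w)
  qed
  have fg: "f (g w) = w" if "w \<in> L" for w
  proof -
    obtain u v where w: "w = (u, v)" by (cases w)
    have "(u, v) \<in> L" using that w by simp
    from neq_rational[OF this, of "p + 3 * q" q] neq_rational2[OF this, of "p + 3 * q" q]
    moreover have "of_int (p + 3 * q) / of_int q = (of_int p / of_int q + 3 :: real)"
      using assms(1) by (simp add: add_divide_distrib)
    ultimately have "u - 3 \<noteq> of_int p / of_int q" "v - 3 \<noteq> of_int p / of_int q"
      by (metis diff_add_cancel)+
    then have "half_turn p q (half_turn p q (u - 3)) = u - 3" "half_turn p q (half_turn p q (v - 3)) = v - 3"
      by (simp_all only: half_turn_involution[OF assms(1)] not_False_eq_True)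
    then show ?thesis
      by (simp add: f_def g_def half_turn_shift[OF assms(1), where k = 3, simplified] w)
  qed
  have "bij_betw f L L"
    by (rule bij_betw_byWitness[where f' = g]) (use f g gf fg in auto)
  then show ?thesis by (simp add: f_def)
qed

lemma card_half_turn:
  assumes "q > 0" "q dvd p^2 + 1"
    and "\<And>u v. (u, v) \<in> L \<Longrightarrow> P u v \<longleftrightarrow> Q (3 + half_turn p q u) (3 + half_turn p q v)"
  shows "card {(u, v) \<in> L. P u v} = card {(u, v) \<in> L. Q u v}"
proof -
  define f where "f = (\<lambda>(u, v). (3 + half_turn p q u, 3 + half_turn p q v))"
  have b: "bij_betw f L L" unfolding f_def by (rule bij_half_turn[OF assms(1,2)])
  define X where "X = {(u, v) \<in> L. P u v}"
  define Y where "Y = {(u, v) \<in> L. Q u v}"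
  have iff: "f w \<in> Y \<longleftrightarrow> w \<in> X" if "w \<in> L" for w
  proof -
    obtain u v where w: "w = (u, v)" by (cases w)
    have "f w \<in> L" using b that bij_betwE by blast
    then show ?thesis using assms(3)[of u v] that by (simp add: f_def w X_def Y_def)
  qed
  have "bij_betw f X Y"
    using b
  proof (rule bij_betw_subset)
    show "X \<subseteq> L" by (auto simp: X_def)
    show "f ` X = Y"
    proof (intro equalityI subsetI)
      fix w assume "w \<in> f ` X"
      then show "w \<in> Y" using iff \<open>X \<subseteq> L\<close> by blast
    next
      fix w assume w: "w \<in> Y"
      then have "w \<in> L" by (auto simp: Y_def)
      then have "w \<in> f ` L" using b by (simp add: bij_betw_def)
      then show "w \<in> f ` X" using iff w by blast
    qed
  qed
  then show ?thesis unfolding X_def Y_def by (rule bij_betw_same_card)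
qed

text \<open>The half-turn exchanges the ends of the vertical line over \<open>p / q\<close>, hence the lifts that cross this line
  with themselves, up to the translation by \<open>3\<close>.\<close>

lemma card_crossing_shift:
  assumes "q > 0" "q dvd p^2 + 1"
  shows "card (crossing (of_int p / of_int q + 3)) = card (crossing (of_int p / of_int q))"
proof -
  let ?y = "of_int p / of_int q :: real"
  define Q where "Q = (real_of_int q)\<^sup>2"
  have Q: "Q > 0" using assms(1) by (simp add: Q_def)
  have gen: "(- (1 / (Q * s))) * (- (1 / (Q * t))) < 0 \<longleftrightarrow> s * t < 0" for s t :: real
  proof -
    have "(- (1 / (Q * s))) * (- (1 / (Q * t))) = 1 / ((Q * Q) * (s * t))" by simp
    moreover have "1 / ((Q * Q) * (s * t)) < 0 \<longleftrightarrow> s * t < 0"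
    proof -
      have "1 / (c * x) < 0 \<longleftrightarrow> x < 0" if "c > 0" for c x :: real
        using that by (simp add: divide_less_0_iff mult_less_0_iff)
      from this[OF mult_pos_pos[OF Q Q]] show ?thesis .
    qed
    ultimately show ?thesis by (simp only:)
  qed
  have sh: "3 + half_turn p q w - (?y + 3) = - (1 / (Q * (w - ?y)))" for w
    by (simp add: half_turn_def Q_def)
  have "(u - ?y) * (v - ?y) < 0 \<longleftrightarrow>
    (3 + half_turn p q u - (?y + 3)) * (3 + half_turn p q v - (?y + 3)) < 0" if "(u, v) \<in> L" for u v
    unfolding sh gen ..
  note e = card_half_turn[where P = "\<lambda>u v. (u - ?y) * (v - ?y) < 0" and
    Q = "\<lambda>u v. (u - (?y + 3)) * (v - (?y + 3)) < 0", OF assms this]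
  show ?thesis unfolding crossing_def by (rule e[symmetric])
qed

text \<open>The half-turn maps the geodesic from \<open>y\<close> to \<open>p / q\<close> to the vertical line over the image of \<open>y\<close>; the right
  side says that \<open>(u, v)\<close> is linked with the pair \<open>(y, p / q)\<close>.\<close>

lemma half_turn_crossing_iff:
  assumes "q > 0" "(u, v) \<in> L" "y \<noteq> of_int p / of_int q"
  shows "(half_turn p q u - half_turn p q y) * (half_turn p q v - half_turn p q y) < 0 \<longleftrightarrow>
    (u - y) * (v - y) * ((u - of_int p / of_int q) * (v - of_int p / of_int q)) < 0"
proof -
  define m :: real where "m = of_int p / of_int q"
  define k where "k = (of_int q)\<^sup>2 * (y - m)"
  have k: "k \<noteq> 0" using assms by (simp add: k_def m_def)
  have nz: "u - m \<noteq> 0" "v - m \<noteq> 0"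
    using neq_rational[OF assms(2), of p q] neq_rational2[OF assms(2), of p q] by (simp_all add: m_def)
  have gen: "(a / (k * s)) * (b / (k * t)) < 0 \<longleftrightarrow> a * b * (s * t) < 0" if "s \<noteq> 0" "t \<noteq> 0" for a b s t :: real
  proof -
    have "(a / (k * s)) * (b / (k * t)) = a * b * (s * t) / (k * s * t)\<^sup>2"
      using that k by (simp add: power2_eq_square)
    moreover have "(k * s * t)\<^sup>2 > 0" using that k by simp
    ultimately show ?thesis by (metis divide_less_0_iff less_asym)
  qed
  have d: "half_turn p q w - half_turn p q y = (w - y) / (k * (w - m))" if "w \<noteq> of_int p / of_int q" for w
    using half_turn_diff[OF that assms(3,1)] by (simp only: k_def m_def ac_simps)
  show ?thesis
    unfolding d[OF neq_rational[OF assms(2)]] d[OF neq_rational2[OF assms(2)]]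
    using gen[OF nz] by (simp only: m_def)
qed

end

section \<open>Frames of half-turns and their flips\<close>

text \<open>Three half-turns over \<open>y\<^sub>i = p\<^sub>i / q\<^sub>i\<close> whose vertical lines, together with their translates by multiples of
  \<open>3\<close>, cut out the ideal triangles with a vertex at \<open>\<infinity>\<close> of a triangulation of the torus. The
  determinants express that each half-turn exchanges the neighbouring vertices (\<open>frame_half_turn\<close>).\<close>

definition frame :: "int \<Rightarrow> int \<Rightarrow> int \<Rightarrow> int \<Rightarrow> int \<Rightarrow> int \<Rightarrow> bool" where
  "frame p0 q0 p1 q1 p2 q2 \<longleftrightarrow> 0 < q0 \<and> 0 < q1 \<and> 0 < q2 \<and>
     q0 dvd p0^2 + 1 \<and> q1 dvd p1^2 + 1 \<and> q2 dvd p2^2 + 1 \<and>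
     p1 * q0 - p0 * q1 = q2 \<and> p2 * q1 - p1 * q2 = q0 \<and> (p0 + 3 * q0) * q2 - p2 * q0 = q1"

lemma dvd_shift: "(q::int) dvd p^2 + 1 \<Longrightarrow> q dvd (p + k * q)^2 + 1"
proof -
  assume "q dvd p^2 + 1"
  moreover have "(p + k * q)^2 + 1 = (p^2 + 1) + q * (2 * k * p + k^2 * q)" by (simp add: power2_eq_square algebra_simps)
  ultimately show ?thesis by (metis dvd_add dvd_triv_left)
qed

lemma frame_rotate: "frame p0 q0 p1 q1 p2 q2 \<Longrightarrow> frame p1 q1 p2 q2 (p0 + 3 * q0) q0"
  unfolding frame_def using dvd_shift[of q0 p0 3] by (simp add: algebra_simps)

lemma frame_shift: "frame p0 q0 p1 q1 p2 q2 \<Longrightarrow> frame (p0 + k * q0) q0 (p1 + k * q1) q1 (p2 + k * q2) q2"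
  unfolding frame_def using dvd_shift[of q0 p0 k] dvd_shift[of q1 p1 k] dvd_shift[of q2 p2 k]
  by (simp add: algebra_simps)

lemma frame_markoff: "frame p0 q0 p1 q1 p2 q2 \<Longrightarrow> q0^2 + q1^2 + q2^2 = 3 * q0 * q1 * q2"
proof -
  assume "frame p0 q0 p1 q1 p2 q2"
  then have 1: "p1 * q0 - p0 * q1 = q2" "p2 * q1 - p1 * q2 = q0" "(p0 + 3 * q0) * q2 - p2 * q0 = q1"
    by (auto simp: frame_def)
  have "q0 * q0 + q1 * q1 + q2 * q2 = (p2 * q1 - p1 * q2) * q0 + ((p0 + 3 * q0) * q2 - p2 * q0) * q1 + (p1 * q0 - p0 * q1) * q2"
    unfolding 1 ..
  also have "\<dots> = 3 * q0 * q1 * q2" by (simp add: algebra_simps)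
  finally show ?thesis by (simp add: power2_eq_square)
qed

text \<open>A diagonal exchange of the triangulation: the line over \<open>y\<^sub>2\<close> is replaced by a line
  between \<open>y\<^sub>0\<close> and \<open>y\<^sub>1\<close>. On the denominators it is the Vieta involution of the Markoff
  equation.\<close>

lemma frame_flip:
  assumes "frame p0 q0 p1 q1 p2 q2"
  shows "frame p0 q0 (3 * q0 * p1 - p2) (3 * q0 * q1 - q2) p1 q1"
proof -
  note f = assms[unfolded frame_def]
  obtain r0 r1 where r: "p0^2 + 1 = q0 * r0" "p1^2 + 1 = q1 * r1" using f by (auto elim!: dvdE)
  have 1: "p1 * q0 = q2 + p0 * q1" "p2 * q1 = q0 + p1 * q2" "p2 * q0 = (p0 + 3 * q0) * q2 - q1" using f by auto
  have "q1 * (q0 * r1 - p0 * p1) = q1 * p2"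
  proof -
    have "q1 * (q0 * r1 - p0 * p1) = q0 * (q1 * r1) - p0 * p1 * q1" by (simp add: algebra_simps)
    also have "\<dots> = p1 * (p1 * q0 - p0 * q1) + q0" unfolding r(2)[symmetric] by (simp add: algebra_simps power2_eq_square)
    also have "\<dots> = q1 * p2" using f by (simp add: algebra_simps)
    finally show ?thesis .
  qed
  then have e2: "q0 * r1 - p0 * p1 = p2" using f by simp
  have "q0 * (p0 * p1 - r0 * q1) = q0 * (p2 - 3 * q2)"
  proof -
    have "q0 * (p0 * p1 - r0 * q1) = p0 * (p1 * q0) - (q0 * r0) * q1" by (simp add: algebra_simps)
    also have "\<dots> = p0 * q2 - q1" unfolding r(1)[symmetric] 1(1) by (simp add: algebra_simps power2_eq_square)
    also have "\<dots> = q0 * (p2 - 3 * q2)" using f by (simp add: algebra_simps)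
    finally show ?thesis .
  qed
  then have e3: "p0 * p1 - r0 * q1 = p2 - 3 * q2" using f by simp
  let ?p = "3 * q0 * p1 - p2" and ?q = "3 * q0 * q1 - q2" and ?r = "3 * p0 * p1 + r0 * p1 - p0 * r1"
  have a: "p0 * p1 - (3 * p0 + r0) * q1 = - ?p" using e3 1(1) by (simp add: algebra_simps)
  have b: "(3 * q0 + p0) * p1 - q0 * r1 = ?p" using e2 by (simp add: algebra_simps)
  have c: "q0 * p1 - (3 * q0 + p0) * q1 = - ?q" using 1(1) by (simp add: algebra_simps)
  have "(p0 * p1 - (3 * p0 + r0) * q1) * ((3 * q0 + p0) * p1 - q0 * r1) - ?r * (q0 * p1 - (3 * q0 + p0) * q1)
     = (q0 * r0 - p0^2) * (q1 * r1 - p1^2)" by (simp add: power2_eq_square algebra_simps)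
  also have "\<dots> = 1" unfolding r[symmetric] by simp
  finally have "?q * ?r = ?p^2 + 1" unfolding a b c by (simp add: power2_eq_square algebra_simps)
  then have d: "?q dvd ?p^2 + 1" by (metis dvd_triv_left)
  have "q2 * ?q = q0^2 + q1^2" using frame_markoff[OF assms] by (simp add: algebra_simps power2_eq_square)
  moreover have "q0^2 + q1^2 > 0" using f by (simp add: sum_power2_gt_zero_iff)
  ultimately have "?q > 0" using f by (metis zero_less_mult_pos)
  moreover have "?p * q0 - p0 * ?q = q1"
  proof -
    have "?p * q0 - p0 * ?q = 3 * q0 * (p1 * q0 - p0 * q1) - (p2 * q0 - p0 * q2)" by (simp add: algebra_simps)
    also have "\<dots> = 3 * q0 * q2 - (((p0 + 3 * q0) * q2 - q1) - p0 * q2)" unfolding 1 by simp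
    finally show ?thesis by (simp add: algebra_simps)
  qed
  moreover have "p1 * ?q - ?p * q1 = q0" using 1 by (simp add: algebra_simps)
  moreover have "(p0 + 3 * q0) * q1 - p1 * q0 = ?q" using 1 by (simp add: algebra_simps)
  ultimately show ?thesis unfolding frame_def using f d by blast
qed

abbreviation fr :: "int \<Rightarrow> int \<Rightarrow> real" where "fr p q \<equiv> of_int p / of_int q"

lemma fr_shift: "q > 0 \<Longrightarrow> fr (p + k * q) q = fr p q + of_int k"
  by (simp add: add_divide_distrib)

lemma frame_gap:
  assumes "frame p0 q0 p1 q1 p2 q2"
  shows "fr p1 q1 - fr p0 q0 = of_int q2 / (of_int q0 * of_int q1)"
proof -
  have "real_of_int p1 * of_int q0 - of_int p0 * of_int q1 = of_int q2"
    using assms by (auto simp: frame_def simp flip: of_int_mult of_int_diff)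
  then show ?thesis using assms by (simp add: frame_def diff_frac_eq mult.commute)
qed

lemma frame_pos: "frame p0 q0 p1 q1 p2 q2 \<Longrightarrow> 0 < q0 \<and> 0 < q1 \<and> 0 < q2"
  by (simp add: frame_def)

lemma frame_dvd: "frame p0 q0 p1 q1 p2 q2 \<Longrightarrow> q0 dvd p0^2 + 1 \<and> q1 dvd p1^2 + 1 \<and> q2 dvd p2^2 + 1"
  by (simp add: frame_def)

lemma frame_less: "frame p0 q0 p1 q1 p2 q2 \<Longrightarrow> fr p0 q0 < fr p1 q1 \<and> fr p1 q1 < fr p2 q2 \<and> fr p2 q2 < fr p0 q0 + 3"
proof -
  have *: "fr p0 q0 < fr p1 q1" if "frame p0 q0 p1 q1 p2 q2" for p0 q0 p1 q1 p2 q2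
  proof -
    have "real_of_int q2 / (of_int q0 * of_int q1) > 0" using frame_pos[OF that] by simp
    then show ?thesis using frame_gap[OF that] by linarith
  qed
  assume f: "frame p0 q0 p1 q1 p2 q2"
  show ?thesis using *[OF f] *[OF frame_rotate[OF f]] *[OF frame_rotate[OF frame_rotate[OF f]]]
    frame_pos[OF f] fr_shift[of q0 p0 3] by simp
qed

lemma frame_half_turn:
  assumes "frame p0 q0 p1 q1 p2 q2"
  shows "half_turn p1 q1 (fr p0 q0) = fr p2 q2" "half_turn p1 q1 (fr p2 q2) = fr p0 q0"
proof -
  note pos = frame_pos[OF assms]
  have 1: "fr p0 q0 - fr p1 q1 = - (of_int q2 / (of_int q0 * of_int q1))" using frame_gap[OF assms] by simp
  have 2: "fr p2 q2 - fr p1 q1 = of_int q0 / (of_int q1 * of_int q2)" using frame_gap[OF frame_rotate[OF assms]] by simp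
  have "half_turn p1 q1 (fr p0 q0) = fr p1 q1 + of_int q0 / (of_int q1 * of_int q2)"
    unfolding half_turn_def 1 using pos by (simp add: power2_eq_square)
  then show *: "half_turn p1 q1 (fr p0 q0) = fr p2 q2" using 2 by simp
  have "half_turn p1 q1 (fr p2 q2) = fr p1 q1 - of_int q2 / (of_int q0 * of_int q1)"
    unfolding half_turn_def 2 using pos by (simp add: power2_eq_square)
  then show "half_turn p1 q1 (fr p2 q2) = fr p0 q0" using 1 by simp
qed

context geodesic_family
begin

text \<open>The lifts that cross the geodesic between \<open>y\<close> and \<open>y'\<close>, the third side of the triangle
  with the vertical lines over \<open>y\<close> and \<open>y'\<close>.\<close>

definition bottom :: "real \<Rightarrow> real \<Rightarrow> (real \<times> real) set" where
  "bottom y y' = {(u, v) \<in> L. (u - y) * (v - y) * ((u - y') * (v - y')) < 0}"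

lemma bottom_eq:
  "bottom (fr p q) (fr p' q') = (crossing (fr p q) - crossing (fr p' q')) \<union> (crossing (fr p' q') - crossing (fr p q))"
proof -
  have "(u - fr p q) * (v - fr p q) * ((u - fr p' q') * (v - fr p' q')) < 0 \<longleftrightarrow>
    ((u - fr p q) * (v - fr p q) < 0 \<longleftrightarrow> \<not> (u - fr p' q') * (v - fr p' q') < 0)" if "(u, v) \<in> L" for u v
  proof -
    have "(u - fr p q) * (v - fr p q) \<noteq> 0" "(u - fr p' q') * (v - fr p' q') \<noteq> 0"
      using neq_rational[OF that] neq_rational2[OF that] by auto
    moreover have "x * z < 0 \<longleftrightarrow> (x < 0 \<longleftrightarrow> \<not> z < 0)" if "x \<noteq> 0" "z \<noteq> 0" for x z :: real
      using that by (auto simp: mult_less_0_iff)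
    ultimately show ?thesis by blast
  qed
  then show ?thesis unfolding bottom_def crossing_def by blast
qed

text \<open>The half-turn over \<open>y\<^sub>1\<close> maps the geodesic between \<open>y\<^sub>0\<close> and \<open>y\<^sub>1\<close> to the vertical line over
  \<open>y\<^sub>2\<close>.\<close>

lemma card_bottom:
  assumes "frame p0 q0 p1 q1 p2 q2"
  shows "card (bottom (fr p0 q0) (fr p1 q1)) = card (crossing (fr p2 q2))"
proof -
  note pos = frame_pos[OF assms] and dv = frame_dvd[OF assms]
  let ?h = "half_turn p1 q1"
  have "card {(u, v) \<in> L. (u - fr p0 q0) * (v - fr p0 q0) * ((u - fr p1 q1) * (v - fr p1 q1)) < 0}
    = card {(u, v) \<in> L. (u - (fr p2 q2 + 3)) * (v - (fr p2 q2 + 3)) < 0}"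
  proof (rule card_half_turn[of q1 p1])
    fix u v assume uv: "(u, v) \<in> L"
    have "fr p0 q0 \<noteq> fr p1 q1" using frame_less[OF assms] by simp
    from half_turn_crossing_iff[OF _ uv this] pos
    show "(u - fr p0 q0) * (v - fr p0 q0) * ((u - fr p1 q1) * (v - fr p1 q1)) < 0 \<longleftrightarrow>
      (3 + ?h u - (fr p2 q2 + 3)) * (3 + ?h v - (fr p2 q2 + 3)) < 0"
      unfolding frame_half_turn[OF assms] by simp
  qed (use pos dv in auto)
  then show ?thesis using card_crossing_shift[of q2 p2] pos dv by (simp add: bottom_def crossing_def)
qed

text \<open>The quantity that decreases in the descent.\<close>

definition weight :: "int \<Rightarrow> int \<Rightarrow> int \<Rightarrow> int \<Rightarrow> int \<Rightarrow> int \<Rightarrow> nat" where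
  "weight p0 q0 p1 q1 p2 q2 = card (crossing (fr p0 q0)) + card (crossing (fr p1 q1)) + card (crossing (fr p2 q2))"

lemma fin: "frame p0 q0 p1 q1 p2 q2 \<Longrightarrow>
    finite (crossing (fr p0 q0)) \<and> finite (crossing (fr p1 q1)) \<and> finite (crossing (fr p2 q2))"
  using finite_crossing frame_pos by blast

text \<open>In a triangle a lift enters through one side and leaves through another. If none cuts off the corner
  at \<open>\<infinity>\<close>, the crossings of the third side are those of the other two. The second
  claim comes from the same count in the translate of the triangle by \<open>3\<close>.\<close>

lemma opposite_corner:
  assumes f: "frame p0 q0 p1 q1 p2 q2"
    and e: "crossing (fr p0 q0) \<inter> crossing (fr p1 q1) = {}"
  shows "card (crossing (fr p2 q2)) = card (crossing (fr p0 q0)) + card (crossing (fr p1 q1))"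
    and "crossing (fr p0 q0 + 3) \<inter> crossing (fr p1 q1 + 3) = {}"
proof -
  note pos = frame_pos[OF f] and dv = frame_dvd[OF f]
  have "bottom (fr p0 q0) (fr p1 q1) = crossing (fr p0 q0) \<union> crossing (fr p1 q1)"
    using e unfolding bottom_eq by auto
  then show 1: "card (crossing (fr p2 q2)) = card (crossing (fr p0 q0)) + card (crossing (fr p1 q1))"
    using card_bottom[OF f] card_Un_disjoint[OF _ _ e] fin[OF f] by simp
  let ?f = "frame (p0 + 3 * q0) q0 (p1 + 3 * q1) q1 (p2 + 3 * q2) q2"
  have f3: ?f by (rule frame_shift[OF f])
  have s: "fr (p0 + 3 * q0) q0 = fr p0 q0 + 3" "fr (p1 + 3 * q1) q1 = fr p1 q1 + 3" "fr (p2 + 3 * q2) q2 = fr p2 q2 + 3"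
    using pos fr_shift[of q0 p0 3] fr_shift[of q1 p1 3] fr_shift[of q2 p2 3] by simp_all
  let ?A = "crossing (fr p0 q0 + 3)" and ?B = "crossing (fr p1 q1 + 3)"
  have fA: "finite ?A" "finite ?B" using fin[OF f3] unfolding s by auto
  have "card (crossing (fr p2 q2)) = card (bottom (fr p0 q0 + 3) (fr p1 q1 + 3))"
    using card_bottom[OF f3] card_crossing_shift[of q2 p2] pos dv unfolding s by simp
  also have "\<dots> = card (?A - ?B) + card (?B - ?A)"
    using bottom_eq[of "p0 + 3 * q0" q0 "p1 + 3 * q1" q1] fA unfolding s by (subst card_Un_disjoint[symmetric]) auto
  also have "\<dots> = (card ?A - card (?A \<inter> ?B)) + (card ?B - card (?A \<inter> ?B))"
    using fA by (simp add: card_Diff_subset_Int Int_commute)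
  finally have "card (?A \<inter> ?B) = 0"
    using 1 card_crossing_shift[of q0 p0] card_crossing_shift[of q1 p1] pos dv
      card_mono[OF fA(1), of "?A \<inter> ?B"] card_mono[OF fA(2), of "?A \<inter> ?B"] by auto
  then show "?A \<inter> ?B = {}" using fA by simp
qed

text \<open>A lift that crosses the new line but not the side between \<open>y\<^sub>0\<close> and \<open>y\<^sub>1\<close> avoids the lines over
  \<open>y\<^sub>0\<close> and \<open>y\<^sub>1\<close>. The half-turn over the new point then turns it into a lift that
  crosses both of these lines, up to the translation by \<open>3\<close>, against \<open>opposite_corner\<close>.\<close>

lemma flip_crossing_subset:
  assumes f: "frame p0 q0 p1 q1 p2 q2"
    and e: "crossing (fr p0 q0) \<inter> crossing (fr p1 q1) = {}"
    and p: "p = 3 * q0 * p1 - p2" "q = 3 * q0 * q1 - q2"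
  shows "crossing (fr p q) \<subseteq> bottom (fr p0 q0) (fr p1 q1)"
proof
  fix w assume w: "w \<in> crossing (fr p q)"
  obtain u v where uv: "w = (u, v)" by (cases w)
  have L: "(u, v) \<in> L" and c: "(u - fr p q) * (v - fr p q) < 0" using w uv by (auto simp: crossing_def)
  have f': "frame p0 q0 p q p1 q1" using frame_flip[OF f] p by simp
  note pos = frame_pos[OF f'] and dv = frame_dvd[OF f'] and less = frame_less[OF f']
  show "w \<in> bottom (fr p0 q0) (fr p1 q1)"
  proof (rule ccontr)
    assume "w \<notin> bottom (fr p0 q0) (fr p1 q1)"
    then have "w \<notin> crossing (fr p0 q0)" "w \<notin> crossing (fr p1 q1)"
      using e unfolding bottom_eq by blast+
    then have n: "\<not> (u - fr p0 q0) * (v - fr p0 q0) < 0" "\<not> (u - fr p1 q1) * (v - fr p1 q1) < 0"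
      using L uv by (auto simp: crossing_def)
    have nz: "u \<noteq> fr p0 q0" "u \<noteq> fr p1 q1" "v \<noteq> fr p0 q0" "v \<noteq> fr p1 q1"
      using neq_rational[OF L] neq_rational2[OF L] by auto
    then have n': "(u - fr p0 q0) * (v - fr p0 q0) > 0" "(u - fr p1 q1) * (v - fr p1 q1) > 0"
      using n by (auto simp: not_less less_le)
    have ne: "fr p0 q0 \<noteq> fr p q" "fr p1 q1 \<noteq> fr p q" using less by auto
    have "(half_turn p q u - fr p1 q1) * (half_turn p q v - fr p1 q1) < 0"
      using half_turn_crossing_iff[OF _ L ne(1)] pos n'(1) c unfolding frame_half_turn[OF f'] by (simp add: mult_pos_neg)
    moreover have "(half_turn p q u - fr p0 q0) * (half_turn p q v - fr p0 q0) < 0"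
      using half_turn_crossing_iff[OF _ L ne(2)] pos n'(2) c unfolding frame_half_turn[OF f'] by (simp add: mult_pos_neg)
    moreover have "(3 + half_turn p q u, 3 + half_turn p q v) \<in> L"
      using inv_half_turn[OF L, of q p 1] pos dv by simp
    ultimately have "(3 + half_turn p q u, 3 + half_turn p q v) \<in> crossing (fr p0 q0 + 3) \<inter> crossing (fr p1 q1 + 3)"
      by (simp add: crossing_def)
    then show False using opposite_corner(2)[OF f e] by simp
  qed
qed

end

lemma strict_mono_finite_fixed:
  fixes f :: "real \<Rightarrow> real"
  assumes "finite X" "f ` X \<subseteq> X" "strict_mono_on X f" "x \<in> X"
  shows "f x = x"
proof -
  have inj: "inj_on f X" using assms(3) by (rule strict_mono_on_imp_inj_on)
  have im: "f ` X = X" using assms(1,2) inj by (simp add: endo_inj_surj)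
  have less: "f y < f z \<longleftrightarrow> y < z" if "y \<in> X" "z \<in> X" for y z
    using strict_mono_on_less[OF assms(3)] that by blast
  have "f ` {y\<in>X. y < x} = {y\<in>X. y < f x}"
  proof (intro equalityI subsetI)
    fix y assume y: "y \<in> {y\<in>X. y < f x}"
    then obtain z where z: "z \<in> X" "y = f z" using im by blast
    then have "z < x" using y less[OF z(1) assms(4)] by simp
    then show "y \<in> f ` {y\<in>X. y < x}" using z by blast
  qed (use im less assms(4) in auto)
  moreover have "card (f ` {y\<in>X. y < x}) = card {y\<in>X. y < x}"
    by (intro card_image inj_on_subset[OF inj]) auto
  ultimately have c: "card {y\<in>X. y < x} = card {y\<in>X. y < f x}" by simp
  have fx: "f x \<in> X" using assms(2,4) by blast
  show ?thesis
  proof (rule linorder_cases[of "f x" x])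
    assume l: "f x < x"
    have "{y\<in>X. y < f x} \<subset> {y\<in>X. y < x}" using l fx by auto
    then have "card {y\<in>X. y < f x} < card {y\<in>X. y < x}" using assms(1) by (intro psubset_card_mono) auto
    then show ?thesis using c by simp
  next
    assume l: "x < f x"
    have "{y\<in>X. y < x} \<subset> {y\<in>X. y < f x}" using l assms(4) by auto
    then have "card {y\<in>X. y < x} < card {y\<in>X. y < f x}" using assms(1) by (intro psubset_card_mono) auto
    then show ?thesis using c by simp
  qed auto
qed

section \<open>Descent to a frame adapted to the family\<close>

context geodesic_family
begin

lemma weight_rotate:
  assumes "frame p0 q0 p1 q1 p2 q2"
  shows "weight p1 q1 p2 q2 (p0 + 3 * q0) q0 = weight p0 q0 p1 q1 p2 q2"
  using card_crossing_shift[of q0 p0] fr_shift[of q0 p0 3] frame_pos[OF assms] frame_dvd[OF assms]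
  by (simp add: weight_def)

text \<open>If the flip does not decrease the weight, the new line is crossed at least as often as the side
  between \<open>y\<^sub>0\<close> and \<open>y\<^sub>1\<close>, and the inclusion is an equality.\<close>

lemma flip_step:
  assumes f: "frame p0 q0 p1 q1 p2 q2"
    and e: "crossing (fr p0 q0) \<inter> crossing (fr p1 q1) = {}"
    and p: "p = 3 * q0 * p1 - p2" "q = 3 * q0 * q1 - q2"
    and min: "weight p0 q0 p1 q1 p2 q2 \<le> weight p0 q0 p q p1 q1"
  shows "crossing (fr p q) = bottom (fr p0 q0) (fr p1 q1)"
proof -
  have "card (bottom (fr p0 q0) (fr p1 q1)) \<le> card (crossing (fr p q))"
    using min card_bottom[OF f] by (simp add: weight_def)
  moreover have "finite (bottom (fr p0 q0) (fr p1 q1))"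
    unfolding bottom_eq using fin[OF f] by simp
  ultimately show ?thesis
    using flip_crossing_subset[OF f e p] card_seteq by blast
qed

text \<open>The product \<open>B\<close> of the half-turn over \<open>y\<^sub>1\<close> with the translation by \<open>-3\<close> maps the finite set \<open>S\<close>
  of lifts over \<open>y\<^sub>0\<close> into itself: by the assumption their right ends lie between the new point
  and \<open>y\<^sub>1\<close>, an interval that \<open>B\<close> moves to the right of \<open>y\<^sub>0\<close>. On the end points \<open>B\<close>
  is strictly increasing, so it fixes them. Being the fixed points of \<open>B\<close>, they satisfy
  an explicit quadratic equation.\<close>

lemma terminal_frame:
  assumes f: "frame p0 q0 p1 q1 p2 q2"
    and e: "crossing (fr p0 q0) \<inter> crossing (fr p1 q1) = {}"
    and p: "p = 3 * q0 * p1 - p2" "q = 3 * q0 * q1 - q2"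
    and eq: "crossing (fr p q) = bottom (fr p0 q0) (fr p1 q1)"
    and ne: "crossing (fr p0 q0) \<noteq> {}"
  shows "\<exists>(u, v) \<in> L. u < v \<and> u + v = 2 * fr p1 q1 - 3 \<and> u * v = fr p1 q1 * (fr p1 q1 - 3) + 1 / (of_int q1)\<^sup>2"
proof -
  have f': "frame p0 q0 p q p1 q1" using frame_flip[OF f] p by simp
  note pos = frame_pos[OF f'] and dv = frame_dvd[OF f'] and less = frame_less[OF f']
  define y where "y = fr p1 q1"
  define Q where "Q = (real_of_int q1)\<^sup>2"
  have Q: "Q > 0" using pos by (simp add: Q_def)
  define B where "B = (\<lambda>z. half_turn p1 q1 z - 3)"
  have B_less: "B z < B w" if "z < w" "w < y" for z w
  proof -
    have "half_turn p1 q1 z - half_turn p1 q1 w = (z - w) / (Q * (z - y) * (w - y))"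
      using half_turn_diff[of z p1 q1 w] that pos by (simp add: y_def Q_def)
    also have "\<dots> < 0" using that Q by (simp add: divide_less_0_iff mult_neg_neg zero_less_mult_iff mult_less_0_iff)
    finally show ?thesis by (simp add: B_def)
  qed
  have By0: "B (fr p0 q0) < fr p0 q0"
    using frame_half_turn(1)[OF f] frame_less[OF f] by (simp add: B_def)
  have Byp: "B (fr p q) = fr p0 q0"
    using frame_half_turn(1)[OF frame_rotate[OF f']] fr_shift[of q0 p0 3] pos by (simp add: B_def)
  define S where "S = {(u, v) \<in> L. u < fr p0 q0 \<and> fr p0 q0 < v}"
  have S_sub: "S \<subseteq> crossing (fr p0 q0)" by (auto simp: S_def crossing_def mult_neg_pos)
  have finS: "finite S" using fin[OF f] S_sub finite_subset by blast
  have v: "fr p q < v \<and> v < y" if "(u, v) \<in> S" for u v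
  proof -
    have L: "(u, v) \<in> L" and uv: "u < fr p0 q0" "fr p0 q0 < v" using that by (auto simp: S_def)
    have c0: "(u, v) \<in> crossing (fr p0 q0)" using S_sub that by blast
    then have "(u, v) \<notin> crossing (fr p1 q1)" using e by blast
    then have "(u, v) \<in> crossing (fr p q)" using c0 eq unfolding bottom_eq by blast
    then have "(u - fr p q) * (v - fr p q) < 0" by (simp add: crossing_def)
    moreover have "u < fr p q" using uv less by simp
    ultimately have 1: "fr p q < v" by (simp add: mult_less_0_iff)
    have "\<not> (u - y) * (v - y) < 0" using \<open>(u, v) \<notin> crossing (fr p1 q1)\<close> L by (simp add: crossing_def y_def)
    moreover have "u < y" using uv less by (simp add: y_def)
    ultimately have "v \<le> y" by (simp add: mult_less_0_iff not_less)
    moreover have "v \<noteq> y" using neq_rational2[OF L] by (simp add: y_def)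
    ultimately show ?thesis using 1 by simp
  qed
  have BS: "(B u, B v) \<in> S" if "(u, v) \<in> S" for u v
  proof -
    have L: "(u, v) \<in> L" and uv: "u < fr p0 q0" "fr p0 q0 < v" using that by (auto simp: S_def)
    have "(B u, B v) \<in> L"
      using inv_half_turn[OF L, of q1 p1 "-1"] pos dv by (simp add: B_def)
    moreover have "B u < fr p0 q0" using B_less[OF uv(1)] By0 less by (simp add: y_def)
    moreover have "fr p0 q0 < B v" using B_less[of "fr p q" v] v[OF that] Byp by simp
    ultimately show ?thesis by (simp add: S_def)
  qed
  obtain u v where uv: "(u, v) \<in> S"
  proof -
    obtain a b where ab: "(a, b) \<in> L" "(a - fr p0 q0) * (b - fr p0 q0) < 0" using ne by (auto simp: crossing_def)
    then have "(a, b) \<in> S \<or> (b, a) \<in> S" using sym[OF ab(1)] by (auto simp: S_def mult_less_0_iff)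
    then show ?thesis using that by blast
  qed
  have mono: "strict_mono_on X B" if "\<And>z. z \<in> X \<Longrightarrow> z < y" for X
    by (rule strict_mono_onI) (use that B_less in blast)
  have Bu: "B u = u"
  proof (rule strict_mono_finite_fixed[of "fst ` S"])
    show "B ` fst ` S \<subseteq> fst ` S" using BS by force
    show "strict_mono_on (fst ` S) B"
      by (rule mono) (use less in \<open>auto simp: S_def y_def\<close>)
    show "u \<in> fst ` S" using uv by force
  qed (use finS in simp)
  have Bv: "B v = v"
  proof (rule strict_mono_finite_fixed[of "snd ` S"])
    show "B ` snd ` S \<subseteq> snd ` S" using BS by force
    show "strict_mono_on (snd ` S) B"
      by (rule mono) (use v in auto)
    show "v \<in> snd ` S" using uv by force
  qed (use finS in simp)
  have root: "(z - y) * (z - y + 3) = - 1 / Q" if "B z = z" "z < y" for z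
  proof -
    have "y - 1 / (Q * (z - y)) - 3 = z" using that(1) by (simp add: B_def half_turn_def y_def Q_def)
    then have "z - y + 3 = - (1 / (Q * (z - y)))" by simp
    then show ?thesis using that(2) Q by (simp add: field_simps)
  qed
  have uy: "u < v" "u < y" "v < y" using uv v[OF uv] by (auto simp: S_def)
  have "(u - v) * (u + v - (2 * y - 3)) = (u - y) * (u - y + 3) - (v - y) * (v - y + 3)" by (simp add: algebra_simps)
  also have "\<dots> = 0" using root[OF Bu uy(2)] root[OF Bv uy(3)] by simp
  finally have sum: "u + v = 2 * y - 3" using uy by simp
  then have v_eq: "v = 2 * y - 3 - u" by simp
  have "u * v = y * (y - 3) - (u - y) * (u - y + 3)" unfolding v_eq by (simp add: algebra_simps)
  also have "\<dots> = y * (y - 3) + 1 / Q" using root[OF Bu uy(2)] by simp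
  finally have "u * v = y * (y - 3) + 1 / Q" .
  moreover have "(u, v) \<in> L" using uv by (simp add: S_def)
  ultimately show ?thesis using sum uy(1) by (intro bexI[of _ "(u, v)"]) (simp_all add: y_def Q_def)
qed

text \<open>Some member of the family has the end points of the axis of the half-turn over \<open>y\<^sub>1\<close> followed by the
  translation by \<open>-3\<close>.\<close>

definition has_core :: bool where
  "has_core \<longleftrightarrow> (\<exists>p0 q0 p1 q1 p2 q2. frame p0 q0 p1 q1 p2 q2 \<and>
     (\<exists>(u, v) \<in> L. u < v \<and> u + v = 2 * fr p1 q1 - 3 \<and> u * v = fr p1 q1 * (fr p1 q1 - 3) + 1 / (of_int q1)\<^sup>2))"

text \<open>If the line over \<open>y\<^sub>0\<close> is not crossed, the rotated frame that starts with \<open>y\<^sub>2 - 3\<close> has the same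
  weight and a crossed first line.\<close>

lemma corner_step:
  assumes f: "frame p0 q0 p1 q1 p2 q2"
    and e: "crossing (fr p0 q0) \<inter> crossing (fr p1 q1) = {}"
    and w: "weight p0 q0 p1 q1 p2 q2 > 0"
    and min: "\<And>p0' q0' p1' q1' p2' q2'. frame p0' q0' p1' q1' p2' q2' \<Longrightarrow> weight p0' q0' p1' q1' p2' q2' > 0 \<Longrightarrow>
       weight p0 q0 p1 q1 p2 q2 \<le> weight p0' q0' p1' q1' p2' q2'"
  shows has_core
proof -
  have flip_min: "weight p0 q0 p1 q1 p2 q2 \<le> weight a0 b0 (3 * b0 * a1 - a2) (3 * b0 * b1 - b2) a1 b1"
    if "frame a0 b0 a1 b1 a2 b2" "crossing (fr a0 b0) \<inter> crossing (fr a1 b1) = {}" "weight a0 b0 a1 b1 a2 b2 > 0"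
    for a0 b0 a1 b1 a2 b2
  proof (rule min[OF frame_flip[OF that(1)]])
    show "weight a0 b0 (3 * b0 * a1 - a2) (3 * b0 * b1 - b2) a1 b1 > 0"
      using that(3) opposite_corner(1)[OF that(1,2)] by (auto simp: weight_def)
  qed
  show ?thesis
  proof (cases "crossing (fr p0 q0) = {}")
    case False
    have "crossing (fr (3 * q0 * p1 - p2) (3 * q0 * q1 - q2)) = bottom (fr p0 q0) (fr p1 q1)"
      by (rule flip_step[OF f e refl refl flip_min[OF f e w]])
    from terminal_frame[OF f e refl refl this False] f show ?thesis unfolding has_core_def by blast
  next
    case True
    have f': "frame (p2 - 3 * q2) q2 p0 q0 p1 q1"
      using frame_rotate[OF frame_rotate[OF frame_shift[OF f, of "-3"]]] by (simp add: algebra_simps)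
    have w': "weight (p2 - 3 * q2) q2 p0 q0 p1 q1 = weight p0 q0 p1 q1 p2 q2"
      using weight_rotate[OF f'] by simp
    have e': "crossing (fr (p2 - 3 * q2) q2) \<inter> crossing (fr p0 q0) = {}" using True by simp
    have "card (crossing (fr p1 q1)) > 0"
      using w True opposite_corner(1)[OF f e] by (simp add: weight_def)
    then have "card (crossing (fr (p2 - 3 * q2) q2)) > 0"
      using opposite_corner(1)[OF f' e'] True by simp
    then have ne: "crossing (fr (p2 - 3 * q2) q2) \<noteq> {}" by auto
    have "crossing (fr (3 * q2 * p0 - p1) (3 * q2 * q0 - q1)) = bottom (fr (p2 - 3 * q2) q2) (fr p0 q0)"
      by (rule flip_step[OF f' e' refl refl]) (use flip_min[OF f' e'] w w' in simp)
    from terminal_frame[OF f' e' refl refl this ne] f' show ?thesis unfolding has_core_def by blast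
  qed
qed

definition lines :: "int \<Rightarrow> int \<Rightarrow> int \<Rightarrow> int \<Rightarrow> int \<Rightarrow> int \<Rightarrow> real set" where
  "lines p0 q0 p1 q1 p2 q2 = (\<Union>k::int. {fr p0 q0 + 3 * of_int k, fr p1 q1 + 3 * of_int k, fr p2 q2 + 3 * of_int k})"

lemma fr_shift3: "q > 0 \<Longrightarrow> fr (p + (3 * k) * q) q = fr p q + 3 * of_int k"
  using fr_shift[of q p "3 * k"] by simp

lemma card_crossing_shift_int:
  assumes "q > 0" "q dvd p^2 + 1"
  shows "card (crossing (fr p q + 3 * of_int k)) = card (crossing (fr p q))"
proof -
  have step: "card (crossing (fr p q + 3 * of_int (i + 1))) = card (crossing (fr p q + 3 * of_int i))" for i
  proof -
    have "fr p q + 3 * of_int (i + 1) = (fr p q + 3 * of_int i) + 3" by simp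
    then show ?thesis
      using card_crossing_shift[OF assms(1) dvd_shift[OF assms(2)], of "3 * i"]
      unfolding fr_shift3[OF assms(1)] by (simp only:)
  qed
  show ?thesis
  proof (induction k rule: int_induct[where k = 0])
    case (step2 i)
    then show ?case using step[of "i - 1"] by simp
  qed (use step in auto)
qed

lemma lines_rotate:
  assumes "frame p0 q0 p1 q1 p2 q2"
  shows "lines p1 q1 p2 q2 (p0 + 3 * q0) q0 = lines p0 q0 p1 q1 p2 q2"
proof -
  have eq: "fr (p0 + 3 * q0) q0 + 3 * of_int k = fr p0 q0 + 3 * of_int (k + 1)" for k
    using fr_shift[of q0 p0 3] frame_pos[OF assms] by simp
  show ?thesis
  proof (intro equalityI subsetI)
    fix x assume "x \<in> lines p1 q1 p2 q2 (p0 + 3 * q0) q0"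
    then show "x \<in> lines p0 q0 p1 q1 p2 q2" unfolding lines_def eq by blast
  next
    fix x assume "x \<in> lines p0 q0 p1 q1 p2 q2"
    then obtain k where "x = fr p0 q0 + 3 * of_int k \<or> x = fr p1 q1 + 3 * of_int k \<or> x = fr p2 q2 + 3 * of_int k"
      unfolding lines_def by blast
    moreover have "fr p0 q0 + 3 * of_int k = fr (p0 + 3 * q0) q0 + 3 * of_int (k - 1)" unfolding eq by simp
    ultimately show "x \<in> lines p1 q1 p2 q2 (p0 + 3 * q0) q0" unfolding lines_def by blast
  qed
qed

lemma lines_shift:
  assumes "frame p0 q0 p1 q1 p2 q2"
  shows "lines (p0 + (3 * k) * q0) q0 (p1 + (3 * k) * q1) q1 (p2 + (3 * k) * q2) q2 = lines p0 q0 p1 q1 p2 q2"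
proof -
  have pos: "q0 > 0" "q1 > 0" "q2 > 0" using frame_pos[OF assms] by auto
  have e: "x + 3 * of_int k + 3 * of_int j = x + 3 * of_int (k + j)" for x :: real and j by simp
  show ?thesis
  proof (intro equalityI subsetI)
    fix x assume "x \<in> lines (p0 + (3 * k) * q0) q0 (p1 + (3 * k) * q1) q1 (p2 + (3 * k) * q2) q2"
    then show "x \<in> lines p0 q0 p1 q1 p2 q2"
      unfolding lines_def fr_shift3[OF pos(1)] fr_shift3[OF pos(2)] fr_shift3[OF pos(3)] e by blast
  next
    fix x assume "x \<in> lines p0 q0 p1 q1 p2 q2"
    then obtain j where "x = fr p0 q0 + 3 * of_int (k + (j - k)) \<or> x = fr p1 q1 + 3 * of_int (k + (j - k)) \<or> x = fr p2 q2 + 3 * of_int (k + (j - k))"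
      unfolding lines_def by auto
    then show "x \<in> lines (p0 + (3 * k) * q0) q0 (p1 + (3 * k) * q1) q1 (p2 + (3 * k) * q2) q2"
      unfolding lines_def fr_shift3[OF pos(1)] fr_shift3[OF pos(2)] fr_shift3[OF pos(3)] e by blast
  qed
qed

text \<open>Translations and rotations of a frame change neither its weight nor its set of lines, and they bring
  any gap between two lines into first position.\<close>

lemma frame_at:
  assumes f: "frame p0 q0 p1 q1 p2 q2" and x: "x \<notin> lines p0 q0 p1 q1 p2 q2"
  shows "\<exists>a0 b0 a1 b1 a2 b2. frame a0 b0 a1 b1 a2 b2 \<and> fr a0 b0 < x \<and> x < fr a1 b1 \<and>
    weight a0 b0 a1 b1 a2 b2 = weight p0 q0 p1 q1 p2 q2 \<and> lines a0 b0 a1 b1 a2 b2 = lines p0 q0 p1 q1 p2 q2"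
proof -
  have pos: "q0 > 0" "q1 > 0" "q2 > 0" using frame_pos[OF f] by auto
  have dv: "q0 dvd p0^2 + 1" "q1 dvd p1^2 + 1" "q2 dvd p2^2 + 1" using frame_dvd[OF f] by auto
  define k where "k = \<lfloor>(x - fr p0 q0) / 3\<rfloor>"
  have k: "fr p0 q0 + 3 * of_int k \<le> x" "x < fr p0 q0 + 3 * of_int k + 3"
  proof -
    have "y + 3 * of_int \<lfloor>(x - y) / 3\<rfloor> \<le> x \<and> x < y + 3 * of_int \<lfloor>(x - y) / 3\<rfloor> + 3" for y :: real
      using floor_correct[of "(x - y) / 3"] by (simp add: field_simps)
    then show "fr p0 q0 + 3 * of_int k \<le> x" "x < fr p0 q0 + 3 * of_int k + 3" unfolding k_def by blast+
  qed
  define a0 where "a0 = p0 + (3 * k) * q0"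
  define a1 where "a1 = p1 + (3 * k) * q1"
  define a2 where "a2 = p2 + (3 * k) * q2"
  have F: "frame a0 q0 a1 q1 a2 q2" unfolding a0_def a1_def a2_def by (rule frame_shift[OF f])
  have e: "fr a0 q0 = fr p0 q0 + 3 * of_int k" "fr a1 q1 = fr p1 q1 + 3 * of_int k" "fr a2 q2 = fr p2 q2 + 3 * of_int k"
    unfolding a0_def a1_def a2_def using pos by (simp_all only: fr_shift3)
  have W: "weight a0 q0 a1 q1 a2 q2 = weight p0 q0 p1 q1 p2 q2"
    unfolding weight_def e using card_crossing_shift_int pos dv by simp
  have Li: "lines a0 q0 a1 q1 a2 q2 = lines p0 q0 p1 q1 p2 q2"
    unfolding a0_def a1_def a2_def by (rule lines_shift[OF f])
  have nx: "x \<noteq> fr a0 q0" "x \<noteq> fr a1 q1" "x \<noteq> fr a2 q2" using x unfolding e lines_def by blast+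
  have F1: "frame a1 q1 a2 q2 (a0 + 3 * q0) q0" by (rule frame_rotate[OF F])
  have F2: "frame a2 q2 (a0 + 3 * q0) q0 (a1 + 3 * q1) q1" by (rule frame_rotate[OF F1])
  have 0: "fr a0 q0 < x" using k nx e by simp
  consider "x < fr a1 q1" | "fr a1 q1 < x" "x < fr a2 q2" | "fr a2 q2 < x" using nx by linarith
  then show ?thesis
  proof cases
    case 1
    then show ?thesis using F 0 W Li by blast
  next
    case 2
    then show ?thesis using F1 W Li weight_rotate[OF F] lines_rotate[OF F] by metis
  next
    case 3
    have "x < fr (a0 + 3 * q0) q0" using k(2) e fr_shift[of q0 a0 3] pos by simp
    then show ?thesis using 3 F2 W Li weight_rotate[OF F] lines_rotate[OF F] weight_rotate[OF F1] lines_rotate[OF F1] by metis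
  qed
qed

lemma lines_gap:
  assumes f: "frame p0 q0 p1 q1 p2 q2" and y: "y \<in> lines p0 q0 p1 q1 p2 q2" "y < fr p1 q1"
  shows "y \<le> fr p0 q0"
proof -
  note less = frame_less[OF f]
  obtain k where k: "y = fr p0 q0 + 3 * of_int k \<or> y = fr p1 q1 + 3 * of_int k \<or> y = fr p2 q2 + 3 * of_int k"
    using y(1) unfolding lines_def by blast
  have kk: "real_of_int k \<le> 0" if "real_of_int k < 1" using that by simp
  have kk': "real_of_int k \<le> - 1" if "real_of_int k < 0"
  proof -
    have "k \<le> - 1" using that by simp
    then have "real_of_int k \<le> of_int (- 1)" by (simp only: of_int_le_iff)
    then show ?thesis by simp
  qed
  from k show ?thesis
  proof (elim disjE)
    assume "y = fr p0 q0 + 3 * of_int k" then show ?thesis using kk y(2) less by linarith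
  next
    assume "y = fr p1 q1 + 3 * of_int k" then show ?thesis using kk' y(2) less by linarith
  next
    assume "y = fr p2 q2 + 3 * of_int k" then show ?thesis using kk' y(2) less by linarith
  qed
qed

text \<open>A longest member crosses the line over an integer: otherwise it lies between two consecutive integers, and
  the half-turn over the left one would lengthen it.\<close>

lemma integer_crossing: "\<exists>m::int. crossing (of_int m) \<noteq> {}"
proof -
  obtain u v where uv: "(u, v) \<in> L" and max: "\<And>u' v'. (u', v') \<in> L \<Longrightarrow> \<bar>u' - v'\<bar> \<le> \<bar>u - v\<bar>"
    using longest[of L] nonempty by blast
  show ?thesis
  proof (rule ccontr)
    assume none: "\<not> ?thesis"
    have nc: "\<not> (u - of_int m) * (v - of_int m) < 0" for m :: int
      using none uv by (auto simp: crossing_def)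
    define m where "m = \<lfloor>u\<rfloor>"
    have nz: "u \<noteq> of_int k" "v \<noteq> of_int k" for k :: int
      using neq_rational[OF uv, of k 1] neq_rational2[OF uv, of k 1] by auto
    have u: "of_int m < u" "u < of_int m + 1" using nz(1)[of m] unfolding m_def by linarith+
    have "v > of_int m" using nc[of m] nz(2)[of m] u by (auto simp: mult_less_0_iff)
    moreover have "v < of_int m + 1" using nc[of "m + 1"] nz(2)[of "m + 1"] u by (auto simp: mult_less_0_iff)
    ultimately have v: "of_int m < v" "v < of_int m + 1" .
    have "(3 + half_turn m 1 u, 3 + half_turn m 1 v) \<in> L" using inv_half_turn[OF uv, of 1 m 1] by simp
    from max[OF this] have "\<bar>(u - v) / ((u - of_int m) * (v - of_int m))\<bar> \<le> \<bar>u - v\<bar>"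
      using half_turn_diff[of u m 1 v] u v by simp
    moreover have "0 < (u - of_int m) * (v - of_int m)" using u v by simp
    moreover have "(u - of_int m) * (v - of_int m) < 1 * 1"
      by (rule mult_strict_mono) (use u v in auto)
    moreover have "\<bar>u - v\<bar> > 0" using distinct[OF uv] by simp
    moreover have False if "\<bar>a / d\<bar> \<le> \<bar>a\<bar>" "0 < d" "d < 1 * 1" "\<bar>a\<bar> > 0" for a d :: real
    proof -
      have "\<bar>a\<bar> \<le> \<bar>a\<bar> * d" using that(1,2) by (simp add: pos_divide_le_eq)
      moreover have "\<bar>a\<bar> * d < \<bar>a\<bar> * 1" using that(3,4) by (intro mult_strict_left_mono) auto
      ultimately show False by simp
    qed
    ultimately show False by blast
  qed
qed

lemma farey_frame: "frame 0 1 1 1 2 1" by (simp add: frame_def)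

lemma farey_weight: "weight 0 1 1 1 2 1 > 0"
proof -
  obtain m :: int where m: "crossing (of_int m) \<noteq> {}" using integer_crossing by blast
  define k where "k = m div 3"
  define i where "i = m mod 3"
  have "finite (crossing (of_int m))" using finite_crossing[of 1 m] by simp
  then have "card (crossing (of_int m)) > 0" using m by (simp add: card_gt_0_iff)
  moreover have "real_of_int m = fr i 1 + 3 * of_int k"
  proof -
    have "m = i + 3 * k" by (simp add: i_def k_def)
    from arg_cong[OF this, of real_of_int] show ?thesis by simp
  qed
  ultimately have "card (crossing (fr i 1)) > 0" using card_crossing_shift_int[of 1 i k] by simp
  moreover have "i = 0 \<or> i = 1 \<or> i = 2" unfolding i_def by presburger
  ultimately show ?thesis by (auto simp: weight_def)
qed

text \<open>Take a frame of least positive weight and, among the lifts that cross its lines, a longest one. Rotate the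
  frame so that the right end lies in the first gap. A lift across both lines of this
  gap would be linked with the chosen one or be longer, so no such lift exists and
  \<open>corner_step\<close> applies.\<close>

lemma core: has_core
proof -
  define W where "W = (\<lambda>(p0, q0, p1, q1, p2, q2). weight p0 q0 p1 q1 p2 q2)"
  define P where "P = (\<lambda>(p0, q0, p1, q1, p2, q2). frame p0 q0 p1 q1 p2 q2 \<and> weight p0 q0 p1 q1 p2 q2 > 0)"
  have "P (0, 1, 1, 1, 2, 1)" using farey_frame farey_weight by (simp add: P_def)
  then obtain t where t: "P t" "\<And>t'. P t' \<Longrightarrow> W t \<le> W t'"
    using ex_has_least_nat[of P _ W] by blast
  obtain p0 q0 p1 q1 p2 q2 where tt: "t = (p0, q0, p1, q1, p2, q2)" by (cases t)
  have f: "frame p0 q0 p1 q1 p2 q2" and w: "weight p0 q0 p1 q1 p2 q2 > 0" using t(1) by (auto simp: P_def tt)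
  have min: "weight p0 q0 p1 q1 p2 q2 \<le> weight a0 b0 a1 b1 a2 b2"
    if "frame a0 b0 a1 b1 a2 b2" "weight a0 b0 a1 b1 a2 b2 > 0" for a0 b0 a1 b1 a2 b2
    using t(2)[of "(a0, b0, a1, b1, a2, b2)"] that by (simp add: P_def W_def tt)
  define X where "X = {(u, v) \<in> L. \<exists>y\<in>lines p0 q0 p1 q1 p2 q2. (u - y) * (v - y) < 0}"
  have Xs: "(v, u) \<in> X" if "(u, v) \<in> X" for u v
    using that sym unfolding X_def by (auto simp: mult.commute)
  have in_lines: "fr p0 q0 \<in> lines p0 q0 p1 q1 p2 q2" "fr p1 q1 \<in> lines p0 q0 p1 q1 p2 q2" "fr p2 q2 \<in> lines p0 q0 p1 q1 p2 q2"
    unfolding lines_def by (auto intro: exI[of _ 0])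
  have "X \<noteq> {}"
  proof -
    have "crossing (fr p0 q0) \<noteq> {} \<or> crossing (fr p1 q1) \<noteq> {} \<or> crossing (fr p2 q2) \<noteq> {}"
      using w by (auto simp: weight_def)
    then show ?thesis using in_lines unfolding X_def crossing_def by blast
  qed
  moreover have "X \<subseteq> L" by (auto simp: X_def)
  ultimately obtain u' v' where uv': "(u', v') \<in> X" and max': "\<And>a b. (a, b) \<in> X \<Longrightarrow> \<bar>a - b\<bar> \<le> \<bar>u' - v'\<bar>"
    using longest[of X] by blast
  have "\<exists>u v. (u, v) \<in> X \<and> u < v \<and> (\<forall>a b. (a, b) \<in> X \<longrightarrow> \<bar>a - b\<bar> \<le> \<bar>u - v\<bar>)"
  proof (cases "u' < v'")
    case True
    then show ?thesis using uv' max' by blast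
  next
    case False
    then have "v' < u'" using distinct uv' \<open>X \<subseteq> L\<close> by force
    moreover have "\<bar>u' - v'\<bar> = \<bar>v' - u'\<bar>" by simp
    ultimately show ?thesis using Xs[OF uv'] max' by metis
  qed
  then obtain u v where uv: "(u, v) \<in> X" "u < v" and max: "\<And>a b. (a, b) \<in> X \<Longrightarrow> \<bar>a - b\<bar> \<le> \<bar>u - v\<bar>"
    by blast
  have L: "(u, v) \<in> L" using uv \<open>X \<subseteq> L\<close> by blast
  have "v \<notin> lines p0 q0 p1 q1 p2 q2"
  proof
    assume "v \<in> lines p0 q0 p1 q1 p2 q2"
    then have "v \<in> \<rat>" unfolding lines_def by auto
    then show False using irrational2[OF L] by simp
  qed
  from frame_at[OF f this] obtain a0 b0 a1 b1 a2 b2 where F: "frame a0 b0 a1 b1 a2 b2"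
    and v: "fr a0 b0 < v" "v < fr a1 b1"
    and We: "weight a0 b0 a1 b1 a2 b2 = weight p0 q0 p1 q1 p2 q2"
    and Li: "lines a0 b0 a1 b1 a2 b2 = lines p0 q0 p1 q1 p2 q2" by blast
  obtain y where y: "y \<in> lines a0 b0 a1 b1 a2 b2" "(u - y) * (v - y) < 0" using uv(1) unfolding X_def Li by blast
  then have "u < y" "y < v" using uv(2) by (auto simp: mult_less_0_iff)
  then have "y \<le> fr a0 b0" using lines_gap[OF F y(1)] v by simp
  then have u: "u < fr a0 b0" using \<open>u < y\<close> by simp
  have a0L: "fr a0 b0 \<in> lines a0 b0 a1 b1 a2 b2" unfolding lines_def by (auto intro: exI[of _ 0])
  have "crossing (fr a0 b0) \<inter> crossing (fr a1 b1) = {}"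
  proof (rule ccontr)
    assume "\<not> ?thesis"
    then obtain a b where ab: "(a, b) \<in> crossing (fr a0 b0)" "(a, b) \<in> crossing (fr a1 b1)" by auto
    have swap: "(d, c) \<in> crossing z" if "(c, d) \<in> crossing z" for c d z
      using that sym unfolding crossing_def by (auto simp: mult.commute)
    have no: False if "(c, d) \<in> crossing (fr a0 b0)" "(c, d) \<in> crossing (fr a1 b1)" "c < d" for c d
    proof -
      have cd: "(c, d) \<in> L" "c < fr a0 b0" "fr a1 b1 < d"
        using that by (auto simp: crossing_def mult_less_0_iff)
      have "(c, d) \<in> X" using that(1) a0L cd(1) unfolding X_def Li[symmetric] crossing_def by blast
      from max[OF this] have "d - c \<le> v - u" using that(3) uv(2) by simp
      moreover have "\<not> u < c" using unlinked[OF L cd(1)] cd v by auto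
      ultimately show False using cd v by simp
    qed
    have "a \<noteq> b" using ab(1) distinct by (auto simp: crossing_def)
    then show False using no[of a b] no[of b a] ab swap by fastforce
  qed
  from corner_step[OF F this] show ?thesis using w min We by simp
qed

text \<open>By the Markoff equation the half-turn over \<open>y\<^sub>0\<close> exchanges the end points of the axis.\<close>

lemma core_data:
  obtains p0 q0 p1 q1 u v where "q0 > 0" "q0 dvd p0^2 + 1" "q1 > 0" "q1 dvd p1^2 + 1"
    "(u, v) \<in> L" "u < v" "u + v = 2 * fr p1 q1 - 3" "u * v = fr p1 q1 * (fr p1 q1 - 3) + 1 / (of_int q1)\<^sup>2"
    "half_turn p0 q0 u = v" "half_turn p0 q0 v = u"
proof -
  obtain p0 q0 p1 q1 p2 q2 u v where f: "frame p0 q0 p1 q1 p2 q2"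
    and uv: "(u, v) \<in> L" "u < v" "u + v = 2 * fr p1 q1 - 3" "u * v = fr p1 q1 * (fr p1 q1 - 3) + 1 / (of_int q1)\<^sup>2"
    using core unfolding has_core_def by blast
  note pos = frame_pos[OF f]
  define a where "a = fr p1 q1 - fr p0 q0"
  have a: "a = of_int q2 / (of_int q0 * of_int q1)" using frame_gap[OF f] by (simp add: a_def)
  have "real_of_int (q0\<^sup>2 + q1\<^sup>2 + q2\<^sup>2) = of_int (3 * q0 * q1 * q2)" using frame_markoff[OF f] by simp
  then have m: "(real_of_int q2)\<^sup>2 - 3 * of_int q0 * of_int q1 * of_int q2 + (of_int q0)\<^sup>2 = - (of_int q1)\<^sup>2" by simp
  have "(u - y) * (v - y) = u * v - (u + v) * y + y\<^sup>2" for y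
    by (simp add: algebra_simps power2_eq_square)
  then have "(u - fr p0 q0) * (v - fr p0 q0) = u * v - (u + v) * fr p0 q0 + (fr p0 q0)\<^sup>2" .
  also have "\<dots> = a\<^sup>2 - 3 * a + 1 / (of_int q1)\<^sup>2"
  proof -
    have "y * (y - 3) + c - (2 * y - 3) * x + x\<^sup>2 = (y - x)\<^sup>2 - 3 * (y - x) + c" for x y c :: real
      by (simp add: algebra_simps power2_eq_square)
    then show ?thesis unfolding uv a_def .
  qed
  also have "\<dots> = ((real_of_int q2)\<^sup>2 - 3 * of_int q0 * of_int q1 * of_int q2 + (of_int q0)\<^sup>2) / ((of_int q0)\<^sup>2 * (of_int q1)\<^sup>2)"
    unfolding a using pos by (simp add: field_simps power2_eq_square)
  also have "\<dots> = - 1 / (of_int q0)\<^sup>2" unfolding m using pos by simp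
  finally have prod: "(u - fr p0 q0) * (v - fr p0 q0) = - 1 / (of_int q0)\<^sup>2" .
  have ht: "half_turn p0 q0 w = z" if "(w - fr p0 q0) * (z - fr p0 q0) = - 1 / (of_int q0)\<^sup>2" for w z
  proof -
    have "w - fr p0 q0 \<noteq> 0" using that pos by auto
    then have "z - fr p0 q0 = - 1 / ((of_int q0)\<^sup>2 * (w - fr p0 q0))" using that pos by (simp add: field_simps)
    then show ?thesis by (simp add: half_turn_def)
  qed
  show ?thesis
    by (rule that[OF _ _ _ _ uv ht[OF prod] ht]) (use pos frame_dvd[OF f] prod in \<open>auto simp: mult.commute\<close>)
qed

end

section \<open>Geodesics of the hyperbolic plane\<close>

lemma cosh_hdist:
  assumes "z \<in> uhp" "w \<in> uhp"
  shows "cosh (hdist z w) = 1 + (cmod (z - w))\<^sup>2 / (2 * Im z * Im w)"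
  unfolding hdist_def using assms by (intro cosh_arcosh_real) (simp add: uhp_def)

definition rmoeb :: "real \<Rightarrow> real \<Rightarrow> real \<Rightarrow> real \<Rightarrow> complex \<Rightarrow> complex" where
  "rmoeb a b c d = moebius (of_real a) (of_real b) (of_real c) (of_real d)"

lemma rmoeb_uhp:
  assumes "a * d - b * c > 0" "z \<in> uhp"
  shows "rmoeb a b c d z \<in> uhp" "of_real c * z + of_real d \<noteq> 0"
proof -
  have "c \<noteq> 0 \<or> d \<noteq> 0" using assms(1) by auto
  then show nz: "of_real c * z + of_real d \<noteq> 0" using denom_uhp[of z c d] assms(2) by (simp add: uhp_def)
  show "rmoeb a b c d z \<in> uhp"
    using assms nz by (simp add: uhp_def rmoeb_def Im_moebius)
qed

lemma hdist_rmoeb: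
  assumes det: "a * d - b * c > 0" and z: "z \<in> uhp" and w: "w \<in> uhp"
  shows "hdist (rmoeb a b c d z) (rmoeb a b c d w) = hdist z w"
proof -
  define D where "D = a * d - b * c"
  define P where "P = of_real c * z + of_real d"
  define Q where "Q = of_real c * w + of_real d"
  have nz: "P \<noteq> 0" "Q \<noteq> 0" using rmoeb_uhp(2)[OF det] z w by (auto simp: P_def Q_def)
  have D: "D > 0" using det by (simp add: D_def)
  have diff: "rmoeb a b c d z - rmoeb a b c d w = of_real D * (z - w) / (P * Q)"
  proof -
    have "rmoeb a b c d z - rmoeb a b c d w = ((of_real a * z + of_real b) * Q - (of_real a * w + of_real b) * P) / (P * Q)"
      unfolding rmoeb_def moebius_def P_def[symmetric] Q_def[symmetric] using nz by (simp add: diff_frac_eq)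
    also have "(of_real a * z + of_real b) * Q - (of_real a * w + of_real b) * P = of_real D * (z - w)"
      by (simp add: P_def Q_def D_def algebra_simps)
    finally show ?thesis .
  qed
  have I: "Im (rmoeb a b c d z) = D * Im z / (cmod P)\<^sup>2" "Im (rmoeb a b c d w) = D * Im w / (cmod Q)\<^sup>2"
    by (simp_all add: rmoeb_def Im_moebius D_def P_def Q_def)
  have "(cmod (rmoeb a b c d z - rmoeb a b c d w))\<^sup>2 / (2 * Im (rmoeb a b c d z) * Im (rmoeb a b c d w))
     = (cmod (z - w))\<^sup>2 / (2 * Im z * Im w)"
    unfolding diff I using nz D by (simp add: norm_mult norm_divide power_mult_distrib power_divide power2_eq_square)
  then show ?thesis by (simp add: hdist_def)
qed

lemma hgeodesic_rmoeb:
  assumes "a * d - b * c > 0" "hgeodesic_on I c'"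
  shows "hgeodesic_on I (\<lambda>t. rmoeb a b c d (c' t))"
proof -
  have "c' t \<in> uhp" if "t \<in> I" for t using assms(2) that by (auto simp: hgeodesic_on_def)
  then show ?thesis
    using assms rmoeb_uhp(1)[OF assms(1)] hdist_rmoeb[OF assms(1)] by (auto simp: hgeodesic_on_def)
qed

lemma pslz_rmoeb: "z \<in> uhp \<Longrightarrow> pslz a b c d z = rmoeb (of_int a) (of_int b) (of_int c) (of_int d) z"
  by (simp add: pslz_def rmoeb_def)

lemma det_real: "a * d - b * c = (1::int) \<Longrightarrow> real_of_int a * of_int d - of_int b * of_int c = 1"
  by (metis of_int_1 of_int_diff of_int_mult)

lemma hgeodesic_pslz:
  assumes "a * d - b * c = 1" "hgeodesic_on I c'"
  shows "hgeodesic_on I (\<lambda>t. pslz a b c d (c' t))"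
proof -
  have "real_of_int a * of_int d - of_int b * of_int c > 0" using det_real[OF assms(1)] by simp
  from hgeodesic_rmoeb[OF this assms(2)] have "hgeodesic_on I (\<lambda>t. rmoeb (of_int a) (of_int b) (of_int c) (of_int d) (c' t))" .
  moreover have "c' t \<in> uhp" if "t \<in> I" for t using assms(2) that by (auto simp: hgeodesic_on_def)
  ultimately show ?thesis by (auto simp: hgeodesic_on_def pslz_rmoeb)
qed

text \<open>The unit-speed geodesic from \<open>u\<close> to \<open>v\<close>, as image of the imaginary axis under a real
  fractional linear map. It lies in the upper half-plane if \<open>k * (v - u) > 0\<close>; the value of \<open>k\<close>
  fixes the starting point.\<close>

definition semicircle :: "real \<Rightarrow> real \<Rightarrow> real \<Rightarrow> real \<Rightarrow> complex" where
  "semicircle u v k t = (of_real u + of_real v * (\<i> * of_real k * exp (of_real t))) / (1 + \<i> * of_real k * exp (of_real t))"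

text \<open>For \<open>s = \<plusminus>1\<close> this is a unit-speed vertical line, upwards or downwards.\<close>

definition vertical :: "real \<Rightarrow> real \<Rightarrow> real \<Rightarrow> real \<Rightarrow> complex" where
  "vertical x k s t = of_real x + \<i> * of_real (k * exp (s * t))"

definition geodesic_form :: "(real \<Rightarrow> complex) \<Rightarrow> bool" where
  "geodesic_form F \<longleftrightarrow> (\<exists>x k s. k > 0 \<and> (s = 1 \<or> s = - 1) \<and> F = vertical x k s) \<or>
     (\<exists>u v k. k * (v - u) > 0 \<and> F = semicircle u v k)"

lemma arc_denom: "1 + \<i> * of_real x \<noteq> 0"
  by (auto simp: complex_eq_iff)

lemma semicircle_Complex:
  "semicircle u v k t = Complex ((u + v * (k * exp t)\<^sup>2) / (1 + (k * exp t)\<^sup>2)) ((k * exp t) * (v - u) / (1 + (k * exp t)\<^sup>2))"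
proof -
  define x where "x = k * exp t"
  have p: "1 + x\<^sup>2 \<noteq> 0" by (metis add_pos_nonneg less_irrefl zero_le_power2 zero_less_one)
  have "semicircle u v k t = (of_real u + of_real v * (\<i> * of_real x)) / (1 + \<i> * of_real x)"
    by (simp add: semicircle_def x_def exp_of_real mult.assoc)
  also have "\<dots> = Complex ((u + v * x\<^sup>2) / (1 + x\<^sup>2)) (x * (v - u) / (1 + x\<^sup>2))"
  proof -
    have "Complex ((u + v * x\<^sup>2) / (1 + x\<^sup>2)) (x * (v - u) / (1 + x\<^sup>2)) * (1 + \<i> * of_real x) = of_real u + of_real v * (\<i> * of_real x)"
    proof -
      define d where "d = 1 + x\<^sup>2"
      have d: "d \<noteq> 0" using p by (simp add: d_def)
      have "(u + v * x\<^sup>2) / d - x * (v - u) / d * x = (u + v * x\<^sup>2 - x * (v - u) * x) / d"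
        by (simp add: diff_divide_distrib)
      also have "u + v * x\<^sup>2 - x * (v - u) * x = u * d" by (simp add: d_def power2_eq_square algebra_simps)
      finally have 1: "(u + v * x\<^sup>2) / d - x * (v - u) / d * x = u" using d by simp
      have "M / d + N / d * x = (M + N * x) / d" for M N :: real by (simp add: add_divide_distrib)
      then have "x * (v - u) / d + (u + v * x\<^sup>2) / d * x = (x * (v - u) + (u + v * x\<^sup>2) * x) / d" .
      also have "x * (v - u) + (u + v * x\<^sup>2) * x = v * x * d" by (simp add: d_def power2_eq_square algebra_simps)
      finally have 2: "x * (v - u) / d + (u + v * x\<^sup>2) / d * x = v * x" using d by simp
      show ?thesis unfolding d_def[symmetric] using 1 2 by (simp add: complex_eq_iff)
    qed
    then show ?thesis using arc_denom[of x] by (simp add: divide_eq_eq)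
  qed
  finally show ?thesis by (simp add: x_def)
qed

lemma semicircle_swap:
  assumes "k \<noteq> 0"
  shows "semicircle v u k t = semicircle u v (- 1 / k) (- t)"
proof -
  have e: "exp t * exp (- t) = (1::real)" by (simp add: exp_minus)
  define x where "x = k * exp t"
  have x: "x \<noteq> 0" using assms by (simp add: x_def)
  have x': "(- 1 / k) * exp (- t) = - (1 / x)" using assms by (simp add: x_def exp_minus field_simps)
  have p: "1 + x\<^sup>2 \<noteq> 0" by (metis add_pos_nonneg less_irrefl zero_le_power2 zero_less_one)
  have 1: "(u + v * (1 / x)\<^sup>2) / (1 + (1 / x)\<^sup>2) = (v + u * x\<^sup>2) / (1 + x\<^sup>2)"
  proof -
    have "(u + v * (1 / x)\<^sup>2) = (v + u * x\<^sup>2) / x\<^sup>2" "1 + (1 / x)\<^sup>2 = (1 + x\<^sup>2) / x\<^sup>2"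
      using x by (simp_all add: field_simps)
    then show ?thesis using x by simp
  qed
  have 2: "- (1 / x) * (v - u) / (1 + (1 / x)\<^sup>2) = x * (u - v) / (1 + x\<^sup>2)"
  proof -
    have "1 + (1 / x)\<^sup>2 = (1 + x\<^sup>2) / x\<^sup>2"
      using x by (simp_all add: field_simps)
    then have "- (1 / x) * (v - u) / (1 + (1 / x)\<^sup>2) = - (1 / x) * (v - u) * x\<^sup>2 / (1 + x\<^sup>2)" by simp
    also have "- (1 / x) * (v - u) * x\<^sup>2 = (1 / x * x\<^sup>2) * (u - v)"
      by (simp only: minus_diff_eq[of u v, symmetric] minus_mult_left[symmetric] minus_mult_right[symmetric] minus_minus mult.commute mult.left_commute)
    also have "1 / x * x\<^sup>2 = x" using x by (simp add: power2_eq_square)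
    finally show ?thesis .
  qed
  show ?thesis unfolding semicircle_Complex x' x_def[symmetric] power2_minus 1 2 ..
qed

lemma semicircle_uhp: "k * (v - u) > 0 \<Longrightarrow> semicircle u v k t \<in> uhp"
proof -
  assume "k * (v - u) > 0"
  from mult_pos_pos[OF exp_gt_zero[of t] this] have "exp t * (k * (v - u)) > 0" .
  then have "(k * exp t) * (v - u) > 0" by (simp add: ac_simps)
  moreover have "1 + (k * exp t)\<^sup>2 > 0" by (metis add_pos_nonneg zero_le_power2 zero_less_one)
  ultimately show ?thesis by (simp add: semicircle_Complex uhp_def)
qed

lemma semicircle_circle: "(Re (semicircle u v k t) - u) * (v - Re (semicircle u v k t)) = (Im (semicircle u v k t))\<^sup>2"
proof -
  define x where "x = k * exp t"
  have p: "1 + x\<^sup>2 \<noteq> 0" by (metis add_pos_nonneg less_irrefl zero_le_power2 zero_less_one)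
  have "(u + v * x\<^sup>2) / (1 + x\<^sup>2) - u = (v - u) * x\<^sup>2 / (1 + x\<^sup>2)" "v - (u + v * x\<^sup>2) / (1 + x\<^sup>2) = (v - u) / (1 + x\<^sup>2)"
    using p by (simp_all add: field_simps)
  then show ?thesis unfolding semicircle_Complex x_def[symmetric]
    by (simp add: power2_eq_square)
qed

lemma semicircle_onto:
  assumes "k * (v - u) > 0" "Im z > 0" "(Re z - u) * (v - Re z) = (Im z)\<^sup>2"
  shows "\<exists>t. semicircle u v k t = z"
proof -
  have nz: "v - Re z \<noteq> 0" "Re z - u \<noteq> 0" using assms(2,3) by auto
  define x where "x = Im z / (v - Re z)"
  have x2: "x\<^sup>2 = (Re z - u) / (v - Re z)"
    unfolding x_def power_divide assms(3)[symmetric] using nz by (simp add: power2_eq_square)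
  have p: "1 + x\<^sup>2 = (v - u) / (v - Re z)" unfolding x2 using nz by (simp add: field_simps)
  have p0: "1 + x\<^sup>2 > 0" by (metis add_pos_nonneg zero_le_power2 zero_less_one)
  then have same: "(v - u) * (v - Re z) > 0" unfolding p by (simp add: zero_less_divide_iff zero_less_mult_iff)
  have uv: "v - u \<noteq> 0" using assms(1) by auto
  have "x / k > 0"
    using assms(1,2) same unfolding x_def by (auto simp: zero_less_divide_iff zero_less_mult_iff mult_less_0_iff)
  define t where "t = ln (x / k)"
  have kx: "k * exp t = x" using \<open>x / k > 0\<close> assms(1) by (auto simp: t_def)
  have "(u + v * x\<^sup>2) / (1 + x\<^sup>2) = Re z"
  proof -
    have "u + v * x\<^sup>2 = Re z * ((v - u) / (v - Re z))"
      unfolding x2 using nz by (simp add: field_simps)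
    then show ?thesis unfolding p using nz uv by simp
  qed
  moreover have "x * (v - u) / (1 + x\<^sup>2) = Im z"
    unfolding p using nz uv by (simp add: x_def)
  ultimately have "semicircle u v k t = z" unfolding semicircle_Complex kx by (simp add: complex_eq_iff)
  then show ?thesis by blast
qed

text \<open>The distances of \<open>c t\<close> to two points of the axis give two equations, whose difference determines the
  imaginary part; then the real part vanishes.\<close>

lemma imaginary_axis_determined:
  assumes ab: "a \<noteq> b" and A: "A > 0" and B: "B > 0"
    and c: "hgeodesic_on I c" "a \<in> I" "b \<in> I" "c a = \<i> * of_real A" "c b = \<i> * of_real B"
    and s: "s = ln (B / A) / (b - a)"
  shows "s = 1 \<or> s = - 1" "t \<in> I \<Longrightarrow> c t = \<i> * of_real (A * exp (s * (t - a)))"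
proof -
  have uA: "\<i> * of_real A \<in> uhp" "\<i> * of_real B \<in> uhp" using A B by (auto simp: uhp_def)
  have dist: "hdist (c x) (c y) = \<bar>x - y\<bar>" if "x \<in> I" "y \<in> I" for x y
    using c(1) that by (auto simp: hgeodesic_on_def)
  have BA: "exp (s * (b - a)) = B / A" using s ab A B by simp
  define \<sigma> where "\<sigma> = s * (b - a)"
  have B': "B = A * exp \<sigma>" using BA A by (simp add: \<sigma>_def)
  have c1: "cosh (x - y) = 1 + (cmod (c x - c y))\<^sup>2 / (2 * Im (c x) * Im (c y))" if "x \<in> I" "y \<in> I" for x y
  proof -
    have "c x \<in> uhp" "c y \<in> uhp" using c(1) that by (auto simp: hgeodesic_on_def)
    from cosh_hdist[OF this] show ?thesis using dist[OF that] by (simp add: cosh_real_abs)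
  qed
  have "cosh (a - b) = 1 + (A - B)\<^sup>2 / (2 * A * B)"
    using c1[OF c(2,3)] unfolding c(4,5) by (simp add: norm_mult flip: right_diff_distrib of_real_diff)
  also have "\<dots> = cosh \<sigma>"
    unfolding B' cosh_def using A by (simp add: field_simps power2_eq_square exp_minus)
  finally have "\<bar>a - b\<bar> = \<bar>\<sigma>\<bar>" by (metis cosh_real_abs cosh_real_eq_iff abs_ge_zero abs_abs)
  then have "\<bar>s\<bar> * \<bar>b - a\<bar> = 1 * \<bar>b - a\<bar>" unfolding \<sigma>_def abs_mult by (simp add: abs_minus_commute)
  then have "\<bar>s\<bar> = 1" using ab by simp
  then show s1: "s = 1 \<or> s = - 1" by linarith
  assume t: "t \<in> I"
  define z where "z = c t"
  have zu: "Im z > 0" using c(1) t by (auto simp: hgeodesic_on_def z_def uhp_def)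
  define \<tau> where "\<tau> = s * (t - a)"
  have cosh1: "cosh (t - a) = cosh \<tau>" unfolding \<tau>_def using s1 by (metis cosh_minus mult_1 mult_minus1)
  have cosh2: "cosh (t - b) = cosh (\<tau> - \<sigma>)"
  proof -
    have "\<tau> - \<sigma> = s * (t - b)" by (simp add: \<tau>_def \<sigma>_def algebra_simps)
    then show ?thesis using s1 by (metis cosh_minus mult_1 mult_minus1)
  qed
  have norm: "(cmod (z - \<i> * of_real y))\<^sup>2 = (Re z)\<^sup>2 + (Im z - y)\<^sup>2" for y
    by (simp add: cmod_power2)
  have 1: "(Re z)\<^sup>2 + (Im z)\<^sup>2 + A\<^sup>2 = 2 * Im z * A * cosh \<tau>"
    using c1[OF t c(2)] A zu unfolding c(4) z_def[symmetric] cosh1 norm by (simp add: field_simps power2_eq_square)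
  have 2: "(Re z)\<^sup>2 + (Im z)\<^sup>2 + B\<^sup>2 = 2 * Im z * B * cosh (\<tau> - \<sigma>)"
    using c1[OF t c(3)] B zu unfolding c(5) z_def[symmetric] cosh2 norm by (simp add: field_simps power2_eq_square)
  have ex: "exp \<sigma> * cosh (\<tau> - \<sigma>) - cosh \<tau> = exp (- \<tau>) * ((exp \<sigma>)\<^sup>2 - 1) / 2"
    by (simp add: cosh_def exp_diff exp_minus field_simps power2_eq_square)
  have "A\<^sup>2 * ((exp \<sigma>)\<^sup>2 - 1) = B\<^sup>2 - A\<^sup>2" by (simp add: B' power_mult_distrib algebra_simps)
  also have "\<dots> = 2 * Im z * A * (exp \<sigma> * cosh (\<tau> - \<sigma>) - cosh \<tau>)" using 1 2 by (simp add: B' algebra_simps)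
  also have "\<dots> = Im z * A * exp (- \<tau>) * ((exp \<sigma>)\<^sup>2 - 1)" unfolding ex by simp
  finally have "A\<^sup>2 * ((exp \<sigma>)\<^sup>2 - 1) = Im z * A * exp (- \<tau>) * ((exp \<sigma>)\<^sup>2 - 1)" .
  moreover have "(exp \<sigma>)\<^sup>2 - 1 \<noteq> 0"
  proof -
    have "\<sigma> \<noteq> 0" using s1 ab by (auto simp: \<sigma>_def)
    moreover have "(exp \<sigma>)\<^sup>2 = exp (2 * \<sigma>)" by (simp add: power2_eq_square flip: exp_add)
    ultimately show ?thesis by simp
  qed
  ultimately have "A\<^sup>2 = Im z * A * exp (- \<tau>)" by simp
  then have "A = Im z * exp (- \<tau>)" using A by (simp add: power2_eq_square)
  then have im: "Im z = A * exp \<tau>" by (simp add: exp_minus field_simps)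
  have "(Re z)\<^sup>2 = 2 * Im z * A * cosh \<tau> - (Im z)\<^sup>2 - A\<^sup>2" using 1 by simp
  also have "\<dots> = 0" unfolding im cosh_def by (simp add: field_simps power2_eq_square exp_minus)
  finally have "Re z = 0" by simp
  then show "c t = \<i> * of_real (A * exp (s * (t - a)))"
    using im by (simp add: complex_eq_iff z_def \<tau>_def)
qed

lemma vertical_uhp: "k > 0 \<Longrightarrow> vertical x k s t \<in> uhp"
  by (simp add: vertical_def uhp_def)

text \<open>Two points of the plane can be moved to the imaginary axis by a real fractional linear map. The
  curve \<open>F\<close> is chosen before \<open>I\<close> and \<open>c\<close>, so the lemma contains the uniqueness of geodesics as well.\<close>

lemma hgeodesic_determined:
  assumes ab: "a \<noteq> b" and p: "p \<in> uhp" and q: "q \<in> uhp"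
  shows "\<exists>F. \<forall>I c. hgeodesic_on I c \<and> a \<in> I \<and> b \<in> I \<and> c a = p \<and> c b = q \<longrightarrow>
    geodesic_form F \<and> (\<forall>t\<in>I. c t = F t)"
proof (cases "p = q")
  case True
  have "\<not> (hgeodesic_on I c \<and> a \<in> I \<and> b \<in> I \<and> c a = p \<and> c b = q)" for I c
  proof
    assume *: "hgeodesic_on I c \<and> a \<in> I \<and> b \<in> I \<and> c a = p \<and> c b = q"
    then have "hdist p q = \<bar>a - b\<bar>" by (auto simp: hgeodesic_on_def)
    moreover have "hdist p q = 0" using True by (simp add: hdist_def)
    ultimately show False using ab by simp
  qed
  then show ?thesis by blast
next
  case pq: False
  show ?thesis
  proof (cases "Re p = Re q")
    case True
    define x where "x = Re p"
    define A B where "A = Im p" and "B = Im q"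
    have AB: "A > 0" "B > 0" using p q by (auto simp: A_def B_def uhp_def)
    define s where "s = ln (B / A) / (b - a)"
    define F where "F = vertical x (A * exp (- s * a)) s"
    have "geodesic_form F \<and> (\<forall>t\<in>I. c t = F t)"
      if c: "hgeodesic_on I c" "a \<in> I" "b \<in> I" "c a = p" "c b = q" for I c
    proof -
      have sh: "rmoeb 1 (- x) 0 1 z = z - of_real x" for z by (simp add: rmoeb_def moebius_def)
      have "hgeodesic_on I (\<lambda>t. c t - of_real x)"
        using hgeodesic_rmoeb[of 1 1 "- x" 0 I c] c(1) by (simp add: sh)
      note D = imaginary_axis_determined[OF ab AB this c(2,3) _ _ s_def]
      have e: "c a - of_real x = \<i> * of_real A" "c b - of_real x = \<i> * of_real B"
        using True by (auto simp: c(4,5) complex_eq_iff x_def A_def B_def)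
      have "geodesic_form F"
        unfolding geodesic_form_def F_def using D(1)[OF e] AB by (intro disjI1 exI[of _ x] exI[of _ "A * exp (- s * a)"] exI[of _ s]) auto
      moreover have "c t = F t" if "t \<in> I" for t
      proof -
        have "A * exp (s * (t - a)) = A * exp (- s * a) * exp (s * t)" by (simp add: algebra_simps flip: exp_add)
        moreover have "c t = of_real x + \<i> * of_real (A * exp (s * (t - a)))"
          using D(2)[OF e that] by (simp only: diff_eq_eq add.commute)
        ultimately show ?thesis by (simp only: F_def vertical_def)
      qed
      ultimately show ?thesis by blast
    qed
    then show ?thesis by blast
  next
    case False
    define m where "m = ((cmod q)\<^sup>2 - (cmod p)\<^sup>2) / (2 * (Re q - Re p))"
    define \<rho> where "\<rho> = sqrt ((Re p - m)\<^sup>2 + (Im p)\<^sup>2)"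
    define u v where "u = m - \<rho>" and "v = m + \<rho>"
    have Im: "Im p > 0" "Im q > 0" using p q by (auto simp: uhp_def)
    have "(Re p - m)\<^sup>2 + (Im p)\<^sup>2 > 0" using Im by (simp add: add_nonneg_pos)
    then have \<rho>: "\<rho> > 0" "\<rho>\<^sup>2 = (Re p - m)\<^sup>2 + (Im p)\<^sup>2" by (auto simp: \<rho>_def)
    have m: "2 * m * (Re q - Re p) = (cmod q)\<^sup>2 - (cmod p)\<^sup>2"
    proof -
      have "2 * (N / (2 * D)) * D = N" if "D \<noteq> 0" for N D :: real using that by simp
      moreover have "Re q - Re p \<noteq> 0" using False by simp
      ultimately show ?thesis unfolding m_def by blast
    qed
    have \<rho>q: "\<rho>\<^sup>2 = (Re q - m)\<^sup>2 + (Im q)\<^sup>2"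
      unfolding \<rho>(2) using m unfolding cmod_power2 by (simp add: power2_eq_square algebra_simps)
    have det: "1 * v - (- u) * (- 1) > 0" using \<rho> by (simp add: u_def v_def)
    let ?\<phi> = "rmoeb 1 (- u) (- 1) v"
    have circ: "Re (?\<phi> z) = 0" if "\<rho>\<^sup>2 = (Re z - m)\<^sup>2 + (Im z)\<^sup>2" for z
    proof -
      have "Re ((z - of_real u) / (of_real v - z)) = Re ((z - of_real u) * cnj (of_real v - z)) / (cmod (of_real v - z))\<^sup>2"
        by (subst complex_div_cnj) (simp add: Re_divide_of_real)
      also have "Re ((z - of_real u) * cnj (of_real v - z)) = (Re z - u) * (v - Re z) - (Im z)\<^sup>2"
        by (simp add: power2_eq_square)
      also have "\<dots> = 0" using that by (simp add: u_def v_def power2_eq_square algebra_simps)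
      finally show ?thesis by (simp add: rmoeb_def moebius_def)
    qed
    define A B where "A = Im (?\<phi> p)" and "B = Im (?\<phi> q)"
    have AB: "A > 0" "B > 0" using rmoeb_uhp(1)[OF det p] rmoeb_uhp(1)[OF det q] by (auto simp: A_def B_def uhp_def)
    have e: "?\<phi> p = \<i> * of_real A" "?\<phi> q = \<i> * of_real B"
      using circ[OF \<rho>(2)] circ[OF \<rho>q] by (auto simp: complex_eq_iff A_def B_def)
    define s where "s = ln (B / A) / (b - a)"
    define F where "F = (if s = 1 then semicircle u v (A * exp (- a)) else semicircle v u (- 1 / (A * exp a)))"
    have "geodesic_form F \<and> (\<forall>t\<in>I. c t = F t)"
      if c: "hgeodesic_on I c" "a \<in> I" "b \<in> I" "c a = p" "c b = q" for I c
    proof -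
      note D = imaginary_axis_determined[OF ab AB hgeodesic_rmoeb[OF det c(1)] c(2,3) _ _ s_def]
      have e': "?\<phi> (c a) = \<i> * of_real A" "?\<phi> (c b) = \<i> * of_real B" using e c by auto
      have vu: "v - u > 0" using \<rho> by (simp add: u_def v_def)
      have form: "geodesic_form F"
      proof (cases "s = 1")
        case True
        have "A * exp (- a) * (v - u) > 0" using AB vu by simp
        then show ?thesis unfolding geodesic_form_def F_def if_P[OF True] by blast
      next
        case False
        have "- 1 / (A * exp a) * (u - v) > 0" using AB vu by (simp add: zero_less_mult_iff divide_less_0_iff)
        then show ?thesis unfolding geodesic_form_def F_def if_not_P[OF False] by blast
      qed
      moreover have "c t = F t" if t: "t \<in> I" for t
      proof -
        have cu: "c t \<in> uhp" using c(1) t by (auto simp: hgeodesic_on_def)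
        define x where "x = A * exp (s * (t - a))"
        have w: "?\<phi> (c t) = \<i> * of_real x" unfolding x_def by (rule D(2)[OF e' t])
        have "moebius (of_real v) (- (- of_real u)) (- (- 1)) 1 (?\<phi> (c t)) = c t"
          unfolding rmoeb_def
          using moebius_inverse[of 1 "of_real v" "- of_real u" "- 1" "c t"] rmoeb_uhp(2)[OF det cu] vu by simp
        then have ct: "c t = (of_real u + of_real v * (\<i> * of_real x)) / (1 + \<i> * of_real x)"
          unfolding w by (simp add: moebius_def add.commute)
        show ?thesis
        proof (cases "s = 1")
          case True
          have "x = A * exp (- a) * exp t" using True by (simp add: x_def flip: exp_add)
          then show ?thesis unfolding ct F_def using True by (simp add: semicircle_def exp_of_real mult.assoc)
        next
          case False
          then have s: "s = - 1" using D(1)[OF e'] by simp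
          have x: "x = A * exp a * exp (- t)" by (simp add: x_def s flip: exp_add)
          have "F t = semicircle u v (A * exp a) (- t)"
            unfolding F_def using False AB semicircle_swap[of "- 1 / (A * exp a)" v u t] by simp
          also have "\<dots> = c t" unfolding ct x by (simp add: semicircle_def exp_of_real mult.assoc flip: of_real_minus)
          finally show ?thesis by simp
        qed
      qed
      ultimately show ?thesis by blast
    qed
    then show ?thesis by blast
  qed
qed

lemma hgeodesic_form:
  assumes "hgeodesic_on I c" "a \<in> I" "b \<in> I" "a \<noteq> b"
  obtains F where "geodesic_form F" "\<And>t. t \<in> I \<Longrightarrow> c t = F t"
proof -
  have "c a \<in> uhp" "c b \<in> uhp" using assms by (auto simp: hgeodesic_on_def)
  from hgeodesic_determined[OF assms(4) this] obtain F where
    F: "\<forall>I h. hgeodesic_on I h \<and> a \<in> I \<and> b \<in> I \<and> h a = c a \<and> h b = c b \<longrightarrow> geodesic_form F \<and> (\<forall>t\<in>I. h t = F t)"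
    by (rule exE)
  have "geodesic_form F \<and> (\<forall>t\<in>I. c t = F t)" by (rule F[rule_format]) (use assms in simp)
  then show ?thesis using that[of F] by simp
qed

lemma hgeodesic_unique:
  assumes c: "hgeodesic_on I c" and c': "hgeodesic_on I c'" and ab: "a \<in> I" "b \<in> I" "a \<noteq> b"
    and eq: "c a = c' a" "c b = c' b" and t: "t \<in> I"
  shows "c t = c' t"
proof -
  have "c a \<in> uhp" "c b \<in> uhp" using c ab by (auto simp: hgeodesic_on_def)
  from hgeodesic_determined[OF ab(3) this] obtain F where
    F: "\<forall>I h. hgeodesic_on I h \<and> a \<in> I \<and> b \<in> I \<and> h a = c a \<and> h b = c b \<longrightarrow> geodesic_form F \<and> (\<forall>t\<in>I. h t = F t)"
    by (rule exE)
  have "geodesic_form F \<and> (\<forall>t\<in>I. c t = F t)" by (rule F[rule_format]) (use c ab in simp)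
  moreover have "geodesic_form F \<and> (\<forall>t\<in>I. c' t = F t)" by (rule F[rule_format]) (use c' ab eq in simp)
  ultimately show ?thesis using t by simp
qed

lemma hgeodesic_vertical:
  assumes "k > 0"
  shows "hgeodesic_on I (vertical x k 1)"
proof -
  have "hdist (vertical x k 1 s) (vertical x k 1 t) = \<bar>s - t\<bar>" for s t
  proof -
    have "vertical x k 1 s - vertical x k 1 t = \<i> * of_real (k * exp s - k * exp t)" by (simp add: vertical_def algebra_simps)
    then have "(cmod (vertical x k 1 s - vertical x k 1 t))\<^sup>2 = (k * exp s - k * exp t)\<^sup>2" by (simp only: norm_mult norm_ii norm_of_real mult_1 power2_abs)
    moreover have "1 + (k * a - k * b)\<^sup>2 / (2 * (k * a) * (k * b)) = (a / b + b / a) / 2" if "a > 0" "b > 0" for a b :: real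
      using that assms by (simp add: field_simps power2_eq_square)
    from this[OF exp_gt_zero exp_gt_zero] have "1 + (k * exp s - k * exp t)\<^sup>2 / (2 * (k * exp s) * (k * exp t)) = cosh (s - t)"
      by (simp add: cosh_def exp_diff exp_minus)
    moreover have "Im (vertical x k 1 s) = k * exp s" "Im (vertical x k 1 t) = k * exp t" by (simp_all add: vertical_def)
    ultimately have "1 + (cmod (vertical x k 1 s - vertical x k 1 t))\<^sup>2 / (2 * Im (vertical x k 1 s) * Im (vertical x k 1 t)) = cosh (s - t)"
      by (simp only:)
    also have "\<dots> = cosh \<bar>s - t\<bar>" by (simp add: cosh_real_abs)
    finally have "hdist (vertical x k 1 s) (vertical x k 1 t) = arcosh (cosh \<bar>s - t\<bar>)" unfolding hdist_def by (rule arg_cong)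
    also have "\<dots> = \<bar>s - t\<bar>" by (rule arcosh_cosh_real) simp
    finally show ?thesis .
  qed
  then show ?thesis using vertical_uhp[OF assms] by (auto simp: hgeodesic_on_def)
qed

section \<open>Semicircles under the modular group\<close>

lemma circle_cross:
  assumes "u < u'" "u' < v" "v < (v'::real)"
  obtains z where "Im z > 0" "(Re z - u) * (v - Re z) = (Im z)\<^sup>2" "(Re z - u') * (v' - Re z) = (Im z)\<^sup>2"
proof -
  define S where "S = u' + v' - u - v"
  have S: "S > 0" using assms by (simp add: S_def)
  define x where "x = (u' * v' - u * v) / S"
  have xS: "x * S = u' * v' - u * v" using S by (simp add: x_def)
  have "(x - u) * S = (u' - u) * (v' - u)" unfolding left_diff_distrib xS by (simp add: S_def algebra_simps)
  moreover have "(u' - u) * (v' - u) > 0" using assms by simp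
  ultimately have 1: "x - u > 0" using S by (metis zero_less_mult_pos2)
  have "(v - x) * S = (v - u') * (v' - v)" unfolding left_diff_distrib xS by (simp add: S_def algebra_simps)
  moreover have "(v - u') * (v' - v) > 0" using assms by simp
  ultimately have 2: "v - x > 0" using S by (metis zero_less_mult_pos2)
  define y where "y = sqrt ((x - u) * (v - x))"
  have y: "y > 0" "y\<^sup>2 = (x - u) * (v - x)" using 1 2 by (simp_all add: y_def)
  have "(x - u') * (v' - x) = (x - u) * (v - x)"
    using xS by (simp add: S_def algebra_simps)
  then show ?thesis using that[of "Complex x y"] y by simp
qed

lemma Re_semicircle: "Re (semicircle u v k t) = v - (v - u) / (1 + (k * exp t)\<^sup>2)"
proof -
  have p: "1 + (k * exp t)\<^sup>2 \<noteq> 0" by (metis add_pos_nonneg less_irrefl zero_le_power2 zero_less_one)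
  have "(u + v * x) / (1 + x) = v - (v - u) / (1 + x)" if "1 + x \<noteq> 0" for x :: real
    using that by (simp add: field_simps)
  from this[OF p] show ?thesis by (simp add: semicircle_Complex)
qed

lemma Re_semicircle_less:
  assumes "u < v" "k \<noteq> 0" "s < t"
  shows "Re (semicircle u v k s) < Re (semicircle u v k t)"
proof -
  have "(k * exp s)\<^sup>2 < (k * exp t)\<^sup>2"
    using assms by (simp add: power_mult_distrib power_strict_mono)
  moreover have "1 + (k * exp s)\<^sup>2 > 0" by (metis add_pos_nonneg zero_le_power2 zero_less_one)
  ultimately have "(v - u) / (1 + (k * exp t)\<^sup>2) < (v - u) / (1 + (k * exp s)\<^sup>2)"
    using assms(1) by (intro divide_strict_left_mono mult_pos_pos) auto
  then show ?thesis by (simp add: Re_semicircle)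
qed

lemma Re_semicircle_neq:
  assumes "u \<noteq> v" "k \<noteq> 0" "s \<noteq> t"
  shows "Re (semicircle u v k s) \<noteq> Re (semicircle u v k t)"
proof -
  have "(k * exp s)\<^sup>2 \<noteq> (k * exp t)\<^sup>2"
    using assms by (simp add: power_mult_distrib power2_eq_iff_nonneg)
  moreover have "1 + (k * exp s)\<^sup>2 > 0" "1 + (k * exp t)\<^sup>2 > 0" by (metis add_pos_nonneg zero_le_power2 zero_less_one)+
  ultimately show ?thesis using assms(1) by (simp add: Re_semicircle frac_eq_eq)
qed

lemma semicircle_same_circle:
  assumes "u' \<noteq> v'" "k \<noteq> 0"
    and on: "\<And>t. (Re (semicircle u' v' k t) - u) * (v - Re (semicircle u' v' k t)) = (Im (semicircle u' v' k t))\<^sup>2"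
  shows "u + v = u' + v'" "u * v = u' * v'"
proof -
  let ?x = "\<lambda>t. Re (semicircle u' v' k t)"
  have eq: "(u + v - u' - v') * ?x t = u * v - u' * v'" for t
    using on[of t] semicircle_circle[of u' v' k t] by (simp add: algebra_simps)
  have "(u + v - u' - v') * (?x 0 - ?x 1) = 0" using eq[of 0] eq[of 1] by (simp add: right_diff_distrib)
  then show 1: "u + v = u' + v'" using Re_semicircle_neq[OF assms(1,2), of 0 1] by simp
  show "u * v = u' * v'" using eq[of 0] 1 by simp
qed

lemma sum_prod_eq:
  fixes u v :: real
  assumes "u + v = u' + v'" "u * v = u' * v'"
  shows "(u = u' \<and> v = v') \<or> (u = v' \<and> v = u')"
proof -
  have "(u - u') * (u - v') = u * u - u * (u' + v') + u' * v'" by (simp add: algebra_simps)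
  also have "\<dots> = 0" unfolding assms[symmetric] by (simp add: algebra_simps)
  finally show ?thesis using assms(1) by auto
qed

lemma semicircle_inj:
  assumes "u \<noteq> v" "k \<noteq> 0" "u' \<noteq> v'" "k' \<noteq> 0" and eq: "\<And>t. semicircle u v k t = semicircle u' v' k' t"
  shows "u = u' \<and> v = v'"
proof -
  have "(Re (semicircle u' v' k' t) - u) * (v - Re (semicircle u' v' k' t)) = (Im (semicircle u' v' k' t))\<^sup>2" for t
    unfolding eq[symmetric] by (rule semicircle_circle)
  note sum_prod_eq[OF semicircle_same_circle[OF assms(3,4) this]]
  moreover have False if "u = v'" "v = u'"
  proof (cases "u < v")
    case True
    then show False using Re_semicircle_less[of u v k 0 1] Re_semicircle_less[of v u k' 0 1] assms eq[of 0] eq[of 1]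
      Re_semicircle[of u v k 0] Re_semicircle[of u v k 1] Re_semicircle[of v u k' 0] Re_semicircle[of v u k' 1]
      semicircle_swap[of k' v u 0] semicircle_swap[of k' v u 1] that
        Re_semicircle_less[of u v "- 1 / k'" "- 1" 0] by simp
  next
    case False
    then have "v < u" using assms(1) by simp
    then show False using assms eq[of 0] eq[of 1] semicircle_swap[of k u v 0] semicircle_swap[of k u v 1] that
       Re_semicircle_less[of v u k' 0 1] Re_semicircle_less[of v u "- 1 / k" "- 1" 0] by simp
  qed
  ultimately show ?thesis by blast
qed

lemma pslz_semicircle:
  assumes det: "a * d - b * c = 1" and nz: "of_int c * u + of_int d \<noteq> 0" "of_int c * v + of_int d \<noteq> 0"
    and k: "k * (v - u) > 0"
  obtains k' where "k' * (rmob a b c d v - rmob a b c d u) > 0"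
    "\<And>t. pslz a b c d (semicircle u v k t) = semicircle (rmob a b c d u) (rmob a b c d v) k' t"
proof -
  define P where "P = of_int c * u + of_int d"
  define Q where "Q = of_int c * v + of_int d"
  define k' where "k' = k * Q / P"
  have PQ: "P \<noteq> 0" "Q \<noteq> 0" using nz by (auto simp: P_def Q_def)
  have "rmob a b c d v - rmob a b c d u = ((of_int a * v + of_int b) * P - (of_int a * u + of_int b) * Q) / (P * Q)"
    unfolding moebius_def P_def[symmetric] Q_def[symmetric] using PQ by (simp add: diff_frac_eq mult.commute)
  also have "(of_int a * v + of_int b) * P - (of_int a * u + of_int b) * Q = (of_int a * of_int d - of_int b * of_int c) * (v - u)"
    by (simp add: P_def Q_def algebra_simps)
  also have "\<dots> = v - u" using det_real[OF det] by simp
  finally have "k' * (rmob a b c d v - rmob a b c d u) = k * (v - u) / P\<^sup>2"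
    using PQ by (simp add: k'_def power2_eq_square)
  then have 1: "k' * (rmob a b c d v - rmob a b c d u) > 0" using k PQ by simp
  have 2: "pslz a b c d (semicircle u v k t) = semicircle (rmob a b c d u) (rmob a b c d v) k' t" for t
  proof -
    define w where "w = \<i> * of_real k * exp (of_real t)"
    have w1: "1 + w \<noteq> 0" using arc_denom[of "k * exp t"] by (simp add: w_def exp_of_real mult.assoc)
    have w2: "1 + \<i> * of_real k' * exp (of_real t) \<noteq> 0" using arc_denom[of "k' * exp t"] by (simp add: exp_of_real mult.assoc)
    have kw: "\<i> * of_real k' * exp (of_real t) = w * of_real Q / of_real P" by (simp add: w_def k'_def)
    have P: "of_int c * of_real u + of_int d = (of_real P :: complex)" "of_int c * of_real v + of_int d = (of_real Q :: complex)"
      by (simp_all add: P_def Q_def)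
    have "pslz a b c d (semicircle u v k t) = moebius (of_int a) (of_int b) (of_int c) (of_int d) ((of_real u + of_real v * w) / (1 + w))"
      using semicircle_uhp[OF k, of t] by (simp add: pslz_def semicircle_def w_def)
    also have "\<dots> = moebius (of_int a) (of_int b) (of_int c) (of_int d) (moebius (of_real v) (of_real u) 1 1 w)"
      by (simp add: moebius_def add.commute)
    also have "\<dots> = (of_int a * (of_real u + of_real v * w) + of_int b * (1 + w)) / (of_int c * (of_real u + of_real v * w) + of_int d * (1 + w))"
      using w1 by (subst moebius_comp) (simp_all add: moebius_def add.commute algebra_simps)
    also have "\<dots> = ((of_int a * of_real u + of_int b) + (of_int a * of_real v + of_int b) * w) / (of_real P + of_real Q * w)"
      unfolding P[symmetric] by (simp add: algebra_simps)
    also have "\<dots> = (of_real (rmob a b c d u) * of_real P + of_real (rmob a b c d v) * of_real Q * w) / (of_real P + of_real Q * w)"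
    proof -
      have "rmob a b c d u * P = of_int a * u + of_int b" "rmob a b c d v * Q = of_int a * v + of_int b"
        using PQ by (simp_all add: moebius_def P_def[symmetric] Q_def[symmetric])
      from this[THEN arg_cong[where f = complex_of_real]]
      have "of_real (rmob a b c d u) * of_real P = (of_int a * of_real u + of_int b :: complex)"
        "of_real (rmob a b c d v) * of_real Q = (of_int a * of_real v + of_int b :: complex)"
        by simp_all
      then show ?thesis by simp
    qed
    also have "\<dots> = ((of_real (rmob a b c d u) + of_real (rmob a b c d v) * (w * of_real Q / of_real P)) * of_real P) / ((1 + w * of_real Q / of_real P) * of_real P)"
      using PQ by (simp add: algebra_simps)
    also have "\<dots> = semicircle (rmob a b c d u) (rmob a b c d v) k' t"
      unfolding semicircle_def kw using PQ by (subst mult_divide_mult_cancel_right) auto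
    finally show ?thesis .
  qed
  show ?thesis by (rule that[OF 1 2])
qed

lemma rational_square_int:
  fixes s :: real
  assumes "s \<in> \<rat>" "s\<^sup>2 = of_int D"
  shows "\<exists>n::int. n\<^sup>2 = D"
proof -
  from Rats_abs_nat_div_natE[OF assms(1)] obtain m n :: nat where mn: "n \<noteq> 0" "\<bar>s\<bar> = real m / real n" "coprime m n"
    by blast
  have "(real m)\<^sup>2 = of_int D * (real n)\<^sup>2"
    using assms(2) mn(1,2) by (metis nonzero_eq_divide_eq of_nat_eq_0_iff power2_abs power_divide power_not_zero)
  then have "real_of_int ((int m)\<^sup>2) = real_of_int (D * (int n)\<^sup>2)" by simp
  then have e: "(int m)\<^sup>2 = D * (int n)\<^sup>2" by (simp only: of_int_eq_iff)
  then have "(int n)\<^sup>2 dvd (int m)\<^sup>2" by simp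
  moreover have "coprime ((int m)\<^sup>2) ((int n)\<^sup>2)" using mn(3) by simp
  ultimately have "(int n)\<^sup>2 = 1"
    by (metis coprime_absorb_right is_unit_power_iff zdvd1_eq abs_of_nat int_dvd_int_iff nat_dvd_1_iff_1 of_nat_1 power_one zero_neq_numeral)
  then show ?thesis using e by auto
qed

section \<open>Lifts of a simple closed geodesic\<close>

lemma exp_square_neq_one:
  assumes "x \<noteq> 0" shows "(exp x)\<^sup>2 \<noteq> (1::real)" "1 \<noteq> (exp (x::real))\<^sup>2"
proof -
  have "(exp x)\<^sup>2 = exp (2 * x)" by (simp add: power2_eq_square flip: exp_add)
  then show "(exp x)\<^sup>2 \<noteq> (1::real)" using assms by simp
  then show "1 \<noteq> (exp (x::real))\<^sup>2" by simp
qed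

locale closed_geodesic =
  fixes \<gamma> :: "real \<Rightarrow> complex set" and l :: real
  assumes lift_ex: "\<exists>c. lifts_to \<gamma> c" and l_pos: "l > 0" and period: "\<gamma> (t + l) = \<gamma> t"
    and simple: "inj_on \<gamma> {0..<l}"
begin

lemma period_nat: "\<gamma> (t + real n * l) = \<gamma> t"
proof (induction n)
  case (Suc n)
  have "\<gamma> (t + real (Suc n) * l) = \<gamma> ((t + real n * l) + l)" by (simp add: algebra_simps)
  then show ?case using period Suc by simp
qed simp

lemma period_int: "\<gamma> (t + of_int j * l) = \<gamma> t"
proof (cases "j \<ge> 0")
  case True
  then show ?thesis using period_nat[of t "nat j"] by simp
next
  case False
  then show ?thesis using period_nat[of "t + of_int j * l" "nat (- j)"] by simp
qed

lemma same_point_iff: "\<gamma> s = \<gamma> t \<longleftrightarrow> (\<exists>j::int. t = s + of_int j * l)"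
proof
  assume eq: "\<gamma> s = \<gamma> t"
  define r where "r = (\<lambda>x. x - of_int \<lfloor>x / l\<rfloor> * l)"
  have r: "r x \<in> {0..<l}" for x
  proof -
    have "of_int \<lfloor>x / l\<rfloor> * l \<le> x"
      using of_int_floor_le[of "x / l"] unfolding pos_le_divide_eq[OF l_pos] .
    moreover have "x < (of_int \<lfloor>x / l\<rfloor> + 1) * l"
      using floor_correct[of "x / l"] unfolding pos_divide_less_eq[OF l_pos] by simp
    ultimately show ?thesis by (simp add: r_def algebra_simps)
  qed
  have "\<gamma> (r x) = \<gamma> x" for x
    using period_int[of x "- \<lfloor>x / l\<rfloor>"] by (simp add: r_def)
  then have "r s = r t" using eq simple r by (metis inj_onD)
  then have "t = s + of_int (\<lfloor>t / l\<rfloor> - \<lfloor>s / l\<rfloor>) * l" by (simp add: r_def algebra_simps)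
  then show "\<exists>j::int. t = s + of_int j * l" by blast
next
  assume "\<exists>j::int. t = s + of_int j * l"
  then show "\<gamma> s = \<gamma> t" using period_int by force
qed

lemma lift_uhp: "lifts_to \<gamma> c \<Longrightarrow> c t \<in> uhp"
  by (auto simp: lifts_to_def hgeodesic_on_def)

lemma lift_proj: "lifts_to \<gamma> c \<Longrightarrow> torus_proj (c t) = \<gamma> t"
  by (simp add: lifts_to_def)

lemma lift_pslz: "lifts_to \<gamma> c \<Longrightarrow> gam a b c' d \<Longrightarrow> lifts_to \<gamma> (\<lambda>t. pslz a b c' d (c t))"
  using hgeodesic_pslz[OF gam_det] torus_proj_pslz lift_uhp by (auto simp: lifts_to_def)

lemma lift_shift:
  assumes "lifts_to \<gamma> c" "\<And>t. \<gamma> (t + x) = \<gamma> t"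
  shows "lifts_to \<gamma> (\<lambda>t. c (t + x))"
  using assms by (auto simp: lifts_to_def hgeodesic_on_def)

text \<open>At every time the two lifts differ by an element of \<open>\<Gamma>\<close>. This group is countable and there are uncountably many times,
  so one element serves at two different times, and two points determine a geodesic.\<close>

lemma lifts_differ_by_element:
  assumes c: "lifts_to \<gamma> c" and c': "lifts_to \<gamma> c'"
  shows "\<exists>a b p d. gam a b p d \<and> (\<forall>t. c' t = pslz a b p d (c t))"
proof -
  have "\<exists>a b p d. gam a b p d \<and> c' t = pslz a b p d (c t)" for t
  proof -
    have "torus_proj (c t) = torus_proj (c' t)" using lift_proj[OF c] lift_proj[OF c'] by simp
    then show ?thesis by (rule torus_proj_eq_iff[OF lift_uhp[OF c] lift_uhp[OF c'], THEN iffD1])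
  qed
  then have "\<forall>t. \<exists>g. gam (fst g) (fst (snd g)) (fst (snd (snd g))) (snd (snd (snd g))) \<and>
      c' t = pslz (fst g) (fst (snd g)) (fst (snd (snd g))) (snd (snd (snd g))) (c t)"
    by (metis fst_conv snd_conv)
  from choice[OF this] obtain G :: "real \<Rightarrow> int \<times> int \<times> int \<times> int" where
    G: "\<forall>t. gam (fst (G t)) (fst (snd (G t))) (fst (snd (snd (G t)))) (snd (snd (snd (G t)))) \<and>
      c' t = pslz (fst (G t)) (fst (snd (G t))) (fst (snd (snd (G t)))) (snd (snd (snd (G t)))) (c t)"
    by (rule exE)
  have "\<not> inj G"
  proof
    assume "inj G"
    then have "inj (to_nat \<circ> G)" by (intro inj_compose) auto
    then have "countable (UNIV :: real set)" by (rule countableI)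
    then show False using uncountable_UNIV_real by simp
  qed
  then obtain s t where st: "s \<noteq> t" "G s = G t" by (auto simp: inj_def)
  obtain a b p d where g: "G s = (a, b, p, d)" by (cases "G s")
  then have gam: "gam a b p d" and eq: "c' s = pslz a b p d (c s)" "c' t = pslz a b p d (c t)"
    using G[rule_format, of s] G[rule_format, of t] unfolding st(2)[symmetric] g by simp_all
  have "hgeodesic_on UNIV c'" "hgeodesic_on UNIV (\<lambda>t. pslz a b p d (c t))"
    using c' lift_pslz[OF c gam] by (auto simp: lifts_to_def)
  from hgeodesic_unique[OF this _ _ st(1)] eq have "c' x = pslz a b p d (c x)" for x by simp
  then show ?thesis using gam by blast
qed

lemma pslz_diag:
  assumes "a * d - b * c = 1" "b = 0" "c = 0" "a = d" "z \<in> uhp"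
  shows "pslz a b c d z = z"
proof -
  have "d \<noteq> 0" using assms(1,2) by auto
  then show ?thesis using assms(2-) by (simp add: pslz_def moebius_def)
qed

lemma lifts_eq:
  assumes "lifts_to \<gamma> c" "lifts_to \<gamma> c'" "c t0 = c' t0"
  shows "c = c'"
proof -
  obtain a b p d where g: "gam a b p d" "\<And>t. c' t = pslz a b p d (c t)"
    using lifts_differ_by_element[OF assms(1,2)] by blast
  have "b = 0 \<and> p = 0 \<and> a = d"
    by (rule gam_fixed_point[OF g(1) lift_uhp[OF assms(1)], of t0]) (use g(2)[of t0] assms(3) in simp)
  then have "c' t = c t" for t
    using g(2)[of t] pslz_diag[OF gam_det[OF g(1)]] lift_uhp[OF assms(1)] by simp
  then show ?thesis by (intro ext) simp
qed

lemma lift_translation: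
  assumes c: "lifts_to \<gamma> c"
  obtains a b p d where "gam a b p d" "\<And>t. c (t + l) = pslz a b p d (c t)" "\<And>t. c (t + l) \<noteq> c t"
proof -
  obtain a b p d where g: "gam a b p d" "\<And>t. c (t + l) = pslz a b p d (c t)"
    using lifts_differ_by_element[OF c lift_shift[OF c period]] by blast
  have "c (t + l) \<noteq> c t" for t
  proof
    assume e: "c (t + l) = c t"
    have "hdist (c (t + l)) (c t) = \<bar>t + l - t\<bar>" using c by (auto simp: lifts_to_def hgeodesic_on_def)
    then show False using l_pos unfolding e by (simp add: hdist_def)
  qed
  from that[OF g this] show ?thesis .
qed

lemma pslz_eqD:
  assumes "a * d - b * c = 1" "z \<in> uhp" "w = pslz a b c d z"
  shows "of_int a * z + of_int b = (of_int c * z + of_int d) * w"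
  using assms denom_uhp_int[OF _ assms(1), of z] by (simp add: pslz_def moebius_def uhp_def)

text \<open>The period acts by an element of \<open>\<Gamma>\<close> that fixes \<open>\<infinity>\<close>, hence by a translation, which
  preserves heights; along a vertical line the height changes.\<close>

lemma lift_not_vertical:
  assumes c: "lifts_to \<gamma> (vertical x k s)" and k: "k > 0" and s: "s = 1 \<or> s = - 1"
  shows False
proof -
  obtain a b p d where g: "gam a b p d" and e: "\<And>t. vertical x k s (t + l) = pslz a b p d (vertical x k s t)"
    and ne: "\<And>t. vertical x k s (t + l) \<noteq> vertical x k s t"
    using lift_translation[OF c] by metis
  note det = gam_det[OF g]
  define rr where "rr = exp (s * l)"
  have eq: "of_int a * (of_real x + \<i> * of_real y) + of_int b = (of_int p * (of_real x + \<i> * of_real y) + of_int d) * (of_real x + \<i> * of_real (rr * y))"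
    if "y = k * exp (s * t)" for y t
  proof -
    have "rr * y = k * exp (s * (t + l))" by (simp add: rr_def that distrib_left exp_add)
    then show ?thesis
      using pslz_eqD[OF det vertical_uhp[OF k] e, of t] that by (simp only: vertical_def)
  qed
  have re: "of_int a * x + of_int b = (of_int p * x + of_int d) * x - of_int p * rr * y\<^sup>2"
    and im: "of_int a * y = (of_int p * x + of_int d) * (rr * y) + of_int p * y * x"
    if "y = k * exp (s * t)" for y t
    using arg_cong[OF eq[OF that], of Re] arg_cong[OF eq[OF that], of Im] by (simp_all add: power2_eq_square algebra_simps)
  have "of_int p * rr * (k * exp (s * 0))\<^sup>2 = of_int p * rr * (k * exp (s * 1))\<^sup>2"
    using re[of _ 0, OF refl] re[of _ 1, OF refl] by linarith
  moreover have "(k * exp (s * 0))\<^sup>2 \<noteq> (k * exp (s * 1))\<^sup>2"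
    using k s exp_square_neq_one[of s] by (auto simp: power_mult_distrib)
  ultimately have p: "p = 0" by (auto simp: rr_def)
  have "of_int a * k = of_int d * (rr * k)" using im[of k 0] p by simp
  then have ad: "of_int a = of_int d * rr" using k by simp
  have "a * d = 1" using det p by simp
  then have "a = d" by (metis zmult_eq_1_iff)
  then have "rr = 1" using ad \<open>a * d = 1\<close> by auto
  then show False using s l_pos by (auto simp: rr_def)
qed

lemma lift_semicircle:
  assumes "lifts_to \<gamma> c"
  obtains u v k where "k * (v - u) > 0" "c = semicircle u v k"
proof -
  have "hgeodesic_on UNIV c" using assms by (simp add: lifts_to_def)
  then obtain F where F: "geodesic_form F" "\<And>t. c t = F t"
    using hgeodesic_form[of UNIV c 0 1] by auto
  then have "c = F" by auto
  then show ?thesis using F(1) lift_not_vertical assms that unfolding geodesic_form_def by blast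
qed

text \<open>The end points are the fixed points of the matrix that acts as the period, and they are irrational because
  the discriminant \<open>(a + d)\<^sup>2 - 4\<close> is positive and not a square.\<close>

lemma lift_endpoints:
  assumes c: "lifts_to \<gamma> (semicircle u v k)" and k: "k * (v - u) > 0"
  shows "\<exists>D C. has_form D C u v" "u \<notin> \<rat>" "v \<notin> \<rat>"
proof -
  obtain a b p d where g: "gam a b p d" and e: "\<And>t. semicircle u v k (t + l) = pslz a b p d (semicircle u v k t)"
    and ne: "\<And>t. semicircle u v k (t + l) \<noteq> semicircle u v k t"
    using lift_translation[OF c] by metis
  note det = gam_det[OF g]
  have k0: "k \<noteq> 0" and uv: "u \<noteq> v" using k by auto
  define rr where "rr = exp l"
  have eq: "(of_int a * of_real u + of_int b + (of_int a * of_real v + of_int b) * (\<i> * of_real X)) * (1 + of_real rr * (\<i> * of_real X))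
     = (of_int p * of_real u + of_int d + (of_int p * of_real v + of_int d) * (\<i> * of_real X)) * (of_real u + of_real v * (of_real rr * (\<i> * of_real X)))"
    if X: "X = k * exp t" for X t
  proof -
    define w where "w = \<i> * of_real X"
    have w: "\<i> * of_real k * exp (of_real t) = w" "\<i> * of_real k * exp (of_real (t + l)) = of_real rr * w"
      unfolding w_def X rr_def exp_of_real exp_add by (simp_all add: mult.assoc mult.commute mult.left_commute)
    have nz: "1 + w \<noteq> 0" "1 + of_real rr * w \<noteq> 0"
      using arc_denom[of X] arc_denom[of "rr * X"] by (simp_all add: w_def ac_simps)
    have "of_int a * ((of_real u + of_real v * w) / (1 + w)) + of_int b =
      (of_int p * ((of_real u + of_real v * w) / (1 + w)) + of_int d) * ((of_real u + of_real v * (of_real rr * w)) / (1 + of_real rr * w))"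
      using pslz_eqD[OF det semicircle_uhp[OF k] e, of t] unfolding semicircle_def w .
    then have "(of_int a * (of_real u + of_real v * w) + of_int b * (1 + w)) * (1 + of_real rr * w) =
      (of_int p * (of_real u + of_real v * w) + of_int d * (1 + w)) * (of_real u + of_real v * (of_real rr * w))"
      using nz by (simp add: divide_simps)
    then show ?thesis unfolding w_def[symmetric] by (simp add: algebra_simps)
  qed
  define P0 where "P0 = of_int a * u + of_int b - (of_int p * u + of_int d) * u"
  define P2 where "P2 = rr * (of_int a * v + of_int b - (of_int p * v + of_int d) * v)"
  have re: "P0 = P2 * X\<^sup>2" if "X = k * exp t" for X t
    using arg_cong[OF eq[OF that], of Re] by (simp add: P0_def P2_def power2_eq_square algebra_simps)
  have "P2 * (k * exp 0)\<^sup>2 = P2 * (k * exp 1)\<^sup>2" by (metis re)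
  moreover have "(k * exp 0)\<^sup>2 \<noteq> (k * exp 1)\<^sup>2" using k0 exp_square_neq_one[of 1] by (auto simp: power_mult_distrib)
  ultimately have P2: "P2 = 0" by auto
  then have P0: "P0 = 0" using re[of k 0] by simp
  have ru: "of_int p * u * u = (of_int a - of_int d) * u + of_int b" using P0 by (simp add: P0_def algebra_simps)
  have rv: "of_int p * v * v = (of_int a - of_int d) * v + of_int b"
  proof -
    have "of_int a * v + of_int b - (of_int p * v + of_int d) * v = 0" using P2 by (simp add: P2_def rr_def)
    then show ?thesis by (simp add: algebra_simps)
  qed
  have p: "p \<noteq> 0"
  proof
    assume p: "p = 0"
    then have "a * d = 1" using det by simp
    then have "a = d" by (metis zmult_eq_1_iff)
    then have "b = 0" using ru p by simp
    then have "pslz a b p d z = z" if "z \<in> uhp" for z using pslz_diag[OF det _ p \<open>a = d\<close> that] by simp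
    then show False using e ne semicircle_uhp[OF k] by metis
  qed
  have "(u - v) * (of_int p * (u + v) - (of_int a - of_int d)) = 0" using ru rv by (simp add: algebra_simps)
  then have sum: "of_int p * (u + v) = of_int a - of_int d" using uv by simp
  have "of_int p * (u * v) = of_int p * (u + v) * u - of_int p * u * u" by (simp add: algebra_simps)
  then have prod: "of_int p * (u * v) = - of_int b" unfolding sum ru by simp
  define D where "D = (a + d)\<^sup>2 - 4"
  have F: "has_form D p u v"
    unfolding has_form_def
  proof (intro conjI p exI)
    show "of_int p * (u + v) = - of_int (d - a)" using sum by simp
    show "of_int p * (u * v) = of_int (- b)" using prod by simp
    show "(d - a)\<^sup>2 - 4 * p * - b = D" using det by (simp add: D_def power2_eq_square algebra_simps)
  qed
  then show "\<exists>D C. has_form D C u v" by blast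
  have dsc: "(of_int p * (u - v))\<^sup>2 = of_int D" by (rule has_form_disc[OF F])
  have irr: "of_int p * (u - v) \<notin> \<rat>"
  proof
    assume "of_int p * (u - v) \<in> \<rat>"
    from rational_square_int[OF this dsc] obtain n where n: "n\<^sup>2 = D" by blast
    have "(of_int p * (u - v))\<^sup>2 > 0" using p uv by simp
    then have "D > 0" unfolding dsc by simp
    define m where "m = \<bar>n\<bar>"
    define t where "t = \<bar>a + d\<bar>"
    have mt: "m\<^sup>2 = t\<^sup>2 - 4" "m \<ge> 0" "t \<ge> 0" using n by (auto simp: m_def t_def D_def)
    have "m < t" using mt by (intro power2_less_imp_less[of m t]) auto
    then have "m\<^sup>2 \<le> (t - 1)\<^sup>2" using mt(2) by (intro power_mono) auto
    then have "2 * t \<le> 5" using mt(1) by (simp add: power2_eq_square algebra_simps)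
    moreover have "t > 2" using mt \<open>D > 0\<close> n by (intro power2_less_imp_less[of 2 t]) (auto simp: m_def)
    ultimately show False by linarith
  qed
  show "u \<notin> \<rat>"
  proof
    assume "u \<in> \<rat>"
    moreover have "of_int p * (u - v) = 2 * of_int p * u - (of_int a - of_int d)" unfolding sum[symmetric] by (simp add: algebra_simps)
    ultimately show False using irr by simp
  qed
  show "v \<notin> \<rat>"
  proof
    assume "v \<in> \<rat>"
    moreover have "of_int p * (u - v) = (of_int a - of_int d) - 2 * of_int p * v" unfolding sum[symmetric] by (simp add: algebra_simps)
    ultimately show False using irr by simp
  qed
qed

text \<open>Initial and final points of all lifts; the order of a pair records the orientation.\<close>

definition ends :: "(real \<times> real) set" where
  "ends = {(u, v). \<exists>k. k * (v - u) > 0 \<and> lifts_to \<gamma> (semicircle u v k)}"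

lemma ends_pslz:
  assumes "(u, v) \<in> ends" and g: "gam a b c d"
  shows "(rmob a b c d u, rmob a b c d v) \<in> ends"
proof -
  obtain k where k: "k * (v - u) > 0" and L: "lifts_to \<gamma> (semicircle u v k)" using assms(1) by (auto simp: ends_def)
  note irr = lift_endpoints(2,3)[OF L k]
  obtain k' where "k' * (rmob a b c d v - rmob a b c d u) > 0"
    and e: "\<And>t. pslz a b c d (semicircle u v k t) = semicircle (rmob a b c d u) (rmob a b c d v) k' t"
    using pslz_semicircle[OF gam_det[OF g] rmob_denom[OF gam_det[OF g] irr(1)] rmob_denom[OF gam_det[OF g] irr(2)] k] by blast
  moreover have "lifts_to \<gamma> (semicircle (rmob a b c d u) (rmob a b c d v) k')"
    using lift_pslz[OF L g] unfolding e .
  ultimately show ?thesis by (auto simp: ends_def)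
qed

lemma ends_orbit:
  assumes "(u, v) \<in> ends" "(u', v') \<in> ends"
  shows "\<exists>a b c d. gam a b c d \<and> u' = rmob a b c d u \<and> v' = rmob a b c d v"
proof -
  obtain k where k: "k * (v - u) > 0" and L: "lifts_to \<gamma> (semicircle u v k)" using assms(1) by (auto simp: ends_def)
  obtain k' where k': "k' * (v' - u') > 0" and L': "lifts_to \<gamma> (semicircle u' v' k')" using assms(2) by (auto simp: ends_def)
  obtain a b c d where g: "gam a b c d" and e: "\<And>t. semicircle u' v' k' t = pslz a b c d (semicircle u v k t)"
    using lifts_differ_by_element[OF L L'] by blast
  note irr = lift_endpoints(2,3)[OF L k]
  obtain k'' where k'': "k'' * (rmob a b c d v - rmob a b c d u) > 0"
    and e': "\<And>t. pslz a b c d (semicircle u v k t) = semicircle (rmob a b c d u) (rmob a b c d v) k'' t"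
    using pslz_semicircle[OF gam_det[OF g] rmob_denom[OF gam_det[OF g] irr(1)] rmob_denom[OF gam_det[OF g] irr(2)] k] by blast
  have "u' = rmob a b c d u \<and> v' = rmob a b c d v"
    by (rule semicircle_inj[of _ _ k' _ _ k'']) (use k' k'' e e' in auto)
  then show ?thesis using g by blast
qed

text \<open>Here simplicity enters: at a common point the two lifts have parameters that differ by a multiple of the period, and
  a point determines the lift because \<open>\<Gamma>\<close> acts freely.\<close>

lemma lifts_disjoint:
  assumes k: "k * (v - u) > 0" and L: "lifts_to \<gamma> (semicircle u v k)"
    and k': "k' * (v' - u') > 0" and L': "lifts_to \<gamma> (semicircle u' v' k')"
    and z: "semicircle u v k s = semicircle u' v' k' t"
  shows "u = u' \<and> v = v'"
proof -
  have "\<gamma> s = \<gamma> t" using lift_proj[OF L, of s] lift_proj[OF L', of t] z by simp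
  then obtain j :: int where j: "t = s + of_int j * l" using same_point_iff by blast
  have "lifts_to \<gamma> (\<lambda>x. semicircle u' v' k' (x + of_int j * l))"
    by (rule lift_shift[OF L' period_int])
  from lifts_eq[OF L this, of s] z j have e: "semicircle u v k x = semicircle u' v' k' (x + of_int j * l)" for x
    by metis
  have "semicircle u' v' k' (x + of_int j * l) = semicircle u' v' (k' * exp (of_int j * l)) x" for x
    by (simp add: semicircle_Complex exp_add mult.assoc mult.commute[of "exp x"])
  then show ?thesis
    using e k k' by (intro semicircle_inj[of u v k u' v' "k' * exp (of_int j * l)"]) auto
qed

text \<open>Otherwise the closed geodesic would satisfy \<open>\<gamma> t = \<gamma> (a - t)\<close> for some \<open>a\<close> and would not be injective on
  a period.\<close>

lemma opposite_lifts:
  assumes k: "k * (v - u) > 0" and L: "lifts_to \<gamma> (semicircle u v k)"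
    and k': "k' * (u - v) > 0" and L': "lifts_to \<gamma> (semicircle v u k')"
  shows False
proof -
  have nz: "k \<noteq> 0" "k' \<noteq> 0" using k k' by auto
  have "(- 1 / k') / k > 0" using k k' by (auto simp: zero_less_mult_iff zero_less_divide_iff mult_less_0_iff divide_less_0_iff)
  define a where "a = ln ((- 1 / k') / k)"
  have ka: "- 1 / k' = k * exp a" using \<open>(- 1 / k') / k > 0\<close> nz by (simp add: a_def)
  have "semicircle v u k' t = semicircle u v k (a - t)" for t
  proof -
    have "semicircle v u k' t = semicircle u v (k * exp a) (- t)" unfolding semicircle_swap[OF nz(2)] ka ..
    also have "\<dots> = semicircle u v k (a - t)" unfolding semicircle_Complex by (simp add: mult.assoc flip: exp_add)
    finally show ?thesis .
  qed
  then have "\<gamma> t = \<gamma> (a - t)" for t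
    using lift_proj[OF L] lift_proj[OF L'] by metis
  \<comment> \<open>The parameters \<open>a / 2 + l / 4\<close> and \<open>a / 2 - l / 4\<close> differ by half a period.\<close>
  from this[of "a / 2 + l / 4"] obtain j :: int where "a - (a / 2 + l / 4) = (a / 2 + l / 4) + of_int j * l"
    using same_point_iff by blast
  then have "(of_int j + 1 / 2) * l = 0" by (simp add: algebra_simps)
  then have "real_of_int (2 * j) = of_int (- 1)" using l_pos by (simp add: add_eq_0_iff)
  then have "2 * j = - 1" by (simp only: of_int_eq_iff)
  then show False by presburger
qed

definition L :: "(real \<times> real) set" where "L = ends \<union> ends\<inverse>"

sublocale geodesic_family L
proof
  show "L \<noteq> {}"
  proof -
    obtain c where c: "lifts_to \<gamma> c" using lift_ex by blast
    obtain u v k where "k * (v - u) > 0" "c = semicircle u v k" using lift_semicircle[OF c] by blast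
    then have "(u, v) \<in> ends" using c by (auto simp: ends_def)
    then show ?thesis by (auto simp: L_def)
  qed
  show "(v, u) \<in> L" if "(u, v) \<in> L" for u v using that by (auto simp: L_def)
  show "(rmob a b c d u, rmob a b c d v) \<in> L" if "(u, v) \<in> L" "gam a b c d" for u v a b c d
    using that ends_pslz[of u v a b c d] ends_pslz[of v u a b c d] by (auto simp: L_def)
  show "\<exists>a b c d. gam a b c d \<and> ((u', v') = (rmob a b c d u, rmob a b c d v) \<or> (u', v') = (rmob a b c d v, rmob a b c d u))"
    if "(u, v) \<in> L" "(u', v') \<in> L" for u v u' v'
  proof -
    have "(u, v) \<in> ends \<or> (v, u) \<in> ends" "(u', v') \<in> ends \<or> (v', u') \<in> ends"
      using that by (auto simp: L_def)
    then show ?thesis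
      using ends_orbit[of u v u' v'] ends_orbit[of u v v' u'] ends_orbit[of v u u' v'] ends_orbit[of v u v' u'] by blast
  qed
  show "u \<noteq> v" if "(u, v) \<in> L" for u v using that by (auto simp: L_def ends_def)
  show "u \<notin> \<rat>" if "(u, v) \<in> L" for u v
  proof -
    have "(u, v) \<in> ends \<or> (v, u) \<in> ends" using that by (auto simp: L_def)
    then show ?thesis unfolding ends_def using lift_endpoints(2,3) by blast
  qed
  show "\<exists>u v C D. (u, v) \<in> L \<and> has_form D C u v"
  proof -
    obtain c where c: "lifts_to \<gamma> c" using lift_ex by blast
    obtain u v k where k: "k * (v - u) > 0" "c = semicircle u v k" using lift_semicircle[OF c] by blast
    then have "(u, v) \<in> ends" using c by (auto simp: ends_def)
    then have "(u, v) \<in> L" by (simp add: L_def)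
    moreover obtain D C where "has_form D C u v" using lift_endpoints(1)[of u v k] c k by blast
    ultimately show ?thesis by blast
  qed
  show "\<not> (u < u' \<and> u' < v \<and> v < v')" if uvL: "(u, v) \<in> L" "(u', v') \<in> L" for u v u' v'
  proof
    assume less: "u < u' \<and> u' < v \<and> v < v'"
    have on: "\<exists>x y k t. k * (y - x) > 0 \<and> lifts_to \<gamma> (semicircle x y k) \<and> semicircle x y k t = z \<and> {x, y} = {u, v}"
      if uv: "(u, v) \<in> L" and z: "Im z > 0" "(Re z - u) * (v - Re z) = (Im z)\<^sup>2" for u v z
    proof -
      from uv consider k where "k * (v - u) > 0" "lifts_to \<gamma> (semicircle u v k)"
        | k where "k * (u - v) > 0" "lifts_to \<gamma> (semicircle v u k)"
        by (auto simp: L_def ends_def)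
      then show ?thesis
      proof cases
        case 1 then show ?thesis using semicircle_onto[OF 1(1) z] by blast
      next
        case 2
        have "(Re z - v) * (u - Re z) = (Im z)\<^sup>2" using z(2) by (simp add: algebra_simps)
        then show ?thesis using semicircle_onto[OF 2(1) z(1)] 2 by blast
      qed
    qed
    obtain z where z: "Im z > 0" "(Re z - u) * (v - Re z) = (Im z)\<^sup>2" "(Re z - u') * (v' - Re z) = (Im z)\<^sup>2"
      using circle_cross less by metis
    obtain x y k t where 1: "k * (y - x) > 0" "lifts_to \<gamma> (semicircle x y k)" "semicircle x y k t = z" "{x, y} = {u, v}"
      using on[OF uvL(1) z(1,2)] by blast
    obtain x' y' k' t' where 2: "k' * (y' - x') > 0" "lifts_to \<gamma> (semicircle x' y' k')" "semicircle x' y' k' t' = z" "{x', y'} = {u', v'}"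
      using on[OF uvL(2) z(1,3)] by blast
    have "x = x' \<and> y = y'" using lifts_disjoint[OF 1(1,2) 2(1,2), of t t'] 1(3) 2(3) by simp
    then have "{u, v} = {u', v'}" using 1(4) 2(4) by simp
    then show False using less by (auto simp: doubleton_eq_iff)
  qed
qed

end

section \<open>Winding around a hyperbolic axis\<close>

lemma Re_times_of_real: "Re (z * of_real r) = Re z * r" by simp

text \<open>Negative inside, zero on and positive outside the semicircle with end points \<open>s\<close> and \<open>t\<close>.\<close>

definition on_circle :: "real \<Rightarrow> real \<Rightarrow> complex \<Rightarrow> real" where
  "on_circle s t z = (Re z - s) * (Re z - t) + (Im z)\<^sup>2"

text \<open>The map \<open>z \<mapsto> Y - 3 - 1 / (Q * (z - Y))\<close> is hyperbolic with pole \<open>Y\<close>, and \<open>\<infinity>\<close> is mapped to \<open>Y - 3\<close>. Its fixed points lie at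
  distance \<open>\<rho>\<close> from \<open>Y - 3 / 2\<close>. The set \<open>\<Lambda>\<close> of pairs is mapped into itself and has no increasing pair across
  the line over \<open>Y\<close>.\<close>

locale winding =
  fixes Y Q \<rho> :: real and \<Lambda> :: "(real \<times> real) set"
  assumes Q: "Q > 0" and rho: "\<rho> > 0" "\<rho>\<^sup>2 = 9 / 4 - 1 / Q"
    and closed: "(a, b) \<in> \<Lambda> \<Longrightarrow> (Y - 3 - 1 / (Q * (a - Y)), Y - 3 - 1 / (Q * (b - Y))) \<in> \<Lambda>"
    and avoid: "(a, b) \<in> \<Lambda> \<Longrightarrow> \<not> (a < Y \<and> Y < b)"
    and neq: "(a, b) \<in> \<Lambda> \<Longrightarrow> a \<noteq> Y \<and> b \<noteq> Y"
begin

definition B :: "real \<Rightarrow> real" where "B z = Y - 3 - 1 / (Q * (z - Y))"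
definition Bc :: "complex \<Rightarrow> complex" where "Bc z = of_real (Y - 3) - 1 / (of_real Q * (z - of_real Y))"
definition u where "u = Y - 3 / 2 - \<rho>"
definition v where "v = Y - 3 / 2 + \<rho>"

lemma rho_less: "\<rho> < 3 / 2"
proof (rule power2_less_imp_less)
  show "\<rho>\<^sup>2 < (3 / 2)\<^sup>2" using rho Q by (simp add: power2_eq_square)
qed simp

lemma uv: "u < v" "v < Y" "Y - 3 < u" using rho rho_less by (simp_all add: u_def v_def)

lemma prod: "(3 / 2 - \<rho>) * (3 / 2 + \<rho>) = 1 / Q"
  using rho(2) by (simp add: algebra_simps power2_eq_square)

lemma B_diff: "s \<noteq> Y \<Longrightarrow> t \<noteq> Y \<Longrightarrow> B s - B t = (s - t) / (Q * (s - Y) * (t - Y))"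
proof -
  assume "s \<noteq> Y" "t \<noteq> Y"
  then have "s - Y \<noteq> 0" "t - Y \<noteq> 0" by auto
  moreover have "1 / (Q * y) - 1 / (Q * x) = (x - y) / (Q * x * y)" if "x \<noteq> 0" "y \<noteq> 0" for x y
    using that Q by (simp add: field_simps)
  ultimately show ?thesis by (simp add: B_def)
qed

lemma B_less: "s < t \<Longrightarrow> t < Y \<Longrightarrow> B s < B t"
proof -
  assume st: "s < t" "t < Y"
  then have "B s - B t = (s - t) / (Q * (s - Y) * (t - Y))" by (intro B_diff) auto
  moreover have "Q * (s - Y) * (t - Y) > 0" using st Q by (simp add: mult_pos_neg mult_neg_neg)
  ultimately have "B s - B t < 0" using st by (simp add: divide_neg_pos)
  then show ?thesis by simp
qed

lemma B_fixed: "B u = u" "B v = v"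
proof -
  have nz: "3 / 2 - \<rho> \<noteq> 0" "3 / 2 + \<rho> \<noteq> 0" using rho rho_less by auto
  have 1: "1 / (Q * (3 / 2 - \<rho>)) = 3 / 2 + \<rho>" "1 / (Q * (3 / 2 + \<rho>)) = 3 / 2 - \<rho>"
  proof -
    have gen: "1 / (Q * p) = q" if "p * q = 1 / Q" "p \<noteq> 0" for p q
    proof -
      have "1 / (Q * p) = (1 / Q) / p" by simp
      then show ?thesis unfolding that(1)[symmetric] using that(2) by simp
    qed
    show "1 / (Q * (3 / 2 - \<rho>)) = 3 / 2 + \<rho>" by (rule gen[OF prod nz(1)])
    show "1 / (Q * (3 / 2 + \<rho>)) = 3 / 2 - \<rho>" by (rule gen[OF _ nz(2)]) (use prod in \<open>simp add: mult.commute\<close>)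
  qed
  have "u - Y = - (3 / 2 + \<rho>)" "v - Y = - (3 / 2 - \<rho>)" by (simp_all add: u_def v_def)
  moreover have "1 / (Q * - p) = - (1 / (Q * p))" for p by simp
  ultimately have "B u = Y - 3 - - (3 / 2 - \<rho>)" "B v = Y - 3 - - (3 / 2 + \<rho>)" unfolding B_def using 1 by metis+
  then show "B u = u" "B v = v" by (simp_all add: u_def v_def)
qed

lemma B_gain: "z < Y \<Longrightarrow> B z - z = ((z - (Y - 3 / 2))\<^sup>2 - \<rho>\<^sup>2) / (Y - z)"
proof -
  assume "z < Y"
  then have nz: "Y - z \<noteq> 0" by simp
  have "B z - z = (Y - 3 - z) + 1 / (Q * (Y - z))"
    using minus_divide_right[of 1 "Q * (Y - z)"] by (simp add: B_def algebra_simps)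
  also have "\<dots> = ((Y - 3 - z) * (Y - z) + 1 / Q) / (Y - z)"
    using nz by (simp add: add_divide_distrib)
  also have "(Y - 3 - z) * (Y - z) + 1 / Q = (z - (Y - 3 / 2))\<^sup>2 - \<rho>\<^sup>2"
    unfolding rho(2) by (simp add: power2_eq_square algebra_simps)
  finally show ?thesis .
qed

text \<open>To the right of the repelling fixed point \<open>v\<close> every step gains at least the constant \<open>\<delta>\<close>, until the pole is passed.\<close>

lemma iterate_escapes:
  assumes "v < b" "b < Y"
  shows "\<exists>n. (B ^^ n) b \<ge> Y"
proof (rule ccontr)
  assume no: "\<not> ?thesis"
  define x where "x = Y - 3 / 2"
  define \<delta> where "\<delta> = ((b - x)\<^sup>2 - \<rho>\<^sup>2) / (Y - v)"
  have bx: "\<rho> < b - x" using assms by (simp add: v_def x_def)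
  then have "\<rho>\<^sup>2 < (b - x)\<^sup>2" using rho by (intro power_strict_mono) auto
  then have \<delta>: "\<delta> > 0" using uv by (simp add: \<delta>_def)
  have "b + real n * \<delta> \<le> (B ^^ n) b" for n
  proof (induction n)
    case (Suc n)
    define z where "z = (B ^^ n) b"
    have z: "b \<le> z" "z < Y" using Suc \<delta> no by (auto simp: z_def not_le) (smt (verit) mult_nonneg_nonneg of_nat_0_le_iff)
    have "(b - x)\<^sup>2 \<le> (z - x)\<^sup>2" using bx rho z by (intro power_mono) auto
    moreover have "Y - z \<le> Y - v" using z assms by simp
    ultimately have "\<delta> \<le> ((z - x)\<^sup>2 - \<rho>\<^sup>2) / (Y - z)"
      unfolding \<delta>_def using z \<open>\<rho>\<^sup>2 < (b - x)\<^sup>2\<close> by (intro frac_le) auto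
    then have "\<delta> \<le> B z - z" using B_gain[OF z(2)] by (simp add: x_def)
    then show ?case using Suc by (simp add: z_def[symmetric] algebra_simps)
  qed simp
  moreover obtain n where "Y - b < real n * \<delta>" using reals_Archimedean3[OF \<delta>] by blast
  ultimately have "Y < (B ^^ n) b" by (smt (verit))
  then show False using no by (meson less_imp_le)
qed

text \<open>The map takes the circle over \<open>(s, t)\<close> to the circle over the images, up to a factor whose sign is that of
  \<open>(s - Y) * (t - Y)\<close>.\<close>

lemma on_circle_Bc:
  assumes "z \<in> uhp" "s \<noteq> Y" "t \<noteq> Y"
  shows "on_circle (B s) (B t) (Bc z) * (Q\<^sup>2 * (cmod (z - of_real Y))\<^sup>2 * ((s - Y) * (t - Y))) = on_circle s t z"
proof -
  have N: "on_circle s t z = Re ((z - of_real s) * cnj (z - of_real t))" for s t z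
    by (simp add: on_circle_def power2_eq_square)
  have zY: "z - of_real Y \<noteq> 0" using assms(1) by (auto simp: uhp_def complex_eq_iff)
  have d: "(Bc z - of_real (B s)) * (of_real (Q * (s - Y)) * (z - of_real Y)) = z - of_real s" if "s \<noteq> Y" for s
  proof -
    have "of_real (s - Y) \<noteq> (0::complex)" using that by simp
    moreover have "Bc z - of_real (B s) = 1 / (of_real Q * of_real (s - Y)) - 1 / (of_real Q * (z - of_real Y))"
      by (simp add: Bc_def B_def)
    moreover have "(1 / (q * a) - 1 / (q * b)) * (q * a * b) = b - a" if "q \<noteq> 0" "a \<noteq> 0" "b \<noteq> 0" for q a b :: complex
      using that by (simp add: field_simps)
    ultimately show ?thesis using zY Q by simp
  qed
  have "(z - of_real s) * cnj (z - of_real t) = ((Bc z - of_real (B s)) * cnj (Bc z - of_real (B t)))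
     * (of_real (Q * (s - Y)) * of_real (Q * (t - Y)) * ((z - of_real Y) * cnj (z - of_real Y)))"
    unfolding d[OF assms(2), symmetric] d[OF assms(3), symmetric] by (simp add: ac_simps)
  also have "of_real (Q * (s - Y)) * of_real (Q * (t - Y)) * ((z - of_real Y) * cnj (z - of_real Y))
     = complex_of_real (Q\<^sup>2 * (cmod (z - of_real Y))\<^sup>2 * ((s - Y) * (t - Y)))"
    unfolding complex_norm_square[symmetric] by (simp add: power2_eq_square ac_simps)
  finally show ?thesis unfolding N by (simp only: Re_times_of_real)
qed

text \<open>The limit case \<open>s = \<infinity>\<close>, where the circle becomes the vertical line over \<open>t\<close>.\<close>

lemma on_circle_Bc_infinity:
  assumes "z \<in> uhp" "t \<noteq> Y"
  shows "on_circle (Y - 3) (B t) (Bc z) * (Q\<^sup>2 * (cmod (z - of_real Y))\<^sup>2 * (Y - t)) = Re z - t"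
proof -
  have N: "on_circle s t z = Re ((z - of_real s) * cnj (z - of_real t))" for s t z
    by (simp add: on_circle_def power2_eq_square)
  have zY: "z - of_real Y \<noteq> 0" using assms(1) by (auto simp: uhp_def complex_eq_iff)
  have d: "(Bc z - of_real (B t)) * (of_real (Q * (t - Y)) * (z - of_real Y)) = z - of_real t"
  proof -
    have "of_real (t - Y) \<noteq> (0::complex)" using assms(2) by simp
    moreover have "Bc z - of_real (B t) = 1 / (of_real Q * of_real (t - Y)) - 1 / (of_real Q * (z - of_real Y))"
      by (simp add: Bc_def B_def)
    moreover have "(1 / (q * a) - 1 / (q * b)) * (q * a * b) = b - a" if "q \<noteq> 0" "a \<noteq> 0" "b \<noteq> 0" for q a b :: complex
      using that by (simp add: field_simps)
    ultimately show ?thesis using zY Q by simp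
  qed
  have e: "(Bc z - of_real (Y - 3)) * (of_real Q * (z - of_real Y)) = - 1"
    using zY Q by (simp add: Bc_def)
  have "(Bc z - of_real (Y - 3)) * cnj (Bc z - of_real (B t)) * (of_real Q * of_real (Q * (t - Y)) * ((z - of_real Y) * cnj (z - of_real Y)))
    = ((Bc z - of_real (Y - 3)) * (of_real Q * (z - of_real Y))) * cnj ((Bc z - of_real (B t)) * (of_real (Q * (t - Y)) * (z - of_real Y)))"
    by (simp add: ac_simps)
  also have "\<dots> = - cnj (z - of_real t)" unfolding d e by simp
  also have "of_real Q * of_real (Q * (t - Y)) * ((z - of_real Y) * cnj (z - of_real Y))
    = complex_of_real (- (Q\<^sup>2 * (cmod (z - of_real Y))\<^sup>2 * (Y - t)))"
    unfolding complex_norm_square[symmetric] by (simp add: power2_eq_square algebra_simps)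
  finally have "Re ((Bc z - of_real (Y - 3)) * cnj (Bc z - of_real (B t))) * - (Q\<^sup>2 * (cmod (z - of_real Y))\<^sup>2 * (Y - t)) = Re (- cnj (z - of_real t))"
    by (simp only: Re_times_of_real[symmetric])
  then show ?thesis unfolding N by simp
qed

lemma Bc_onto:
  assumes "w \<in> uhp"
  obtains z where "z \<in> uhp" "Bc z = w"
proof -
  define z where "z = of_real Y - 1 / (of_real Q * (w - of_real (Y - 3)))"
  have nz: "w - of_real (Y - 3) \<noteq> 0" using assms by (auto simp: uhp_def complex_eq_iff)
  have "Im (1 / (of_real Q * (w - of_real (Y - 3)))) < 0"
    using assms Q nz by (simp add: Im_divide uhp_def divide_neg_pos sum_power2_gt_zero_iff mult_less_0_iff)
  then have "z \<in> uhp" by (simp add: z_def uhp_def)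
  moreover have "Bc z = w"
  proof -
    have "of_real Q * (z - of_real Y) = - 1 / (w - of_real (Y - 3))"
      using Q nz by (simp add: z_def)
    then show ?thesis using nz by (simp add: Bc_def)
  qed
  ultimately show ?thesis using that by blast
qed

lemma Bc_ratio:
  assumes "z \<in> uhp"
  shows "Bc z \<in> uhp" "cmod (Bc z - of_real u) * cmod (z - of_real v) * (3 / 2 + \<rho>) = cmod (Bc z - of_real v) * cmod (z - of_real u) * (3 / 2 - \<rho>)"
proof -
  have zY: "z - of_real Y \<noteq> 0" using assms(1) by (auto simp: uhp_def complex_eq_iff)
  have "Im (1 / (of_real Q * (z - of_real Y))) < 0"
    using assms Q zY by (simp add: Im_divide uhp_def divide_neg_pos sum_power2_gt_zero_iff mult_less_0_iff)
  then show "Bc z \<in> uhp" by (simp add: Bc_def uhp_def)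
  have d: "cmod (Bc z - of_real (B t)) * (Q * \<bar>t - Y\<bar> * cmod (z - of_real Y)) = cmod (z - of_real t)" if "t \<noteq> Y" for t
  proof -
    have "of_real (t - Y) \<noteq> (0::complex)" using that by simp
    moreover have "Bc z - of_real (B t) = 1 / (of_real Q * of_real (t - Y)) - 1 / (of_real Q * (z - of_real Y))"
      by (simp add: Bc_def B_def)
    moreover have "(1 / (q * a) - 1 / (q * b)) * (q * a * b) = b - a" if "q \<noteq> 0" "a \<noteq> 0" "b \<noteq> 0" for q a b :: complex
      using that by (simp add: field_simps)
    ultimately have "(Bc z - of_real (B t)) * (of_real Q * of_real (t - Y) * (z - of_real Y)) = z - of_real t"
      using zY Q by simp
    from arg_cong[OF this, of cmod] show ?thesis using Q by (simp only: norm_mult norm_of_real abs_of_pos)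
  qed
  have "\<bar>u - Y\<bar> = 3 / 2 + \<rho>" "\<bar>v - Y\<bar> = 3 / 2 - \<rho>" using rho rho_less by (simp_all add: u_def v_def)
  moreover have "u \<noteq> Y" "v \<noteq> Y" using uv by auto
  ultimately have du: "cmod (Bc z - of_real u) * (Q * (3 / 2 + \<rho>) * cmod (z - of_real Y)) = cmod (z - of_real u)"
    and dv: "cmod (Bc z - of_real v) * (Q * (3 / 2 - \<rho>) * cmod (z - of_real Y)) = cmod (z - of_real v)"
    using d[of u] d[of v] B_fixed by auto
  have "cmod (Bc z - of_real u) * cmod (z - of_real v) * (3 / 2 + \<rho>) = cmod (Bc z - of_real v) * cmod (z - of_real u) * (3 / 2 - \<rho>)"
    unfolding du[symmetric] dv[symmetric] by (simp only: ac_simps)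
  then show "cmod (Bc z - of_real u) * cmod (z - of_real v) * (3 / 2 + \<rho>) = cmod (Bc z - of_real v) * cmod (z - of_real u) * (3 / 2 - \<rho>)" .
qed

text \<open>The ratio of the distances to the two fixed points is multiplied by a constant below \<open>1\<close> in every step.\<close>

lemma Bc_no_periodic:
  assumes "z \<in> uhp" "n > 0"
  shows "(Bc ^^ n) z \<noteq> z"
proof -
  define \<kappa> where "\<kappa> = (3 / 2 - \<rho>) / (3 / 2 + \<rho>)"
  have \<kappa>: "0 < \<kappa>" "\<kappa> < 1" using rho rho_less by (simp_all add: \<kappa>_def)
  have pos: "cmod (w - of_real t) > 0" if "w \<in> uhp" for w t using that by (auto simp: uhp_def complex_eq_iff)
  define R where "R = (\<lambda>w. cmod (w - of_real u) / cmod (w - of_real v))"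
  have step: "R (Bc w) = \<kappa> * R w" if "w \<in> uhp" for w
  proof -
    have gen: "a / b = (k1 / k2) * (c / d)" if "a * d * k2 = b * c * k1" "b \<noteq> 0" "d \<noteq> 0" "k2 \<noteq> 0" for a b c d k1 k2 :: real
    proof -
      have "a * (d * k2) = (c * k1) * b" using that(1) by (simp add: ac_simps)
      moreover have "d * k2 \<noteq> 0" using that by simp
      ultimately have "a / b = (c * k1) / (d * k2)" using frac_eq_eq[OF that(2)] by blast
      then show ?thesis by (simp add: mult.commute)
    qed
    show ?thesis unfolding R_def \<kappa>_def
    proof (rule gen[OF Bc_ratio(2)[OF that]])
      show "cmod (Bc w - of_real v) \<noteq> 0" "cmod (w - of_real v) \<noteq> 0" "3 / 2 + \<rho> \<noteq> 0"
        using pos[OF that, of v] pos[OF Bc_ratio(1)[OF that], of v] rho(1) by linarith+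
    qed
  qed
  have it: "(Bc ^^ m) z \<in> uhp \<and> R ((Bc ^^ m) z) = \<kappa> ^ m * R z" for m
  proof (induction m)
    case (Suc m)
    then show ?case using step[of "(Bc ^^ m) z"] Bc_ratio(1)[of "(Bc ^^ m) z"] by simp
  qed (use assms(1) in simp)
  have "\<kappa> ^ n < 1" using \<kappa> assms(2) by (simp add: power_less_one_iff)
  moreover have "R z > 0" using pos[OF assms(1)] by (simp add: R_def)
  ultimately have "\<kappa> ^ n * R z < R z" by simp
  then have "R ((Bc ^^ n) z) < R z" using it[of n] by simp
  then show ?thesis by auto
qed

text \<open>Let \<open>x\<close> be the centre of a pair to the right of the axis. The images of \<open>\<infinity>\<close> stay to the left of the axis
  while those of \<open>x\<close> move to the right. When the pair has passed \<open>Y\<close>, the image of the vertical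
  line over \<open>x\<close> is a semicircle that crosses this vertical line, in a point \<open>w\<close>.
  The point \<open>w\<close> is at least as high as the top of the pair, and its preimage \<open>z\<close> on the vertical line is outside the
  semicircle of the pair, since every preimage of \<open>w\<close> stays outside the corresponding image of this semicircle.\<close>

lemma self_crossing:
  assumes ab: "(a, b) \<in> \<Lambda>" "v \<le> a" "a < b" "b < Y"
  obtains n z w where "n > 0" "Re z = (a + b) / 2" "Re w = (a + b) / 2" "Im z \<ge> (b - a) / 2" "Im w \<ge> (b - a) / 2"
    "(Bc ^^ n) z = w" "z \<noteq> w"
proof -
  define x where "x = (a + b) / 2"
  \<comment> \<open>Images of \<open>a\<close>, \<open>b\<close>, \<open>x\<close> and \<open>\<infinity>\<close> after \<open>i\<close> steps; \<open>E 0\<close> is a dummy value, as the image of \<open>\<infinity>\<close> is real only for \<open>i > 0\<close>.\<close>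
  define A where "A = (\<lambda>i. (B ^^ i) a)"
  define B' where "B' = (\<lambda>i. (B ^^ i) b)"
  define C where "C = (\<lambda>i. (B ^^ i) x)"
  define E where "E = (\<lambda>i. (B ^^ (i - 1)) (Y - 3))"
  have AS: "A (Suc i) = B (A i)" "B' (Suc i) = B (B' i)" "C (Suc i) = B (C i)" for i by (simp_all add: A_def B'_def C_def)
  have ES: "E (Suc i) = B (E i)" if "i > 0" for i using that by (cases i) (simp_all add: E_def)
  have E1: "E (Suc 0) = Y - 3" by (simp add: E_def)
  define n where "n = (LEAST n. B' n \<ge> Y)"
  have ex: "\<exists>n. B' n \<ge> Y" using iterate_escapes[of b] ab by (simp add: B'_def)
  have Bn: "B' n \<ge> Y" unfolding n_def using ex by (rule LeastI_ex)
  have Bi: "B' i < Y" if "i < n" for i using not_less_Least[of i "\<lambda>n. B' n \<ge> Y"] that unfolding n_def by (simp add: not_le)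
  have n0: "n > 0" using Bn ab by (cases n) (auto simp: B'_def)
  have mem: "(A i, B' i) \<in> \<Lambda>" for i
  proof (induction i)
    case 0 then show ?case using ab by (simp add: A_def B'_def)
  next
    case (Suc i)
    from closed[OF Suc] show ?case by (simp add: AS B_def)
  qed
  have ord: "v \<le> A i \<and> A i < C i \<and> C i < B' i" if "i \<le> n" for i
    using that
  proof (induction i)
    case 0 then show ?case using ab by (simp add: A_def B'_def C_def x_def)
  next
    case (Suc i)
    then have i: "v \<le> A i" "A i < C i" "C i < B' i" "B' i < Y" using Bi by auto
    have "v \<le> B (A i)"
    proof (cases "v = A i")
      case True then show ?thesis using B_fixed(2) by (metis order_refl)
    next
      case False then show ?thesis using B_less[of v "A i"] i B_fixed by simp
    qed
    then show ?case unfolding AS using B_less[of "A i" "C i"] B_less[of "C i" "B' i"] i by simp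
  qed
  have Eord: "Y - 3 \<le> E i \<and> E i < u" if "i > 0" for i
    using that
  proof (induction i)
    case (Suc i)
    show ?case
    proof (cases "i = 0")
      case True then show ?thesis using E1 uv by simp
    next
      case False
      then have i: "Y - 3 \<le> E i" "E i < u" using Suc by auto
      have "B (E i) < u" using B_less[OF i(2)] B_fixed uv by simp
      moreover have "Y - 3 \<le> B (E i)"
      proof -
        have "E i - Y < 0" using i uv by simp
        then have "1 / (Q * (E i - Y)) \<le> 0" using Q by (simp add: divide_le_0_iff mult_le_0_iff)
        then show ?thesis by (simp add: B_def)
      qed
      ultimately show ?thesis using ES[of i] False by simp
    qed
  qed simp
  have An: "Y \<le> A n" using avoid[OF mem[of n]] Bn neq[OF mem[of n]] by auto
  define h2 where "h2 = (x - E n) * (C n - x)"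
  define w where "w = Complex x (sqrt h2)"
  have x: "a < x" "x < b" using ab by (auto simp: x_def)
  have r: "(b - a) / 2 > 0" using ab by simp
  have "(x - a) * (b - x) \<le> h2"
    unfolding h2_def using Eord[OF n0] ord[of n] An x ab uv by (intro mult_mono) auto
  moreover have sq: "((b - a) / 2)\<^sup>2 = (x - a) * (b - x)" unfolding x_def by (simp add: power2_eq_square field_simps)
  ultimately have h2: "((b - a) / 2)\<^sup>2 \<le> h2" by (simp only:)
  have h2pos: "h2 > 0" using h2 r by (smt (verit) zero_less_power)
  have Imw: "Im w \<ge> (b - a) / 2" using real_le_rsqrt[OF h2] by (simp add: w_def)
  have wu: "w \<in> uhp" using h2pos by (simp add: w_def uhp_def)
  have pull: "\<exists>z. (Bc ^^ i) z = w' \<and> z \<in> uhp \<and> Re z = x \<and> on_circle a b z \<ge> 0"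
    if "i \<le> n" "w' \<in> uhp" "i > 0" "on_circle (E i) (C i) w' = 0" "on_circle (A i) (B' i) w' \<ge> 0" for i w'
    using that
  proof (induction i arbitrary: w')
    case (Suc i)
    obtain z where z: "z \<in> uhp" "Bc z = w'" using Bc_onto[OF Suc.prems(2)] by blast
    have i: "v \<le> A i" "A i < C i" "C i < B' i" "B' i < Y" using ord[of i] Bi[of i] Suc.prems(1) by auto
    have zY: "cmod (z - of_real Y) > 0" using z(1) by (auto simp: uhp_def complex_eq_iff)
    have ne: "A i \<noteq> Y" "B' i \<noteq> Y" "C i \<noteq> Y" using i by auto
    have K: "(A i - Y) * (B' i - Y) \<ge> 0" using i by (simp add: mult_nonpos_nonpos)
    have "Q\<^sup>2 * (cmod (z - of_real Y))\<^sup>2 * ((A i - Y) * (B' i - Y)) \<ge> 0"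
      by (rule mult_nonneg_nonneg[OF _ K]) simp
    from mult_nonneg_nonneg[OF Suc.prems(5) this]
    have "on_circle (A (Suc i)) (B' (Suc i)) w' * (Q\<^sup>2 * (cmod (z - of_real Y))\<^sup>2 * ((A i - Y) * (B' i - Y))) \<ge> 0" .
    then have out: "on_circle (A i) (B' i) z \<ge> 0"
      using on_circle_Bc[OF z(1) ne(1,2)] by (simp add: AS z(2))
    show ?case
    proof (cases "i = 0")
      case True
      have "Re z - C i = 0"
        using on_circle_Bc_infinity[OF z(1) ne(3)] Suc.prems(4) True by (simp add: AS z(2) E1)
      then show ?thesis using z out True by (intro exI[of _ z]) (simp add: A_def B'_def C_def)
    next
      case False
      have eY: "E i \<noteq> Y" using Eord[of i] False uv by auto
      have i0: "i > 0" using False by simp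
      have "on_circle (B (E i)) (B (C i)) (Bc z) = 0"
        using Suc.prems(4) unfolding ES[OF i0] AS z(2) .
      then have "on_circle (E i) (C i) z = 0"
        unfolding on_circle_Bc[OF z(1) eY ne(3), symmetric] by simp
      then obtain z' where "(Bc ^^ i) z' = z" "z' \<in> uhp" "Re z' = x" "on_circle a b z' \<ge> 0"
        using Suc.IH[OF _ z(1) i0 _ out] Suc.prems(1) by auto
      then show ?thesis using z(2) by (intro exI[of _ z']) simp
    qed
  qed simp
  have Imw2: "(Im w)\<^sup>2 = h2" and Rew: "Re w = x" using h2pos by (simp_all add: w_def)
  have "on_circle (E n) (C n) w = 0"
    unfolding on_circle_def Imw2 Rew by (simp add: h2_def algebra_simps)
  note on_w = this
  have out_w: "on_circle (A n) (B' n) w \<ge> 0"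
  proof -
    have "(x - A n) * (x - B' n) \<ge> 0" using An Bn x ab by (intro mult_nonpos_nonpos) auto
    then show ?thesis unfolding on_circle_def Rew by simp
  qed
  from pull[OF order_refl wu n0 on_w out_w]
  obtain z where z: "(Bc ^^ n) z = w" "z \<in> uhp" "Re z = x" "on_circle a b z \<ge> 0"
    by (elim exE conjE)
  have "((b - a) / 2)\<^sup>2 \<le> (Im z)\<^sup>2"
  proof -
    have "(x - a) * (x - b) = - ((x - a) * (b - x))" by (simp only: minus_diff_eq[of b x, symmetric] mult_minus_right)
    then show ?thesis using z(4) sq unfolding on_circle_def z(3) by linarith
  qed
  then have "(b - a) / 2 \<le> Im z"
    by (rule power2_le_imp_le) (use z(2) in \<open>simp add: uhp_def\<close>)
  moreover have "Re w = (a + b) / 2" by (simp add: w_def x_def)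
  moreover have "z \<noteq> w" using Bc_no_periodic[OF z(2) n0] unfolding z(1) by (rule not_sym)
  ultimately show ?thesis
    using that[OF n0 z(3)[unfolded x_def] _ _ Imw z(1)] by simp
qed

end

section \<open>The geodesic as axis of a product of two half-turns\<close>

text \<open>The result of the descent: the pair \<open>(u, v)\<close> consists of the end points of the axis of the half-turn over \<open>p1 / q1\<close> followed by
  the translation by \<open>-3\<close>, and the half-turn over \<open>p / q\<close> exchanges them.\<close>

locale normalized_geodesic = closed_geodesic +
  fixes p q p1 q1 :: int and u v :: real
  assumes q: "q > 0" "q dvd p^2 + 1" and q1: "q1 > 0" "q1 dvd p1^2 + 1"
    and uvL: "(u, v) \<in> L" and u_less_v: "u < v"
    and sum: "u + v = 2 * fr p1 q1 - 3" and prod: "u * v = fr p1 q1 * (fr p1 q1 - 3) + 1 / (of_int q1)\<^sup>2"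
    and swap: "half_turn p q u = v" "half_turn p q v = u"
begin

definition Y :: real where "Y = fr p1 q1"
definition x :: real where "x = Y - 3 / 2"
definition Q :: real where "Q = (of_int q1)\<^sup>2"
definition \<rho> :: real where "\<rho> = (v - u) / 2"

lemma Q1: "Q \<ge> 1"
proof -
  have "1 \<le> real_of_int q1" using q1(1) by simp
  then show ?thesis unfolding Q_def by (simp add: one_le_power)
qed

lemma u_eq: "u = x - \<rho>" and v_eq: "v = x + \<rho>"
proof -
  have "u + v = 2 * Y - 3" using sum by (simp only: Y_def)
  then show "u = x - \<rho>" "v = x + \<rho>" by (simp_all add: x_def \<rho>_def field_simps)
qed

lemma sum_x: "u + v = 2 * x"
  unfolding x_def Y_def sum by simp

lemma rho_sq: "\<rho>\<^sup>2 = 9 / 4 - 1 / Q"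
proof -
  have "4 * \<rho>\<^sup>2 = (u + v)\<^sup>2 - 4 * (u * v)" by (simp add: \<rho>_def power2_eq_square field_simps)
  also have "\<dots> = (2 * Y - 3)\<^sup>2 - 4 * (Y * (Y - 3) + 1 / Q)" unfolding sum prod Y_def Q_def ..
  also have "\<dots> = 9 - 4 / Q" by (simp add: power2_eq_square algebra_simps)
  finally show ?thesis by simp
qed

lemma rho_gt_1: "\<rho> > 1"
proof -
  have "1 / Q \<le> 1" using Q1 by simp
  then have "1\<^sup>2 < \<rho>\<^sup>2" unfolding rho_sq by simp
  moreover have "\<rho> \<ge> 0" using u_less_v by (simp add: \<rho>_def)
  ultimately show ?thesis using power2_less_imp_less by blast
qed

lemma rho_less: "\<rho> < 3 / 2"
proof (rule power2_less_imp_less)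
  show "\<rho>\<^sup>2 < (3 / 2)\<^sup>2" using rho_sq Q1 by (simp add: power2_eq_square)
qed simp

lemma gam_conj: "gam a b c d \<Longrightarrow> gam (a + 3 * m * c) (b + 3 * m * d - 3 * m * a - 9 * m^2 * c) c (d - 3 * m * c)"
  unfolding gam_def
proof (elim conjE, intro conjI)
  assume det: "a * d - b * c = 1" and 2: "if even c then even b else odd (a + d)" and 3: "if 3 dvd c then 3 dvd b else 3 dvd a + d"
  show "(a + 3 * m * c) * (d - 3 * m * c) - (b + 3 * m * d - 3 * m * a - 9 * m^2 * c) * c = 1"
    using det by (simp add: power2_eq_square algebra_simps)
  show "if even c then even (b + 3 * m * d - 3 * m * a - 9 * m^2 * c) else odd (a + 3 * m * c + (d - 3 * m * c))"
  proof (cases "even c")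
    case True
    then have "odd (a * d)" using det by (metis even_add even_diff even_mult_iff odd_one)
    then show ?thesis using True 2 by simp
  qed (use 2 in simp)
  have "3 dvd b + 3 * m * d - 3 * m * a - 9 * m^2 * c" if "3 dvd b"
  proof -
    have "b + 3 * m * d - 3 * m * a - 9 * m^2 * c = b + 3 * (m * d - m * a - 3 * m^2 * c)" by (simp add: algebra_simps)
    then show ?thesis using that by (metis dvd_add dvd_triv_left)
  qed
  then show "if 3 dvd c then 3 dvd b + 3 * m * d - 3 * m * a - 9 * m^2 * c else 3 dvd a + 3 * m * c + (d - 3 * m * c)"
    using 3 by auto
qed

lemma rmob_conj:
  assumes "of_int c * z + of_int d \<noteq> 0"
  shows "rmob (a + 3 * m * c) (b + 3 * m * d - 3 * m * a - 9 * m^2 * c) c (d - 3 * m * c) (z + 3 * of_int m)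
    = rmob a b c d z + 3 * of_int m"
  using assms by (simp add: moebius_def divide_simps) (simp add: power2_eq_square algebra_simps)

text \<open>For the axis itself, the half-turn that exchanges its ends is followed by a translation by an odd multiple of
  \<open>3\<close>. The other members are images under \<open>\<Gamma>\<close>, which is normalised by these translations.\<close>

lemma odd_shift:
  assumes ab: "(a, b) \<in> L" and m: "odd m"
  shows "(a + 3 * of_int m, b + 3 * of_int m) \<in> L"
proof -
  have "(of_int (3 * m) + half_turn p q u, of_int (3 * m) + half_turn p q v) \<in> L"
    by (rule inv_half_turn[OF uvL q m])
  then have s: "(v + 3 * of_int m, u + 3 * of_int m) \<in> L" unfolding swap by (simp add: add.commute)
  obtain e f g h where gm: "gam e f g h"
    and eq: "(a, b) = (rmob e f g h u, rmob e f g h v) \<or> (a, b) = (rmob e f g h v, rmob e f g h u)"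
    using orbit[OF uvL ab] by blast
  have nz: "of_int g * u + of_int h \<noteq> 0" "of_int g * v + of_int h \<noteq> 0"
    using rmob_denom[OF gam_det[OF gm]] irrational[OF uvL] irrational2[OF uvL] by auto
  from inv[OF s gam_conj[OF gm, of m]]
  have "(rmob e f g h v + 3 * of_int m, rmob e f g h u + 3 * of_int m) \<in> L"
    unfolding rmob_conj[OF nz(1)] rmob_conj[OF nz(2)] .
  then show ?thesis using eq sym by auto
qed

lemma shift_L:
  assumes ab: "(a, b) \<in> L"
  shows "(a + 3 * of_int m, b + 3 * of_int m) \<in> L"
proof (cases "odd m")
  case False
  then have "odd (m - 1)" by simp
  from odd_shift[OF odd_shift[OF ab this], of 1] show ?thesis by (simp add: algebra_simps)
qed (use odd_shift[OF ab] in blast)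

lemma form_uv: "has_form (9 * q1^2 - 4) q1 u v"
proof -
  obtain r where r: "p1^2 + 1 = q1 * r" using q1(2) by blast
  have "real_of_int (p1^2 + 1) = of_int (q1 * r)" using r by simp
  then have r': "(of_int p1)\<^sup>2 + 1 = real_of_int q1 * of_int r" by simp
  have q0: "real_of_int q1 \<noteq> 0" using q1 by simp
  have "of_int q1 * (u + v) = - real_of_int (3 * q1 - 2 * p1)"
    unfolding sum using q0 by (simp add: field_simps)
  moreover have "of_int q1 * (u * v) = real_of_int (r - 3 * p1)"
  proof -
    have "of_int q1 * (u * v) = ((of_int p1)\<^sup>2 + 1) / of_int q1 - 3 * of_int p1"
      unfolding prod using q0 by (simp add: field_simps power2_eq_square)
    then show ?thesis unfolding r' using q0 by simp
  qed
  moreover have "(3 * q1 - 2 * p1)^2 - 4 * q1 * (r - 3 * p1) = 9 * q1^2 - 4"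
    using r by (simp add: power2_eq_square algebra_simps)
  ultimately show ?thesis unfolding has_form_def using q1 by (intro conjI exI) auto
qed

text \<open>A pair longer than \<open>3\<close> would be linked with its translate by \<open>3\<close>. The discriminant is \<open>9 q\<^sub>1\<^sup>2 - 4\<close>, and
  the squared lengths are its quotients by squares of integers \<open>C\<close>. Lengths up to \<open>3\<close> require \<open>C\<^sup>2 \<ge> q\<^sub>1\<^sup>2\<close>,
  and \<open>C\<^sup>2 = q\<^sub>1\<^sup>2\<close> gives the length of the axis.\<close>

lemma length_le:
  assumes ab: "(a, b) \<in> L"
  shows "\<bar>a - b\<bar> \<le> 2 * \<rho>"
proof -
  have le3: "d - c \<le> 3" if "(c, d) \<in> L" for c d
  proof (rule ccontr)
    assume "\<not> d - c \<le> 3"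
    then show False using unlinked[OF that shift_L[OF that, of 1]] by simp
  qed
  have 3: "\<bar>a - b\<bar> \<le> 3" using le3[OF ab] le3[OF sym[OF ab]] by linarith
  obtain C where C: "has_form (9 * q1^2 - 4) C a b" using forms[OF uvL form_uv ab] by blast
  have dsc: "(of_int C)\<^sup>2 * (a - b)\<^sup>2 = 9 * (of_int q1)\<^sup>2 - 4"
    using has_form_disc[OF C] by (simp add: power_mult_distrib)
  have C0: "C \<noteq> 0" using C by (simp add: has_form_def)
  have "(a - b)\<^sup>2 \<le> 3\<^sup>2" using 3 by (metis abs_ge_zero power2_abs power_mono)
  then have "(of_int C)\<^sup>2 * (a - b)\<^sup>2 \<le> (of_int C)\<^sup>2 * 9" by (intro mult_left_mono) auto
  then have "9 * (real_of_int q1)\<^sup>2 - 4 \<le> 9 * (of_int C)\<^sup>2" unfolding dsc by simp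
  then have "real_of_int (9 * q1^2 - 4) \<le> of_int (9 * C^2)" by simp
  then have "9 * q1^2 - 4 \<le> 9 * C^2" by (simp only: of_int_le_iff)
  then have "q1^2 \<le> C^2" by linarith
  then have "(real_of_int q1)\<^sup>2 \<le> (of_int C)\<^sup>2" by (metis of_int_le_iff of_int_power)
  then have "(a - b)\<^sup>2 * Q \<le> (of_int C)\<^sup>2 * (a - b)\<^sup>2"
    unfolding Q_def by (subst mult.commute) (intro mult_right_mono, auto)
  also have "\<dots> = 4 * \<rho>\<^sup>2 * Q" unfolding dsc rho_sq using q1(1) by (simp add: Q_def field_simps)
  finally have "(a - b)\<^sup>2 \<le> (2 * \<rho>)\<^sup>2" using Q1 by (simp add: power_mult_distrib)
  then have "\<bar>a - b\<bar> \<le> \<bar>2 * \<rho>\<bar>" by (simp only: abs_le_square_iff)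
  then show ?thesis using rho_gt_1 by linarith
qed

lemma rational_line: "(a, b) \<in> L \<Longrightarrow> a \<noteq> Y + 3 * of_int m \<and> b \<noteq> Y + 3 * of_int m"
proof -
  assume ab: "(a, b) \<in> L"
  show ?thesis
    using neq_rational[OF ab, of "p1 + (3 * m) * q1" q1] neq_rational2[OF ab, of "p1 + (3 * m) * q1" q1]
    unfolding fr_shift3[OF q1(1)] Y_def by (rule conjI)
qed

definition B :: "real \<Rightarrow> real" where "B z = Y - 3 - 1 / (Q * (z - Y))"

lemma B_half_turn: "B z = of_int (3 * (- 1)) + half_turn p1 q1 z"
  by (simp add: B_def half_turn_def Y_def Q_def)

lemma B_L: "(a, b) \<in> L \<Longrightarrow> (B a, B b) \<in> L"
  unfolding B_half_turn by (rule inv_half_turn[OF _ q1]) auto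

text \<open>A pair across \<open>Y\<close> fits between the axis and its translate by \<open>3\<close>. The map \<open>B\<close> with pole \<open>Y\<close> would send it
  to a pair of length at least \<open>2 \<rho> + 3\<close>, against \<open>length_le\<close>.\<close>

lemma no_line_Y:
  assumes ab: "(a, b) \<in> L"
  shows "\<not> (a < Y \<and> Y < b)"
proof
  assume less: "a < Y \<and> Y < b"
  have v: "v < Y" "Y < u + 3" using rho_less u_eq v_eq x_def by linarith+
  have len: "b - a \<le> 2 * \<rho>" using length_le[OF ab] by simp
  have av: "v \<le> a"
  proof (rule ccontr)
    assume "\<not> v \<le> a"
    then have "a < v" "v < b" using less v by simp_all
    then have "\<not> u < a" using unlinked[OF uvL ab] by blast
    then have "a \<le> u" by simp
    then show False using len less rho_less u_eq x_def by linarith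
  qed
  have uv3: "(u + 3, v + 3) \<in> L" using shift_L[OF uvL, of 1] by simp
  have bu: "b \<le> u + 3"
  proof (rule ccontr)
    assume "\<not> b \<le> u + 3"
    then have "a < u + 3" "u + 3 < b" using less v by simp_all
    then have "\<not> b < v + 3" using unlinked[OF ab uv3] by blast
    then have "v + 3 \<le> b" by simp
    then show False using len less rho_less v_eq x_def by linarith
  qed
  have pq: "1 / (Q * (3 / 2 - \<rho>)) = 3 / 2 + \<rho>"
  proof -
    have "(3 / 2 + \<rho>) * (3 / 2 - \<rho>) = 1 / Q" using rho_sq by (simp add: power2_eq_square algebra_simps)
    moreover have "1 / (Q * s) = t" if "t * s = 1 / Q" "s \<noteq> 0" for s t
    proof -
      have "1 / (Q * s) = (1 / Q) / s" by simp
      then show ?thesis unfolding that(1)[symmetric] using that(2) by simp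
    qed
    moreover have "3 / 2 - \<rho> \<noteq> 0" using rho_less by simp
    ultimately show ?thesis by blast
  qed
  have mono: "1 / (Q * (3 / 2 - \<rho>)) \<le> 1 / (Q * z)" if "z \<le> 3 / 2 - \<rho>" "z > 0" for z
    using that Q1 by (intro divide_left_mono mult_left_mono mult_pos_pos) auto
  have "B a = Y - 3 + 1 / (Q * (Y - a))"
    using minus_divide_right[of 1 "Q * (Y - a)"] by (simp add: B_def algebra_simps)
  then have 1: "B a \<ge> v" using mono[of "Y - a"] av less pq v_eq x_def by linarith
  have 2: "B b \<le> u - 3" using mono[of "b - Y"] bu less pq u_eq x_def B_def[of b] by linarith
  have "(B a, B b) \<in> L" by (rule B_L[OF ab])
  from length_le[OF this] 1 2 have "v - u + 3 \<le> 2 * \<rho>" by simp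
  then show False by (simp add: \<rho>_def)
qed

lemma no_line: "(a, b) \<in> L \<Longrightarrow> \<not> (a < Y + 3 * of_int m \<and> Y + 3 * of_int m < b)"
  using no_line_Y[OF shift_L[of a b "- m"]] by (simp add: diff_less_eq less_diff_eq)

text \<open>By the invariance under translations, arguments may assume that a given centre is within \<open>3 / 2\<close> of that of the axis.\<close>

lemma shifted: "normalized_geodesic \<gamma> l (p + (3 * j) * q) q (p1 + (3 * j) * q1) q1 (u + 3 * of_int j) (v + 3 * of_int j)"
proof (unfold_locales)
  show "q dvd (p + 3 * j * q)\<^sup>2 + 1" "q1 dvd (p1 + 3 * j * q1)\<^sup>2 + 1" using dvd_shift q q1 by auto
  show "(u + 3 * of_int j, v + 3 * of_int j) \<in> L" by (rule shift_L[OF uvL])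
  show "u + 3 * real_of_int j + (v + 3 * real_of_int j) = 2 * fr (p1 + 3 * j * q1) q1 - 3"
    unfolding fr_shift3[OF q1(1)] using sum by simp
  have "(u + s) * (v + s) = (y + s) * (y + s - 3) + c" if "u + v = 2 * y - 3" "u * v = y * (y - 3) + c" for y c s
  proof -
    have "(u + s) * (v + s) = u * v + (u + v) * s + s * s" by (simp add: algebra_simps)
    then show ?thesis unfolding that by (simp add: algebra_simps)
  qed
  from this[OF sum prod]
  show "(u + 3 * real_of_int j) * (v + 3 * real_of_int j) = fr (p1 + 3 * j * q1) q1 * (fr (p1 + 3 * j * q1) q1 - 3) + 1 / (real_of_int q1)\<^sup>2"
    unfolding fr_shift3[OF q1(1)] .
  show "half_turn (p + 3 * j * q) q (u + 3 * real_of_int j) = v + 3 * real_of_int j"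
    "half_turn (p + 3 * j * q) q (v + 3 * real_of_int j) = u + 3 * real_of_int j"
    using half_turn_shift[OF q(1), of p "3 * j"] swap by simp_all
qed (use q q1 u_less_v in auto)

lemma lift_through:
  assumes ab: "(a, b) \<in> L" and z: "z \<in> uhp" "on_circle a b z = 0"
  shows "torus_proj z \<in> range \<gamma>"
proof -
  have "(a, b) \<in> ends \<or> (b, a) \<in> ends" using ab by (auto simp: L_def)
  moreover have "on_circle b a z = 0" using z by (simp add: on_circle_def mult.commute)
  moreover have "torus_proj z \<in> range \<gamma>" if cd: "(c, d) \<in> ends" "on_circle c d z = 0" for c d
  proof -
    obtain k where k: "k * (d - c) > 0" "lifts_to \<gamma> (semicircle c d k)" using cd(1) by (auto simp: ends_def)
    have "(Re z - c) * (d - Re z) = (Im z)\<^sup>2" using cd(2) by (simp add: on_circle_def algebra_simps)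
    then obtain t where "semicircle c d k t = z" using semicircle_onto[OF k(1)] z by (auto simp: uhp_def)
    then show ?thesis using lift_proj[OF k(2), of t] by blast
  qed
  ultimately show ?thesis using z by blast
qed

text \<open>The height of a semicircle is bounded by its radius, and radii by \<open>length_le\<close>.\<close>

lemma on_lift_height:
  assumes "torus_proj z = \<gamma> t" "z \<in> uhp"
  shows "Im z \<le> \<rho>"
proof -
  obtain c where c: "lifts_to \<gamma> c" using lift_ex by blast
  have "torus_proj (c t) = torus_proj z" using lift_proj[OF c] assms by simp
  then obtain e f g h where gm: "gam e f g h" "z = pslz e f g h (c t)"
    using torus_proj_eq_iff[OF lift_uhp[OF c] assms(2)] by blast
  have c': "lifts_to \<gamma> (\<lambda>t. pslz e f g h (c t))" by (rule lift_pslz[OF c gm(1)])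
  obtain a b k where k: "k * (b - a) > 0" "(\<lambda>t. pslz e f g h (c t)) = semicircle a b k" using lift_semicircle[OF c'] by blast
  have "(a, b) \<in> L" using k c' by (auto simp: L_def ends_def)
  have "z = semicircle a b k t" using k(2) gm(2) by metis
  then have "(Im z)\<^sup>2 = (Re z - a) * (b - Re z)" using semicircle_circle[of a b k t] by simp
  also have "\<dots> \<le> ((b - a) / 2)\<^sup>2"
  proof -
    have "((b - a) / 2)\<^sup>2 - (y - a) * (b - y) = (y - (a + b) / 2)\<^sup>2" for y by (simp add: power2_eq_square field_simps)
    then show ?thesis by (metis diff_ge_0_iff_ge zero_le_power2)
  qed
  also have "\<dots> \<le> \<rho>\<^sup>2"
  proof -
    have "\<bar>b - a\<bar> \<le> 2 * \<rho>" using length_le[OF \<open>(a, b) \<in> L\<close>] by (simp only: abs_minus_commute)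
    then have "\<bar>(b - a) / 2\<bar> \<le> \<bar>\<rho>\<bar>" using rho_gt_1 by simp
    then show ?thesis by (simp only: abs_le_square_iff)
  qed
  finally show ?thesis by (rule power2_le_imp_le) (use rho_gt_1 in simp)
qed

end

section \<open>Simple vertical rays\<close>

context normalized_geodesic
begin

text \<open>The inverse of the map \<open>B\<close>; the argument on the left of the axis is the mirror image of the one on the right.\<close>

definition Binv :: "real \<Rightarrow> real" where "Binv z = Y - 1 / (Q * (z - (Y - 3)))"

lemma Binv_half_turn: "Binv z = of_int (3 * 1) + half_turn (p1 - 3 * q1) q1 z"
  using fr_shift3[OF q1(1), of p1 "- 1"] by (simp add: Binv_def half_turn_def Y_def Q_def)

lemma Binv_L: "(a, b) \<in> L \<Longrightarrow> (Binv a, Binv b) \<in> L"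
  unfolding Binv_half_turn by (rule inv_half_turn) (use q1 dvd_shift[of q1 p1 "- 3"] in auto)

lemma torus_proj_half_turn:
  fixes a b n :: int
  assumes "b > 0" "b dvd a^2 + 1" "odd n" "z \<in> uhp"
  shows "torus_proj (of_real (of_int (3 * n) + fr a b) - 1 / (of_real ((of_int b)\<^sup>2) * (z - of_real (fr a b)))) = torus_proj z"
proof -
  obtain r where r: "r = (a^2 + 1) div b" by simp
  have br: "b * r = a^2 + 1" using assms r by simp
  have br': "of_int b * of_int r = ((of_int a)\<^sup>2 + 1 :: complex)"
    using arg_cong[OF br, of "of_int :: int \<Rightarrow> complex"] by simp
  note g = gam_half_turn[OF assms(2,3) r]
  have b0: "(of_int b :: complex) \<noteq> 0" using assms(1) by simp
  have Im: "Im z > 0" using assms(4) by (simp add: uhp_def)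
  have nz: "of_int b * z - of_int a \<noteq> 0" using denom_uhp_int[OF Im gam_det[OF g]] by simp
  have fz: "z - of_real (fr a b) = (of_int b * z - of_int a) / of_int b" using b0 by (simp add: field_simps)
  have "pslz (a + 3 * n * b) (- r - 3 * n * a) b (- a) z
    = ((of_int a + 3 * of_int n * of_int b) * z - of_int r - 3 * of_int n * of_int a) / (of_int b * z - of_int a)"
    using assms(4) by (simp add: pslz_def moebius_def)
  also have "\<dots> = of_real (of_int (3 * n) + fr a b) - 1 / (of_real ((of_int b)\<^sup>2) * (z - of_real (fr a b)))"
  proof -
    define W where "W = of_int b * z - of_int a"
    have W: "W \<noteq> 0" using nz by (simp add: W_def)
    have "((of_int a + 3 * of_int n * of_int b) * z - of_int r - 3 * of_int n * of_int a) * of_int b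
      = 3 * of_int n * of_int b * W + of_int a * W - 1"
      using br' by (simp add: W_def algebra_simps power2_eq_square)
    then have "((of_int a + 3 * of_int n * of_int b) * z - of_int r - 3 * of_int n * of_int a) = (3 * of_int n * of_int b * W + of_int a * W - 1) / of_int b"
      using b0 by (simp add: nonzero_eq_divide_eq)
    moreover have "(3 * of_int n * of_int b * W + of_int a * W - 1) / of_int b / W
       = of_real (of_int (3 * n) + fr a b) - 1 / (of_real ((of_int b)\<^sup>2) * (W / of_int b))"
      using b0 W by (simp add: field_simps power2_eq_square)
    ultimately show ?thesis unfolding fz W_def[symmetric] by simp
  qed
  finally show ?thesis using torus_proj_pslz[OF g assms(4)] by simp
qed

lemma ray_avoids:
  assumes "(a, b) \<in> L" and R1: "\<And>y. y > r \<Longrightarrow> torus_proj (Complex x' y) \<notin> range \<gamma>"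
    and h: "h > 0" "h\<^sup>2 = (x' - a) * (b - x')"
  shows "h \<le> r"
proof (rule ccontr)
  assume "\<not> h \<le> r"
  then have "torus_proj (Complex x' h) \<notin> range \<gamma>" using R1 by simp
  moreover have "on_circle a b (Complex x' h) = 0" using h by (simp add: on_circle_def algebra_simps)
  ultimately show False using lift_through[OF assms(1), of "Complex x' h"] h by (simp add: uhp_def)
qed

text \<open>The vertical ray over the centre of \<open>(a, b)\<close> is assumed to be simple and to meet the closed geodesic only in its
  foot. If the pair lies under the axis, the ray starts below the axis and hits it; otherwise the pair is to the
  right of the axis and \<open>self_crossing\<close> contradicts simplicity.\<close>

lemma right_of_axis:
  assumes ab: "(a, b) \<in> L" "a < b" and R1: "\<And>y. y > (b - a) / 2 \<Longrightarrow> torus_proj (Complex ((a + b) / 2) y) \<notin> range \<gamma>"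
    and R2: "\<And>y y'. y \<ge> (b - a) / 2 \<Longrightarrow> y' \<ge> (b - a) / 2 \<Longrightarrow>
       torus_proj (Complex ((a + b) / 2) y) = torus_proj (Complex ((a + b) / 2) y') \<Longrightarrow> y = y'"
    and x': "x < (a + b) / 2" "(a + b) / 2 \<le> x + 3 / 2"
  shows False
proof -
  have len: "b - a \<le> v - u"
  proof -
    have e: "\<bar>a - b\<bar> = b - a" using ab(2) by simp
    have "2 * \<rho> = v - u" by (simp add: \<rho>_def)
    then show ?thesis using length_le[OF ab(1)] unfolding e by (simp only:)
  qed
  have sum_gt: "u + v < a + b" unfolding sum_x using x'(1) by simp
  have va: "v \<le> a"
  proof (rule ccontr)
    assume av: "\<not> v \<le> a"
    show False
    proof (cases "v < b")
      case True
      then have "a \<le> u" using unlinked[OF uvL ab(1)] av by auto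
      then show False using len True by simp
    next
      case False
      then have bv: "b \<le> v" by simp
      define x' where "x' = (a + b) / 2"
      have au: "u < a" using sum_gt bv by simp
      have ax: "a < x'" "x' < b" using ab by (simp_all add: x'_def)
      have "(x' - a) * (b - x') < (x' - u) * (v - x')"
        using au bv ax by (intro mult_less_le_imp_less) auto
      define h where "h = sqrt ((x' - u) * (v - x'))"
      have "(x' - u) * (v - x') > 0" using au bv ax by simp
      then have h: "h > 0" "h\<^sup>2 = (x' - u) * (v - x')" by (simp_all add: h_def)
      have R1': "torus_proj (Complex x' y) \<notin> range \<gamma>" if "y > (b - a) / 2" for y
        unfolding x'_def by (rule R1[OF that])
      have "h \<le> (b - a) / 2" by (rule ray_avoids[OF uvL R1' h])
      then have "h\<^sup>2 \<le> ((b - a) / 2)\<^sup>2" using h by (intro power_mono) auto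
      also have "\<dots> = (x' - a) * (b - x')" by (simp add: x'_def power2_eq_square field_simps)
      finally show False using \<open>(x' - a) * (b - x') < (x' - u) * (v - x')\<close> h by simp
    qed
  qed
  have "a < Y" using x' ab(2) by (simp add: x_def)
  then have bY: "b < Y" using no_line_Y[OF ab(1)] rational_line[OF ab(1), of 0] by auto
  interpret W: winding Y Q \<rho> L
  proof
    show "(Y - 3 - 1 / (Q * (a - Y)), Y - 3 - 1 / (Q * (b - Y))) \<in> L" if "(a, b) \<in> L" for a b
      using B_L[OF that] by (simp add: B_def)
    show "\<not> (a < Y \<and> Y < b)" if "(a, b) \<in> L" for a b by (rule no_line_Y[OF that])
    show "a \<noteq> Y \<and> b \<noteq> Y" if "(a, b) \<in> L" for a b using rational_line[OF that, of 0] by simp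
  qed (use Q1 rho_gt_1 rho_sq in auto)
  have v': "W.v = v" using W.v_def v_eq x_def by linarith
  obtain n z w where n: "n > 0" "Re z = (a + b) / 2" "Re w = (a + b) / 2" "Im z \<ge> (b - a) / 2" "Im w \<ge> (b - a) / 2"
    "(W.Bc ^^ n) z = w" "z \<noteq> w"
    using W.self_crossing[OF ab(1) _ ab(2) bY] va v' by metis
  have step: "torus_proj (W.Bc s) = torus_proj s" if "s \<in> uhp" for s
    using torus_proj_half_turn[OF q1, of "- 1" s] that
    by (simp add: W.Bc_def Y_def[symmetric] Q_def[symmetric])
  have "(W.Bc ^^ m) z \<in> uhp \<and> torus_proj ((W.Bc ^^ m) z) = torus_proj z" for m
  proof (induction m)
    case 0 then show ?case using n(4) ab(2) by (simp add: uhp_def)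
  next
    case (Suc m) then show ?case using step W.Bc_ratio(1) by simp
  qed
  then have "torus_proj z = torus_proj w" using n(6) by metis
  moreover have "z = Complex ((a + b) / 2) (Im z)" "w = Complex ((a + b) / 2) (Im w)" using n by (simp_all add: complex_eq_iff)
  ultimately have "Im z = Im w" using R2[OF n(4,5)] by metis
  then show False using n by (simp add: complex_eq_iff)
qed

text \<open>The mirror image of \<open>right_of_axis\<close>, under \<open>z \<mapsto> - cnj z\<close>.\<close>

lemma left_of_axis:
  assumes ab: "(a, b) \<in> L" "a < b" and R1: "\<And>y. y > (b - a) / 2 \<Longrightarrow> torus_proj (Complex ((a + b) / 2) y) \<notin> range \<gamma>"
    and R2: "\<And>y y'. y \<ge> (b - a) / 2 \<Longrightarrow> y' \<ge> (b - a) / 2 \<Longrightarrow>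
       torus_proj (Complex ((a + b) / 2) y) = torus_proj (Complex ((a + b) / 2) y') \<Longrightarrow> y = y'"
    and x': "(a + b) / 2 < x" "x - 3 / 2 \<le> (a + b) / 2"
  shows False
proof -
  have len: "b - a \<le> v - u"
  proof -
    have e: "\<bar>a - b\<bar> = b - a" using ab(2) by simp
    have "2 * \<rho> = v - u" by (simp add: \<rho>_def)
    then show ?thesis using length_le[OF ab(1)] unfolding e by (simp only:)
  qed
  have sum_less: "a + b < u + v" unfolding sum_x using x'(1) by simp
  have bu: "b \<le> u"
  proof (rule ccontr)
    assume av: "\<not> b \<le> u"
    show False
    proof (cases "a < u")
      case True
      then have "v \<le> b" using unlinked[OF ab(1) uvL] av by force
      then show False using len True by simp
    next
      case False
      then have ua: "u \<le> a" by simp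
      define x' where "x' = (a + b) / 2"
      have bv: "b < v" using sum_less ua by simp
      have ax: "a < x'" "x' < b" using ab by (simp_all add: x'_def)
      have "(b - x') * (x' - a) < (v - x') * (x' - u)"
        using ua bv ax by (intro mult_less_le_imp_less) auto
      then have less: "(x' - a) * (b - x') < (x' - u) * (v - x')" by (simp add: mult.commute)
      define h where "h = sqrt ((x' - u) * (v - x'))"
      have "(x' - u) * (v - x') > 0" using ua bv ax by simp
      then have h: "h > 0" "h\<^sup>2 = (x' - u) * (v - x')" by (simp_all add: h_def)
      have R1': "torus_proj (Complex x' y) \<notin> range \<gamma>" if "y > (b - a) / 2" for y
        unfolding x'_def by (rule R1[OF that])
      have "h \<le> (b - a) / 2" by (rule ray_avoids[OF uvL R1' h])
      then have "h\<^sup>2 \<le> ((b - a) / 2)\<^sup>2" using h by (intro power_mono) auto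
      also have "\<dots> = (x' - a) * (b - x')" by (simp add: x'_def power2_eq_square field_simps)
      finally show False using less h by simp
    qed
  qed
  have no_line': "\<not> (c < Y - 3 \<and> Y - 3 < d)" if "(c, d) \<in> L" for c d
    using no_line[OF that, of "- 1"] by simp
  have rational': "c \<noteq> Y - 3 \<and> d \<noteq> Y - 3" if "(c, d) \<in> L" for c d
    using rational_line[OF that, of "- 1"] by simp
  have "b > Y - 3" using x' ab(2) by (simp add: x_def)
  then have aY: "a > Y - 3" using no_line'[OF ab(1)] rational'[OF ab(1)] by auto
  define M where "M = {(- d, - c) | c d. (c, d) \<in> L}"
  have M: "(c, d) \<in> M \<longleftrightarrow> (- d, - c) \<in> L" for c d unfolding M_def by force
  interpret W: winding "3 - Y" Q \<rho> M
  proof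
    show "(3 - Y - 3 - 1 / (Q * (a - (3 - Y))), 3 - Y - 3 - 1 / (Q * (b - (3 - Y)))) \<in> M" if "(a, b) \<in> M" for a b
    proof -
      have "- (3 - Y - 3 - 1 / (Q * (s - (3 - Y)))) = Binv (- s)" for s
      proof -
        have "Q * (- s - (Y - 3)) = - (Q * (s - (3 - Y)))" by (simp add: algebra_simps)
        then show ?thesis unfolding Binv_def by simp
      qed
      then show ?thesis using Binv_L that unfolding M by simp
    qed
    show "\<not> (a < 3 - Y \<and> 3 - Y < b)" if "(a, b) \<in> M" for a b using no_line'[of "- b" "- a"] that unfolding M by auto
    show "a \<noteq> 3 - Y \<and> b \<noteq> 3 - Y" if "(a, b) \<in> M" for a b using rational'[of "- b" "- a"] that unfolding M by auto
  qed (use Q1 rho_gt_1 rho_sq in auto)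
  have v': "W.v = - u" using W.v_def u_eq x_def by linarith
  have ab': "(- b, - a) \<in> M" "W.v \<le> - b" "- b < - a" "- a < 3 - Y"
    using ab bu aY unfolding v' M by auto
  obtain n z w where n: "n > 0" "Re z = (- b + - a) / 2" "Re w = (- b + - a) / 2" "Im z \<ge> (- a - - b) / 2" "Im w \<ge> (- a - - b) / 2"
    "(W.Bc ^^ n) z = w" "z \<noteq> w"
    by (rule W.self_crossing[OF ab'])
  have step: "torus_proj (- cnj (W.Bc s)) = torus_proj (- cnj s)" if "s \<in> uhp" for s
  proof -
    have d: "q1 dvd (p1 - 3 * q1)^2 + 1" using dvd_shift[OF q1(2), of "- 3"] by simp
    have f: "fr (p1 - 3 * q1) q1 = Y - 3" using fr_shift3[OF q1(1), of p1 "- 1"] by (simp add: Y_def)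
    have "- cnj s \<in> uhp" using that by (simp add: uhp_def)
    from torus_proj_half_turn[OF q1(1) d, of 1 "- cnj s", unfolded f Q_def[symmetric]] this
    have "torus_proj (of_real Y - 1 / (of_real Q * (- cnj s - of_real (Y - 3)))) = torus_proj (- cnj s)" by simp
    moreover have "- cnj (W.Bc s) = of_real Y - 1 / (of_real Q * (- cnj s - of_real (Y - 3)))"
    proof -
      have "of_real Q * (- cnj s - of_real (Y - 3)) = - (of_real Q * (cnj s - of_real (3 - Y)))" by (simp add: algebra_simps)
      then show ?thesis unfolding W.Bc_def by simp
    qed
    ultimately show ?thesis by simp
  qed
  have "(W.Bc ^^ m) z \<in> uhp \<and> torus_proj (- cnj ((W.Bc ^^ m) z)) = torus_proj (- cnj z)" for m
  proof (induction m)
    case 0 then show ?case using n(4) ab(2) by (simp add: uhp_def)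
  next
    case (Suc m) then show ?case using step W.Bc_ratio(1) by simp
  qed
  then have "torus_proj (- cnj z) = torus_proj (- cnj w)" using n(6) by metis
  moreover have "- cnj z = Complex ((a + b) / 2) (Im z)" "- cnj w = Complex ((a + b) / 2) (Im w)"
    using n by (simp_all add: complex_eq_iff field_simps)
  ultimately have "Im z = Im w" using R2[of "Im z" "Im w"] n(4,5) by simp
  then show False using n by (simp add: complex_eq_iff)
qed

lemma on_axis:
  assumes ab: "(a, b) \<in> L" "a < b" and R1: "\<And>y. y > (b - a) / 2 \<Longrightarrow> torus_proj (Complex ((a + b) / 2) y) \<notin> range \<gamma>"
    and x': "(a + b) / 2 = x"
  shows "(b - a) / 2 = \<rho>"
proof -
  have "\<rho> \<le> (b - a) / 2"
  proof (rule ray_avoids[OF uvL R1])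
    have "x - u = \<rho>" "v - x = \<rho>" using u_eq v_eq by linarith+
    then show "\<rho>\<^sup>2 = ((a + b) / 2 - u) * (v - (a + b) / 2)" unfolding x' by (simp add: power2_eq_square)
  qed (use rho_gt_1 in auto)
  moreover have "(b - a) / 2 \<le> \<rho>" using length_le[OF ab(1)] by simp
  ultimately show ?thesis by simp
qed

lemma shifted_xrho:
  "normalized_geodesic.x (p1 + (3 * j) * q1) q1 = x + 3 * of_int j"
  "normalized_geodesic.\<rho> (u + 3 * of_int j) (v + 3 * of_int j) = \<rho>"
proof -
  interpret S: normalized_geodesic \<gamma> l "p + (3 * j) * q" q "p1 + (3 * j) * q1" q1 "u + 3 * of_int j" "v + 3 * of_int j"
    by (rule shifted)
  show "normalized_geodesic.x (p1 + (3 * j) * q1) q1 = x + 3 * of_int j"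
    unfolding S.x_def S.Y_def fr_shift3[OF q1(1)] by (simp add: x_def Y_def)
  show "normalized_geodesic.\<rho> (u + 3 * of_int j) (v + 3 * of_int j) = \<rho>"
    unfolding S.\<rho>_def by (simp add: \<rho>_def)
qed

lemma simple_ray_unique:
  assumes ab: "(a, b) \<in> L" "a < b" and R1: "\<And>y. y > (b - a) / 2 \<Longrightarrow> torus_proj (Complex ((a + b) / 2) y) \<notin> range \<gamma>"
    and R2: "\<And>y y'. y \<ge> (b - a) / 2 \<Longrightarrow> y' \<ge> (b - a) / 2 \<Longrightarrow>
       torus_proj (Complex ((a + b) / 2) y) = torus_proj (Complex ((a + b) / 2) y') \<Longrightarrow> y = y'"
  obtains j :: int where "(a + b) / 2 = x + 3 * of_int j" "(b - a) / 2 = \<rho>"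
proof -
  define j where "j = \<lfloor>((a + b) / 2 - (x - 3 / 2)) / 3\<rfloor>"
  interpret S: normalized_geodesic \<gamma> l "p + (3 * j) * q" q "p1 + (3 * j) * q1" q1 "u + 3 * of_int j" "v + 3 * of_int j"
    by (rule shifted)
  have j: "x + 3 * of_int j - 3 / 2 \<le> (a + b) / 2" "(a + b) / 2 \<le> x + 3 * of_int j + 3 / 2"
    using floor_correct[of "((a + b) / 2 - (x - 3 / 2)) / 3"] unfolding j_def by (simp_all add: field_simps)
  have "(a + b) / 2 = x + 3 * of_int j"
    using S.right_of_axis[OF ab R1 R2] S.left_of_axis[OF ab R1 R2] j unfolding shifted_xrho by (metis linorder_neqE_linordered_idom)
  moreover from this have "(b - a) / 2 = \<rho>" using S.on_axis[OF ab R1] unfolding shifted_xrho by blast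
  ultimately show ?thesis by (rule that)
qed

end

section \<open>Orthogeodesics to the cusp and the twist\<close>

lemma pslz_translation:
  assumes "a * d - b * c = 1" "c = 0" "z \<in> uhp"
  shows "pslz a b c d z = z + of_int (a * b)"
proof -
  have "a * d = 1" using assms by simp
  then have "a = 1 \<and> d = 1 \<or> a = -1 \<and> d = -1" by (auto simp: zmult_eq_1_iff)
  then show ?thesis using assms(2,3) by (auto simp: pslz_def moebius_def)
qed

text \<open>For \<open>c \<noteq> 0\<close> the height becomes at most the inverse of the old one.\<close>

lemma high_point_translation:
  assumes det: "a * d - b * c = 1" and z: "Im z \<ge> 1" and w: "Im (pslz a b c d z) > 1"
  shows "c = 0"
proof (rule ccontr)
  assume c: "c \<noteq> 0"
  have zu: "z \<in> uhp" using z by (simp add: uhp_def)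
  define N where "N = (cmod (of_int c * z + of_int d))\<^sup>2"
  have "N = (of_int c * Re z + of_int d)\<^sup>2 + (of_int c * Im z)\<^sup>2" unfolding N_def cmod_power2 by simp
  then have "(of_int c * Im z)\<^sup>2 \<le> N" by simp
  moreover have "1 * (Im z)\<^sup>2 \<le> (of_int c)\<^sup>2 * (Im z)\<^sup>2"
  proof (rule mult_right_mono)
    have "1 \<le> \<bar>c\<bar>" using c by simp
    then have "1 \<le> c\<^sup>2" by (simp add: int_one_le_iff_zero_less)
    then show "1 \<le> (real_of_int c)\<^sup>2" by (metis of_int_1_le_iff of_int_power)
  qed simp
  ultimately have "(Im z)\<^sup>2 \<le> N" by (simp add: power_mult_distrib)
  moreover have "Im z \<le> (Im z)\<^sup>2" using z by (simp add: power2_eq_square)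
  ultimately have "Im z \<le> N" by simp
  have "Im (pslz a b c d z) = Im z / N" using zu by (simp add: pslz_def Im_moebius_int[OF det] N_def)
  also have "\<dots> \<le> 1" using \<open>Im z \<le> N\<close> z by (simp add: divide_le_eq_1)
  finally show False using w by simp
qed

text \<open>Two images of a point that are this high differ by a translation.\<close>

lemma same_height:
  assumes z: "z \<in> uhp" and g: "gam a b c d" and h: "gam a' b' c' d'"
    and 1: "Im (pslz a b c d z) \<ge> 1" and 2: "Im (pslz a' b' c' d' z) > 1"
  shows "Im (pslz a' b' c' d' z) = Im (pslz a b c d z)"
proof -
  define w where "w = pslz a b c d z"
  have w: "w \<in> uhp" using pslz_in_uhp[OF gam_det[OF g] z] by (simp add: w_def)
  have "pslz d (-b) (-c) a w = z"
    unfolding w_def pslz_comp[OF gam_det[OF g] z] using gam_det[OF g] z pslz_id by (simp add: algebra_simps)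
  then have eq: "pslz a' b' c' d' z = pslz (a'*d+b'*(-c)) (a'*(-b)+b'*a) (c'*d+d'*(-c)) (c'*(-b)+d'*a) w"
    using pslz_comp[OF gam_det[OF gam_inv[OF g]] w, of a' b' c' d'] by simp
  note det = gam_det[OF gam_mult[OF h gam_inv[OF g]]]
  have c0: "c'*d+d'*(-c) = 0"
    by (rule high_point_translation[OF det, of w]) (use 1 2 eq in \<open>simp_all add: w_def\<close>)
  have "Im (pslz a' b' c' d' z) = Im w"
    unfolding eq pslz_translation[OF det c0 w] by simp
  then show ?thesis by (simp add: w_def)
qed

lemma semicircle_Im_le: "Im (semicircle u v k t) \<le> \<bar>v - u\<bar> / 2"
proof (rule power2_le_imp_le)
  have "((v - u) / 2)\<^sup>2 - (y - u) * (v - y) = (y - (u + v) / 2)\<^sup>2" for y :: real by (simp add: power2_eq_square field_simps)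
  then have "(y - u) * (v - y) \<le> ((v - u) / 2)\<^sup>2" for y by (metis diff_ge_0_iff_ge zero_le_power2)
  then show "(Im (semicircle u v k t))\<^sup>2 \<le> (\<bar>v - u\<bar> / 2)\<^sup>2"
    unfolding semicircle_circle[symmetric] by (simp add: power_divide)
qed simp

lemma semicircle_derivative:
  "(semicircle u v k has_vector_derivative
     (\<i> * of_real (k * exp t)) * of_real (v - u) / (1 + \<i> * of_real (k * exp t))\<^sup>2) (at t)"
proof -
  define f where "f = (\<lambda>z. (of_real u + of_real v * (\<i> * of_real k * exp z)) / (1 + \<i> * of_real k * exp z))"
  define w where "w = \<i> * of_real k * exp (complex_of_real t)"
  have w: "w = \<i> * of_real (k * exp t)" by (simp add: w_def exp_of_real)
  have nz: "1 + w \<noteq> 0" unfolding w by (rule arc_denom)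
  have "(f has_field_derivative ((of_real v * w) * (1 + w) - (of_real u + of_real v * w) * w) / ((1 + w) * (1 + w))) (at (of_real t))"
    unfolding f_def w_def using nz unfolding w_def by (auto intro!: derivative_eq_intros simp: mult.assoc)
  moreover have "((of_real v * w) * (1 + w) - (of_real u + of_real v * w) * w) / ((1 + w) * (1 + w)) = w * of_real (v - u) / (1 + w)\<^sup>2"
    by (simp add: power2_eq_square algebra_simps)
  ultimately have "(f has_field_derivative w * of_real (v - u) / (1 + w)\<^sup>2) (at (of_real t))" by simp
  from has_vector_derivative_real_field[OF this, of UNIV]
  show ?thesis unfolding f_def semicircle_def w .
qed

lemma vertical_derivative: "(vertical x k 1 has_vector_derivative \<i> * of_real (k * exp t)) (at t within S)"
proof -
  have "((\<lambda>z. of_real x + \<i> * (of_real k * exp z)) has_field_derivative \<i> * (of_real k * exp (of_real t))) (at (of_real t))"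
    by (auto intro!: derivative_eq_intros)
  from has_vector_derivative_real_field[OF this, of S]
  have "((\<lambda>s. of_real x + \<i> * (of_real k * exp (of_real s))) has_vector_derivative \<i> * of_real (k * exp t)) (at t within S)"
    by (simp add: exp_of_real)
  moreover have "vertical x k 1 = (\<lambda>s. of_real x + \<i> * (of_real k * exp (of_real s)))"
    by (simp add: fun_eq_iff vertical_def exp_of_real)
  ultimately show ?thesis by (simp only:)
qed

text \<open>Move a point of the ray in a cusp neighbourhood above the height \<open>1\<close>. From then on the ray stays above this height,
  because all high representatives of a point have the same height. As it enters every cusp neighbourhood,
  its height is unbounded, and it is a vertical ray.\<close>

lemma ray_to_cusp:
  assumes r: "hgeodesic_on {0..} r"
    and cusp: "\<And>h. eventually (\<lambda>t. torus_proj (r t) \<in> cusp_nbhd h) at_top"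
  obtains a b c d x k where "gam a b c d" "k > 0" "\<forall>t\<ge>0. pslz a b c d (r t) = vertical x k 1 t"
proof -
  have ru: "r t \<in> uhp" if "t \<ge> 0" for t using r that by (auto simp: hgeodesic_on_def)
  have P: "\<exists>T\<ge>0. \<forall>t\<ge>T. \<exists>a b c d. gam a b c d \<and> Im (pslz a b c d (r t)) > h" for h
  proof -
    obtain T where T: "\<And>t. t \<ge> T \<Longrightarrow> torus_proj (r t) \<in> cusp_nbhd h"
      using cusp[of h] unfolding eventually_at_top_linorder by blast
    have "\<exists>a b c d. gam a b c d \<and> Im (pslz a b c d (r t)) > h" if "t \<ge> max 0 T" for t
    proof -
      have t: "torus_proj (r t) \<in> cusp_nbhd h" "t \<ge> 0" using T that by auto
      then obtain z where z: "torus_proj (r t) = torus_proj z" "z \<in> uhp" "h < Im z" by (auto simp: cusp_nbhd_def)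
      then show ?thesis using torus_proj_eq_iff[OF ru[OF t(2)] z(2)] by blast
    qed
    then show ?thesis by (intro exI[of _ "max 0 T"]) auto
  qed
  obtain T where T: "T \<ge> 0" "\<And>t. t \<ge> T \<Longrightarrow> \<exists>a b c d. gam a b c d \<and> Im (pslz a b c d (r t)) > 1" using P[of 1] by blast
  obtain a b c d where g: "gam a b c d" and gT: "Im (pslz a b c d (r T)) > 1" using T(2)[of T] by blast
  have "hgeodesic_on {0..} (\<lambda>t. pslz a b c d (r t))" by (rule hgeodesic_pslz[OF gam_det[OF g] r])
  then obtain F where F: "geodesic_form F" "\<And>t. t \<in> {0..} \<Longrightarrow> pslz a b c d (r t) = F t"
    using hgeodesic_form[of "{0..}" _ 0 1] by auto
  have cont: "continuous_on S (\<lambda>t. Im (F t))" for S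
    using F(1) unfolding geodesic_form_def
  proof (elim disjE exE conjE)
    fix u v k assume "F = semicircle u v k"
    moreover have "1 + (k * exp t)\<^sup>2 \<noteq> 0" for t :: real by (metis add_pos_nonneg less_irrefl zero_le_power2 zero_less_one)
    ultimately show ?thesis unfolding semicircle_Complex by (auto intro!: continuous_intros)
  qed (auto simp: vertical_def intro!: continuous_intros)
  have high: "Im (F t) > 1" if t: "t \<ge> T" for t
  proof (rule ccontr)
    assume "\<not> Im (F t) > 1"
    then have "Im (F t) \<le> 1" "1 \<le> Im (F T)" using gT F(2)[of T] T(1) by auto
    then obtain s where s: "s \<ge> T" "Im (F s) = 1" using IVT2'[of "\<lambda>t. Im (F t)" t 1 T] cont t by auto
    obtain a' b' c' d' where h: "gam a' b' c' d'" "Im (pslz a' b' c' d' (r s)) > 1" using T(2)[OF s(1)] by blast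
    have e: "pslz a b c d (r s) = F s" and u: "r s \<in> uhp" using F(2)[of s] ru[of s] s(1) T(1) by auto
    show False using same_height[OF u g h(1) _ h(2)] h(2) s(2) unfolding e by simp
  qed
  have unb: "\<exists>t\<ge>0. Im (F t) > h" for h
  proof -
    obtain T' where T': "T' \<ge> 0" "\<And>t. t \<ge> T' \<Longrightarrow> \<exists>a b c d. gam a b c d \<and> Im (pslz a b c d (r t)) > max 1 h" using P[of "max 1 h"] by blast
    define t where "t = max T T'"
    obtain a' b' c' d' where h: "gam a' b' c' d'" "Im (pslz a' b' c' d' (r t)) > max 1 h" using T'(2)[of t] by (auto simp: t_def)
    have t: "t \<ge> 0" "t \<ge> T" using T(1) by (auto simp: t_def)
    have e: "pslz a b c d (r t) = F t" and u: "r t \<in> uhp" using F(2)[of t] ru[of t] t by auto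
    have "Im (F t) > h" using same_height[OF u g h(1)] h(2) high[OF t(2)] unfolding e by simp
    then show ?thesis using t by blast
  qed
  from F(1) show ?thesis unfolding geodesic_form_def
  proof (elim disjE exE conjE)
    fix u v k assume "F = semicircle u v k"
    then show ?thesis using unb[of "\<bar>v - u\<bar> / 2"] semicircle_Im_le[of u v k] by (auto simp: not_less[symmetric])
  next
    fix x k s assume k: "k > 0" and s: "s = 1" and "F = vertical x k s"
    then show ?thesis using that[OF g k, of x] F(2) by simp
  next
    fix x k s assume k: "k > 0" and s: "s = - 1" and "F = vertical x k s"
    then have "Im (F t) \<le> k" if "t \<ge> 0" for t using that by (simp add: vertical_def)
    then show ?thesis using unb[of k] by (auto simp: not_less[symmetric])
  qed
qed

lemma moebius_derivative:
  assumes "a * d - b * c = 1" "z \<in> uhp"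
  shows "\<exists>D. (moebius (of_int a) (of_int b) (of_int c) (of_int d) has_field_derivative D) (at z)"
proof -
  have nz: "of_int c * z + of_int d \<noteq> 0" using denom_uhp_int[OF _ assms(1), of z] assms(2) by (simp add: uhp_def)
  have "((\<lambda>z. (of_int a * z + of_int b) / (of_int c * z + of_int d)) has_field_derivative
      (of_int a * (of_int c * z + of_int d) - (of_int a * z + of_int b) * of_int c) / ((of_int c * z + of_int d) * (of_int c * z + of_int d))) (at z)"
    using nz by (auto intro!: derivative_eq_intros)
  then show ?thesis unfolding moebius_def by blast
qed

context normalized_geodesic
begin

text \<open>The translate by \<open>3 j\<close> of the axis is a lift, oriented from left to right for \<open>\<sigma> = 1\<close> and from right to left for
  \<open>\<sigma> = - 1\<close>. In these cases the upward normal at its top is on the left, respectively right, side.\<close>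

definition over :: "real \<Rightarrow> int \<Rightarrow> bool" where
  "over \<sigma> j \<longleftrightarrow> (x + 3 * of_int j - \<sigma> * \<rho>, x + 3 * of_int j + \<sigma> * \<rho>) \<in> ends"

definition top :: "int \<Rightarrow> complex" where "top j = Complex (x + 3 * of_int j) \<rho>"

lemma top_uhp: "top j \<in> uhp" using rho_gt_1 by (simp add: top_def uhp_def)

lemma ends_half_turn:
  assumes ab: "(a, b) \<in> ends" and pq: "q' > 0" "q' dvd p'^2 + 1" "odd n"
  shows "(of_int (3 * n) + half_turn p' q' a, of_int (3 * n) + half_turn p' q' b) \<in> ends"
proof -
  have L: "(a, b) \<in> L" using ab by (simp add: L_def)
  show ?thesis
    using ends_pslz[OF ab gam_half_turn[OF pq(2,3) refl]]
    unfolding rmob_half_turn[OF pq(1,2) refl irrational[OF L], of "3 * n"]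
      rmob_half_turn[OF pq(1,2) refl irrational2[OF L], of "3 * n"] .
qed

text \<open>This is where the hyperelliptic involution reverses the orientation.\<close>

lemma over_flip:
  assumes "over \<sigma> j" "\<sigma> = 1 \<or> \<sigma> = - 1" "odd n"
  shows "over (- \<sigma>) (j + n)"
proof -
  have uv: "x - \<rho> = u" "x + \<rho> = v" by (rule u_eq[symmetric]) (rule v_eq[symmetric])
  have sw: "half_turn p q (x - \<sigma> * \<rho>) = x + \<sigma> * \<rho>" "half_turn p q (x + \<sigma> * \<rho>) = x - \<sigma> * \<rho>"
    using assms(2) swap uv by auto
  have s: "half_turn (p + (3 * j) * q) q (x + 3 * of_int j + y) = 3 * of_int j + half_turn p q (x + y)" for y
    unfolding half_turn_shift[OF q(1)] by (simp add: algebra_simps)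
  have s1: "half_turn (p + (3 * j) * q) q (x + 3 * of_int j - \<sigma> * \<rho>) = 3 * of_int j + (x + \<sigma> * \<rho>)"
    using s[of "- (\<sigma> * \<rho>)"] sw(1) by simp
  have s2: "half_turn (p + (3 * j) * q) q (x + 3 * of_int j + \<sigma> * \<rho>) = 3 * of_int j + (x - \<sigma> * \<rho>)"
    using s[of "\<sigma> * \<rho>"] sw(2) by simp
  have e1: "of_int (3 * n) + (3 * of_int j + (x + \<sigma> * \<rho>)) = x + 3 * of_int (j + n) - (- \<sigma>) * \<rho>" by simp
  have e2: "of_int (3 * n) + (3 * of_int j + (x - \<sigma> * \<rho>)) = x + 3 * of_int (j + n) + (- \<sigma>) * \<rho>" by simp
  from ends_half_turn[OF assms(1)[unfolded over_def] q(1) dvd_shift[OF q(2)] assms(3), of "3 * j"]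
  show ?thesis unfolding s1 s2 e1 e2 over_def .
qed

lemma over_conflict:
  assumes "over \<sigma> j" "over (- \<sigma>) j"
  shows False
proof -
  obtain k where k: "k * ((x + 3 * of_int j + \<sigma> * \<rho>) - (x + 3 * of_int j - \<sigma> * \<rho>)) > 0"
    "lifts_to \<gamma> (semicircle (x + 3 * of_int j - \<sigma> * \<rho>) (x + 3 * of_int j + \<sigma> * \<rho>) k)"
    using assms(1) unfolding over_def ends_def by blast
  have "(x + 3 * of_int j + \<sigma> * \<rho>, x + 3 * of_int j - \<sigma> * \<rho>) \<in> ends"
    using assms(2) by (simp add: over_def)
  then obtain k' where k': "k' * ((x + 3 * of_int j - \<sigma> * \<rho>) - (x + 3 * of_int j + \<sigma> * \<rho>)) > 0"
    "lifts_to \<gamma> (semicircle (x + 3 * of_int j + \<sigma> * \<rho>) (x + 3 * of_int j - \<sigma> * \<rho>) k')"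
    unfolding ends_def by blast
  show False by (rule opposite_lifts[OF k k'])
qed

lemma over_exists:
  assumes "\<sigma> = 1 \<or> \<sigma> = - 1"
  shows "\<exists>j. over \<sigma> j"
proof -
  have uv: "x - \<rho> = u" "x + \<rho> = v" by (rule u_eq[symmetric]) (rule v_eq[symmetric])
  have "(u, v) \<in> ends \<or> (v, u) \<in> ends" using uvL by (auto simp: L_def)
  then have "over 1 0 \<or> over (- 1) 0" using uv by (simp add: over_def)
  then show ?thesis using over_flip[of 1 0 1] over_flip[of "- 1" 0 1] assms by auto
qed

text \<open>The orientations agree only for an even difference of the indices, and translations by multiples of \<open>6\<close> are in \<open>\<Gamma>\<close>.\<close>

lemma torus_proj_top:
  assumes "over \<sigma> i" "over \<sigma> j" "\<sigma> = 1 \<or> \<sigma> = - 1"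
  shows "torus_proj (top i) = torus_proj (top j)"
proof -
  have "even (j - i)"
  proof (rule ccontr)
    assume "odd (j - i)"
    from over_flip[OF assms(1,3) this] show False using over_conflict[OF assms(2)] by simp
  qed
  then have g: "gam 1 (3 * (j - i)) 0 1" by (simp add: gam_def)
  have "pslz 1 (3 * (j - i)) 0 1 (top i) = top j"
    unfolding pslz_translation[OF gam_det[OF g] refl top_uhp] by (simp add: top_def complex_eq_iff)
  then show ?thesis using torus_proj_pslz[OF g top_uhp] by metis
qed

text \<open>An element of \<open>\<Gamma>\<close> between points above height \<open>1\<close> is a translation by a multiple of \<open>6\<close>. It
  preserves orientations, so it cannot relate tops of opposite orientation.\<close>

lemma opposite_tops:
  assumes i: "over 1 i" and j: "over (- 1) j"
  shows "torus_proj (top i) \<noteq> torus_proj (top j)"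
proof
  assume "torus_proj (top i) = torus_proj (top j)"
  then obtain a b c d where g: "gam a b c d" and e: "top j = pslz a b c d (top i)"
    using torus_proj_eq_iff[OF top_uhp top_uhp] by blast
  have "Im (top i) \<ge> 1" "Im (top j) > 1" using rho_gt_1 by (simp_all add: top_def)
  then have c: "c = 0" using high_point_translation[OF gam_det[OF g], of "top i"] e by simp
  have "top j = top i + of_int (a * b)" unfolding e by (rule pslz_translation[OF gam_det[OF g] c top_uhp])
  then have "real_of_int (3 * j) = of_int (3 * i + a * b)" by (simp add: top_def complex_eq_iff)
  then have "3 * j = 3 * i + a * b" by (simp only: of_int_eq_iff)
  moreover have "even b" using g c by (simp add: gam_def)
  ultimately have "even (3 * (j - i))" by simp
  then have "odd (j - i - 1)" by simp
  from over_flip[OF over_flip[OF i, of 1] _ this] have "over 1 j" by simp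
  then show False using over_conflict[of 1 j] j by simp
qed

text \<open>The vertical ray above the top is embedded, because \<open>\<Gamma>\<close> identifies points above height \<open>1\<close> only by translations. It meets
  the closed geodesic only in its foot, because it is above all lifts.\<close>

lemma orthogeodesic_exists:
  assumes ov: "over \<sigma> j" and \<sigma>: "\<sigma> = 1 \<or> \<sigma> = - 1"
  shows "\<exists>s r. simple_cusp_orthogeodesic \<gamma> (\<i> * of_real \<sigma>) s r \<and> \<gamma> s = torus_proj (top j)"
proof -
  define a where "a = x + 3 * of_int j - \<sigma> * \<rho>"
  define b where "b = x + 3 * of_int j + \<sigma> * \<rho>"
  obtain k where k: "k * (b - a) > 0" and c: "lifts_to \<gamma> (semicircle a b k)"
    using ov unfolding over_def ends_def a_def[symmetric] b_def[symmetric] by blast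
  have ba: "b - a = 2 * \<sigma> * \<rho>" by (simp add: a_def b_def)
  have "(k * \<sigma>) * (2 * \<rho>) > 0" using k unfolding ba by (simp add: ac_simps)
  moreover have "2 * \<rho> > 0" using rho_gt_1 by simp
  ultimately have "k * \<sigma> > 0" by (rule zero_less_mult_pos2)
  \<comment> \<open>The time at which the lift is at its top.\<close>
  define s where "s = - ln (k * \<sigma>)"
  have ks: "k * exp s = \<sigma>"
    using \<open>k * \<sigma> > 0\<close> \<sigma> by (auto simp: s_def exp_minus)
  have cs: "semicircle a b k s = top j"
    unfolding semicircle_Complex ks using \<sigma> by (auto simp: top_def a_def b_def)
  define r where "r = vertical (x + 3 * of_int j) \<rho> 1"
  have rt: "r t = Complex (x + 3 * of_int j) (\<rho> * exp t)" for t by (simp add: r_def vertical_def complex_eq_iff)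
  have r0: "r 0 = semicircle a b k s" unfolding cs rt by (simp add: top_def)
  have ru: "r t \<in> uhp" for t using rho_gt_1 by (simp add: rt uhp_def)
  have high: "Im (r t) > 1" if "t \<ge> 0" for t
  proof -
    have "1 \<le> exp t" using that by simp
    then have "\<rho> * 1 \<le> \<rho> * exp t" using rho_gt_1 by (intro mult_left_mono) auto
    then show ?thesis unfolding rt complex.sel using rho_gt_1 by linarith
  qed
  define V where "V = (\<i> * of_real \<sigma>) * of_real (b - a) / (1 + \<i> * of_real \<sigma>)\<^sup>2"
  have dV: "(semicircle a b k has_vector_derivative V) (at s)"
    using semicircle_derivative[of a b k s] unfolding ks V_def .
  have V: "V = of_real (\<sigma> * \<rho>)"
    using \<sigma>
  proof
    assume s: "\<sigma> = 1"
    have "(1 + \<i>)\<^sup>2 = 2 * \<i>" by (simp add: power2_eq_square algebra_simps)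
    then show ?thesis unfolding V_def ba s by simp
  next
    assume s: "\<sigma> = - 1"
    have "(1 - \<i>)\<^sup>2 = - 2 * \<i>" by (simp add: power2_eq_square algebra_simps)
    then show ?thesis unfolding V_def ba s by simp
  qed
  have dr: "(r has_vector_derivative \<i> * of_real \<sigma> * V) (at 0 within {0..})"
  proof -
    have "\<i> * of_real \<sigma> * V = \<i> * of_real (\<rho> * exp 0)" unfolding V using \<sigma> by auto
    then show ?thesis using vertical_derivative[of "x + 3 * of_int j" \<rho> 0 "{0..}"] by (simp only: r_def)
  qed
  have "simple_cusp_orthogeodesic \<gamma> (\<i> * of_real \<sigma>) s r"
    unfolding simple_cusp_orthogeodesic_def
  proof (intro conjI allI impI exI)
    show "hgeodesic_on {0..} r" unfolding r_def using rho_gt_1 by (intro hgeodesic_vertical) simp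
    show "lifts_to \<gamma> (semicircle a b k)" by (rule c)
    show "r 0 = semicircle a b k s" by (rule r0)
    show "(semicircle a b k has_vector_derivative V) (at s)" by (rule dV)
    show "(r has_vector_derivative \<i> * of_real \<sigma> * V) (at 0 within {0..})" by (rule dr)
    show "eventually (\<lambda>t. torus_proj (r t) \<in> cusp_nbhd h) at_top" for h
      unfolding eventually_at_top_linorder
    proof (intro exI allI impI)
      fix t assume t: "t \<ge> max 0 h"
      then have "h < exp t" using exp_ge_add_one_self[of t] by linarith
      also have "exp t \<le> \<rho> * exp t" using rho_gt_1 by simp
      finally show "torus_proj (r t) \<in> cusp_nbhd h" unfolding cusp_nbhd_def using ru[of t] by (intro imageI) (simp add: rt)
    qed
    show "inj_on (\<lambda>t. torus_proj (r t)) {0..}"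
    proof (rule inj_onI)
      fix t t' assume t: "t \<in> {0..}" "t' \<in> {0..}" "torus_proj (r t) = torus_proj (r t')"
      then obtain e f g h where gm: "gam e f g h" and e: "r t' = pslz e f g h (r t)"
        using torus_proj_eq_iff[OF ru ru] by blast
      have "g = 0" using high_point_translation[OF gam_det[OF gm], of "r t"] high[of t] high[of t'] t e by simp
      then have "Im (r t') = Im (r t)" unfolding e using pslz_translation[OF gam_det[OF gm] _ ru] by simp
      then show "t = t'" using rho_gt_1 by (simp add: rt)
    qed
    show "torus_proj (r t) \<notin> range \<gamma>" if "t > 0" for t
    proof
      assume "torus_proj (r t) \<in> range \<gamma>"
      then obtain t' where "torus_proj (r t) = \<gamma> t'" by blast
      from on_lift_height[OF this ru] have "\<rho> * exp t \<le> \<rho> * 1" by (simp add: rt)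
      then show False using that rho_gt_1 by (simp add: mult_le_cancel_left)
    qed
  qed
  moreover have "\<gamma> s = torus_proj (top j)" using lift_proj[OF c, of s] unfolding cs by simp
  ultimately show ?thesis by blast
qed

text \<open>In vertical position the derivative condition says that the ray starts at the top of a lift \<open>(a, b)\<close> whose
  orientation is given by \<open>\<sigma>\<close>; \<open>simple_ray_unique\<close> identifies this lift as a translate of the axis.\<close>

lemma orthogeodesic_unique:
  assumes o: "simple_cusp_orthogeodesic \<gamma> (\<i> * of_real \<sigma>) s r" and \<sigma>: "\<sigma> = 1 \<or> \<sigma> = - 1"
  shows "\<exists>j. over \<sigma> j \<and> \<gamma> s = torus_proj (top j)"
proof -
  note o' = o[unfolded simple_cusp_orthogeodesic_def]
  have hr: "hgeodesic_on {0..} r" using o' by (elim conjE)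
  have cusp: "\<forall>h. eventually (\<lambda>t. torus_proj (r t) \<in> cusp_nbhd h) at_top" using o' by (elim conjE)
  have inj: "inj_on (\<lambda>t. torus_proj (r t)) {0..}" using o' by (elim conjE)
  have out: "\<forall>t>0. torus_proj (r t) \<notin> range \<gamma>" using o' by (elim conjE)
  have "\<exists>c v. lifts_to \<gamma> c \<and> r 0 = c s \<and> (c has_vector_derivative v) (at s) \<and>
        (r has_vector_derivative \<i> * of_real \<sigma> * v) (at 0 within {0..})" using o' by (elim conjE)
  then obtain c V where c: "lifts_to \<gamma> c" "r 0 = c s"
    and dc: "(c has_vector_derivative V) (at s)" and dr: "(r has_vector_derivative \<i> * of_real \<sigma> * V) (at 0 within {0..})"
    by (elim exE conjE)
  obtain e f g h x' k where gm: "gam e f g h" and k: "k > 0" and rv': "\<forall>t\<ge>0. pslz e f g h (r t) = vertical x' k 1 t"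
    by (rule ray_to_cusp[OF hr cusp[rule_format]])
  note rv = rv'[rule_format]
  have ru: "r t \<in> uhp" if "t \<ge> 0" for t using hr that by (auto simp: hgeodesic_on_def)
  have cu: "c t \<in> uhp" for t by (rule lift_uhp[OF c(1)])
  let ?M = "moebius (of_int e) (of_int f) (of_int g) (of_int h) :: complex \<Rightarrow> complex"
  have lift': "lifts_to \<gamma> (\<lambda>t. pslz e f g h (c t))" by (rule lift_pslz[OF c(1) gm])
  then obtain a b m where m: "m * (b - a) > 0" and sc: "(\<lambda>t. pslz e f g h (c t)) = semicircle a b m"
    by (rule lift_semicircle)
  have ends: "(a, b) \<in> ends" using m lift' unfolding sc ends_def by blast
  obtain D where D: "(?M has_field_derivative D) (at (c s))" using moebius_derivative[OF gam_det[OF gm] cu] by blast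
  have Mc: "?M \<circ> c = semicircle a b m"
    unfolding sc[symmetric] using cu by (auto simp: pslz_def)
  have d1: "(semicircle a b m has_vector_derivative V * D) (at s)"
    using field_vector_diff_chain_at[OF dc D] unfolding Mc .
  have D': "(?M has_field_derivative D) (at (r 0) within r ` {0..})"
    unfolding c(2) by (rule has_field_derivative_at_within[OF D])
  have d2: "((?M \<circ> r) has_vector_derivative \<i> * of_real \<sigma> * V * D) (at 0 within {0..})"
    by (rule field_vector_diff_chain_within[OF dr D'])
  have Mr: "(?M \<circ> r) t = vertical x' k 1 t" if "t \<in> {0..}" for t
    using rv[of t] ru[of t] that by (simp add: pslz_def)
  have d3: "(vertical x' k 1 has_vector_derivative \<i> * of_real \<sigma> * V * D) (at 0 within {0..})"
    by (rule has_vector_derivative_transform[OF _ _ d2]) (use Mr in auto)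
  have nb: "at (0::real) within {0..} \<noteq> bot" unfolding at_within_Ici_at_right by simp
  have e1: "\<i> * of_real \<sigma> * V * D = \<i> * of_real k"
    using vector_derivative_unique_within[OF nb d3 vertical_derivative] by simp
  define K where "K = m * exp s"
  have e2: "V * D = \<i> * of_real K * of_real (b - a) / (1 + \<i> * of_real K)\<^sup>2"
    using vector_derivative_unique_at[OF d1 semicircle_derivative] by (simp add: K_def)
  have "of_real \<sigma> * (V * D) = of_real k" using e1 by (simp add: mult.assoc)
  then have "of_real \<sigma> * (of_real \<sigma> * (V * D)) = of_real \<sigma> * of_real k" by simp
  then have "of_real (\<sigma> * \<sigma>) * (V * D) = of_real (\<sigma> * k)" by (simp only: of_real_mult mult.assoc)
  moreover have "\<sigma> * \<sigma> = 1" using \<sigma> by auto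
  ultimately have "V * D = of_real (\<sigma> * k)" by (simp only: of_real_1 mult_1_left)
  then have "\<i> * of_real K * of_real (b - a) = of_real (\<sigma> * k) * (1 + \<i> * of_real K)\<^sup>2"
    using e2 arc_denom[of K] by (simp add: divide_eq_eq)
  also have "(1 + \<i> * of_real K)\<^sup>2 = Complex (1 - K\<^sup>2) (2 * K)" by (simp add: complex_eq_iff power2_eq_square)
  finally have eq: "\<i> * of_real K * of_real (b - a) = of_real (\<sigma> * k) * Complex (1 - K\<^sup>2) (2 * K)" .
  have re: "\<sigma> * k * (1 - K\<^sup>2) = 0" using arg_cong[OF eq, of Re] by simp
  have im: "K * (b - a) = \<sigma> * k * (2 * K)" using arg_cong[OF eq, of Im] by simp
  have K1: "K\<^sup>2 = 1" using re k \<sigma> by auto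
  then have "K \<noteq> 0" by auto
  then have ba: "b - a = 2 * \<sigma> * k" using im by simp
  have "pslz e f g h (c s) = vertical x' k 1 0" using rv[of 0] c(2) by simp
  then have "semicircle a b m s = vertical x' k 1 0" using sc by metis
  then have "Re (semicircle a b m s) = x'" by (simp add: vertical_def)
  then have ab: "a + b = 2 * x'"
    unfolding semicircle_Complex K_def[symmetric] K1 by simp
  define lo where "lo = x' - k"
  define hi where "hi = x' + k"
  have "(a = lo \<and> b = hi) \<or> (a = hi \<and> b = lo)"
    using \<sigma>
  proof
    assume "\<sigma> = 1" then show ?thesis using ba ab by (simp add: lo_def hi_def)
  next
    assume "\<sigma> = - 1" then show ?thesis using ba ab by (simp add: lo_def hi_def)
  qed
  then have L: "(lo, hi) \<in> L" using ends by (auto simp: L_def)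
  have mid: "(lo + hi) / 2 = x'" "(hi - lo) / 2 = k" by (simp_all add: lo_def hi_def)
  have ray: "\<exists>t\<ge>0. torus_proj (Complex x' y) = torus_proj (r t) \<and> y = k * exp t" if "y \<ge> k" for y
  proof -
    define t where "t = ln (y / k)"
    have t: "t \<ge> 0" "k * exp t = y" using that k by (simp_all add: t_def)
    have "pslz e f g h (r t) = Complex x' y" using rv[OF t(1)] t(2) by (simp add: vertical_def complex_eq_iff)
    then show ?thesis using torus_proj_pslz[OF gm ru[OF t(1)]] t by metis
  qed
  have R1: "torus_proj (Complex ((lo + hi) / 2) y) \<notin> range \<gamma>" if "y > (hi - lo) / 2" for y
  proof -
    have yk: "y > k" using that mid by simp
    then obtain t where t: "t \<ge> 0" "torus_proj (Complex x' y) = torus_proj (r t)" "y = k * exp t" using ray[of y] by auto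
    have "t > 0" using t(1,3) yk by (cases "t = 0") auto
    then show ?thesis using out[rule_format, of t] t(2) mid by simp
  qed
  have R2: "y = y'" if y: "y \<ge> (hi - lo) / 2" "y' \<ge> (hi - lo) / 2"
    and eq: "torus_proj (Complex ((lo + hi) / 2) y) = torus_proj (Complex ((lo + hi) / 2) y')" for y y'
  proof -
    obtain t where t: "t \<ge> 0" "torus_proj (Complex x' y) = torus_proj (r t)" "y = k * exp t" using ray[of y] y mid by auto
    obtain t' where t': "t' \<ge> 0" "torus_proj (Complex x' y') = torus_proj (r t')" "y' = k * exp t'" using ray[of y'] y mid by auto
    have "t = t'" using inj_onD[OF inj, of t t'] t t' eq mid by simp
    then show ?thesis using t t' by simp
  qed
  have "lo < hi" using k by (simp add: lo_def hi_def)
  then obtain j :: int where j: "(lo + hi) / 2 = x + 3 * of_int j" "(hi - lo) / 2 = \<rho>"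
    using simple_ray_unique[OF L _ R1 R2] by blast
  have x': "x' = x + 3 * of_int j" and k\<rho>: "k = \<rho>" using j mid by simp_all
  have "a = x + 3 * of_int j - \<sigma> * \<rho>" "b = x + 3 * of_int j + \<sigma> * \<rho>"
    using ab ba unfolding x' k\<rho> by simp_all
  then have "over \<sigma> j" using ends by (simp add: over_def)
  moreover have "\<gamma> s = torus_proj (top j)"
  proof -
    have "\<gamma> s = torus_proj (pslz e f g h (c s))" using lift_proj[OF lift', of s] by simp
    also have "pslz e f g h (c s) = top j"
      using rv[of 0] c(2) by (simp add: vertical_def top_def complex_eq_iff x' k\<rho>)
    finally show ?thesis .
  qed
  ultimately show ?thesis by blast
qed

lemma feet:
  shows "\<exists>j. over 1 j \<and> left_foot \<gamma> = torus_proj (top j)" "\<exists>j. over (- 1) j \<and> right_foot \<gamma> = torus_proj (top j)"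
proof -
  have the: "\<exists>j. over \<sigma> j \<and> (THE A. \<exists>s r. simple_cusp_orthogeodesic \<gamma> (\<i> * of_real \<sigma>) s r \<and> A = \<gamma> s) = torus_proj (top j)"
    if \<sigma>: "\<sigma> = 1 \<or> \<sigma> = - 1" for \<sigma>
  proof -
    obtain j where j: "over \<sigma> j" using over_exists[OF \<sigma>] by blast
    have "(THE A. \<exists>s r. simple_cusp_orthogeodesic \<gamma> (\<i> * of_real \<sigma>) s r \<and> A = \<gamma> s) = torus_proj (top j)"
    proof (rule the_equality)
      show "\<exists>s r. simple_cusp_orthogeodesic \<gamma> (\<i> * of_real \<sigma>) s r \<and> torus_proj (top j) = \<gamma> s"
        using orthogeodesic_exists[OF j \<sigma>] by metis
      fix A assume "\<exists>s r. simple_cusp_orthogeodesic \<gamma> (\<i> * of_real \<sigma>) s r \<and> A = \<gamma> s"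
      then show "A = torus_proj (top j)"
        using orthogeodesic_unique[OF _ \<sigma>] torus_proj_top[OF _ j \<sigma>] by metis
    qed
    then show ?thesis using j by blast
  qed
  show "\<exists>j. over 1 j \<and> left_foot \<gamma> = torus_proj (top j)" using the[of 1] by (simp add: left_foot_def)
  show "\<exists>j. over (- 1) j \<and> right_foot \<gamma> = torus_proj (top j)" using the[of "- 1"] by (simp add: right_foot_def)
qed

lemma feet_differ: "left_foot \<gamma> \<noteq> right_foot \<gamma>"
  using feet opposite_tops by metis

lemma feet_in_range: "left_foot \<gamma> \<in> range \<gamma>" "right_foot \<gamma> \<in> range \<gamma>"
proof -
  obtain j where "over 1 j" "left_foot \<gamma> = torus_proj (top j)" using feet(1) by blast
  then show "left_foot \<gamma> \<in> range \<gamma>" using orthogeodesic_exists[of 1 j] by (metis rangeI)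
  obtain j where "over (- 1) j" "right_foot \<gamma> = torus_proj (top j)" using feet(2) by blast
  then show "right_foot \<gamma> \<in> range \<gamma>" using orthogeodesic_exists[of "- 1" j] by (metis rangeI)
qed

end

context closed_geodesic
begin

lemma geodesic_length_eq: "geodesic_length \<gamma> = l"
  unfolding geodesic_length_def
proof (rule Least_equality)
  show "0 < l \<and> (\<forall>t. \<gamma> (t + l) = \<gamma> t)" using l_pos period by blast
  fix y assume y: "0 < y \<and> (\<forall>t. \<gamma> (t + y) = \<gamma> t)"
  show "l \<le> y"
  proof (rule ccontr)
    assume "\<not> l \<le> y"
    then have "y \<in> {0..<l}" "0 \<in> {0..<l}" using y l_pos by auto
    moreover have "\<gamma> y = \<gamma> 0" using y by (metis add_0)
    ultimately have "y = 0" using simple by (metis inj_onD)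
    then show False using y by simp
  qed
qed

lemma normalized:
  "\<exists>p q p1 q1 u v. normalized_geodesic \<gamma> l p q p1 q1 u v"
proof -
  obtain p0 q0 p1 q1 u v where "q0 > 0" "q0 dvd p0^2 + 1" "q1 > 0" "q1 dvd p1^2 + 1"
    "(u, v) \<in> L" "u < v" "u + v = 2 * fr p1 q1 - 3" "u * v = fr p1 q1 * (fr p1 q1 - 3) + 1 / (of_int q1)\<^sup>2"
    "half_turn p0 q0 u = v" "half_turn p0 q0 v = u"
    by (rule core_data)
  then have "normalized_geodesic \<gamma> l p0 q0 p1 q1 u v" by unfold_locales
  then show ?thesis by blast
qed

text \<open>The feet lie on the geodesic and are different, so the least distance from one to the other exists and is positive.\<close>

lemma absolute_twist_nonzero: "absolute_twist \<gamma> \<noteq> 0"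
proof -
  obtain p q p1 q1 u v where "normalized_geodesic \<gamma> l p q p1 q1 u v" using normalized by blast
  then interpret normalized_geodesic \<gamma> l p q p1 q1 u v .
  obtain a where a: "left_foot \<gamma> = \<gamma> a" using feet_in_range(1) by blast
  obtain b where b: "right_foot \<gamma> = \<gamma> b" using feet_in_range(2) by blast
  \<comment> \<open>The remainder of the time difference modulo the period is the twist.\<close>
  define n where "n = \<lfloor>(b - a) / l\<rfloor>"
  define t where "t = b - a - of_int n * l"
  have n1: "of_int n * l \<le> b - a"
    using of_int_floor_le[of "(b - a) / l"] unfolding pos_le_divide_eq[OF l_pos] n_def .
  have "b - a < (of_int n + 1) * l"
    using floor_correct[of "(b - a) / l"] unfolding pos_divide_less_eq[OF l_pos] n_def by simp
  then have t: "0 \<le> t" "t < l" using n1 by (simp_all add: t_def algebra_simps)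
  have "\<gamma> (a + t) = \<gamma> b" using period_int[of b "- n"] by (simp add: t_def)
  have "absolute_twist \<gamma> = t"
    unfolding absolute_twist_def a b
  proof (rule Least_equality)
    show "0 \<le> t \<and> (\<exists>s. \<gamma> s = \<gamma> a \<and> \<gamma> (s + t) = \<gamma> b)" using t \<open>\<gamma> (a + t) = \<gamma> b\<close> by blast
    fix y assume y: "0 \<le> y \<and> (\<exists>s. \<gamma> s = \<gamma> a \<and> \<gamma> (s + y) = \<gamma> b)"
    then obtain s where s: "\<gamma> s = \<gamma> a" "\<gamma> (s + y) = \<gamma> b" by blast
    obtain i :: int where i: "a = s + of_int i * l" using s(1) same_point_iff by blast
    obtain k :: int where k: "b = s + y + of_int k * l" using s(2) same_point_iff by blast
    have yt: "y = t + of_int (i - k + n) * l" by (simp add: t_def i k algebra_simps)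
    show "t \<le> y"
    proof (rule ccontr)
      assume "\<not> t \<le> y"
      then have "of_int (i - k + n) * l < 0 * l" using yt by simp
      then have "i - k + n < 0" using l_pos by (simp only: mult_less_cancel_right_pos of_int_less_0_iff)
      then have "i - k + n \<le> - 1" by simp
      then have "real_of_int (i - k + n) \<le> of_int (- 1)" by (simp only: of_int_le_iff)
      then have "of_int (i - k + n) * l \<le> of_int (- 1) * l" using l_pos by (intro mult_right_mono) auto
      then show False using yt y t by simp
    qed
  qed
  moreover have "t \<noteq> 0"
  proof
    assume "t = 0"
    then have "left_foot \<gamma> = right_foot \<gamma>" using \<open>\<gamma> (a + t) = \<gamma> b\<close> a b by simp
    then show False using feet_differ by simp
  qed
  ultimately show ?thesis by simp
qed

end

theorem corollary7p2:
  fixes \<gamma> :: "real \<Rightarrow> complex set"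
  assumes "simple_closed_geodesic \<gamma>"
  shows "relative_twist \<gamma> \<noteq> 0"
proof -
  obtain l where "\<exists>c. lifts_to \<gamma> c" "l > 0" "\<And>t. \<gamma> (t + l) = \<gamma> t" "inj_on \<gamma> {0..<l}"
    using assms unfolding simple_closed_geodesic_def by blast
  then interpret closed_geodesic \<gamma> l by unfold_locales
  show ?thesis
    unfolding relative_twist_def geodesic_length_eq using absolute_twist_nonzero l_pos by simp
qed

end
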